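(* Let $N\ge 1$, $m\in(0,1)$, and $p>1$. (1) There exists a constant $C=C(N,m,p)>0$ such that the following holds. Let $T\in(0,\infty)$ and let $u$ be a solution to equation (E) in $\mathbb{R}^N\times(0,T)$. Then there exists a unique $\nu\in\mathcal{M}$ such that $$\operatorname*{ess\,lim}_{t\to+0}\int_{\mathbb{R}^N}u(x,t)\psi(x)\,dx=\int_{\mathbb{R}^N}\psi\,d\nu\quad\text{for all }\psi\in C_c(\mathbb{R}^N).$$ Furthermore, $$\begin{cases}\displaystyle\sup_{z\in\mathbb{R}^N}\nu(B(z,T^\theta))\le C\,T^{\theta\left(N-\frac{2}{p-m}\right)} & \text{if } 1<p<p_m,\\[2mm] \displaystyle\sup_{z\in\mathbb{R}^N}\nu(B(z,\sigma))\le C\left[\log\left(e+\frac{T^\theta}{\sigma}\right)\right]^{-\frac N2}\ \text{ for all }\sigma\in(0,T^\theta) & \text{if } p=p_m,\\[2mm] \displaystyle\sup_{z\in\mathbb{R}^N}\nu(B(z,\sigma))\le C\,\sigma^{N-\frac{2}{p-m}}\ \text{ for all }\sigma\in(0,T^\theta) & \text{if } p>p_m.\end{cases}$$ (2) Let $T\in(0,\infty]$, $\mu\in\mathcal{M}$, and let $u$ be a solution to problem (P) in $\mathbb{R}^N\times(0,T)$ with initial data $\mu$. Then $u$ is a solution to equation (E) in $\mathbb{R}^N\times(0,T)$, and the initial trace of $u$ coincides with $\mu$ in $\mathcal{M}$.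
   Context: Notation: $\mathcal{M}$ is the set of nonnegative Radon measures on $\mathbb{R}^N$; $B(z,r)=\{x\in\mathbb{R}^N:|x-z|<r\}$; $p_m:=m+\frac2N$; $\theta:=\frac{p-m}{2(p-1)}$. $C_c^{2;1}(\mathbb{R}^N\times[0,T))$ denotes the functions with compact support in $\mathbb{R}^N\times[0,T)$ that are $C^2$ in $x$ and $C^1$ in $t$. Equation (E): $\partial_t u=\Delta u^m+u^p$ in $\mathbb{R}^N\times(0,T)$. Problem (P): equation (E) together with $u(\cdot,0)=\mu$ in $\mathbb{R}^N$, where $\mu\in\mathcal{M}$. Definition of solutions: let $T\in(0,\infty]$ and let $u\in L^p_{\rm loc}(\mathbb{R}^N\times[0,T))$ be nonnegative in $\mathbb{R}^N\times(0,T)$. (i) $u$ is a solution to equation (E) in $\mathbb{R}^N\times(0,T)$ if $$\int_\tau^T\int_{\mathbb{R}^N}(-u\partial_t\phi-u^m\Delta\phi-u^p\phi)\,dx\,dt=\int_{\mathbb{R}^N}u(x,\tau)\phi(x,\tau)\,dx$$ for $\phi\in C_c^{2;1}(\mathbb{R}^N\times[0,T))$ and almost all $\tau\in(0,T)$. (ii) For $\mu\in\mathcal{M}$, $u$ is a solution to problem (P) in $\mathbb{R}^N\times(0,T)$ (with initial data $\mu$) if $$\int_0^T\int_{\mathbb{R}^N}(-u\partial_t\phi-u^m\Delta\phi-u^p\phi)\,dx\,dt=\int_{\mathbb{R}^N}\phi(x,0)\,d\mu(x)$$ for all $\phi\in C_c^{2;1}(\mathbb{R}^N\times[0,T))$.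 The initial trace of a solution $u$ to equation (E) is the measure $\nu\in\mathcal{M}$ with $\operatorname{ess\,lim}_{t\to+0}\int_{\mathbb{R}^N}u(x,t)\psi(x)\,dx=\int_{\mathbb{R}^N}\psi\,d\nu$ for all $\psi\in C_c(\mathbb{R}^N)$. *)

theory Defs
  imports "HOL-Analysis.Analysis"
begin

text \<open>
  The space \<open>\<real>\<^sup>N\<close> is an arbitrary type \<open>'a :: euclidean_space\<close> with \<open>N = DIM('a)\<close>.
  The final time is an extended real, so that \<open>T = \<infinity>\<close> is allowed.
\<close>

definition theta :: "real \<Rightarrow> real \<Rightarrow> real"
  where "theta m p = (p - m) / (2 * (p - 1))"

definition strip :: "ereal \<Rightarrow> ('a::euclidean_space \<times> real) set"
  where "strip T = {(x, t). 0 \<le> t \<and> ereal t < T}"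

definition radon :: "'a::euclidean_space measure \<Rightarrow> bool"
  where "radon \<mu> \<longleftrightarrow>
    sets \<mu> = sets borel \<and>
    (\<forall>K. compact K \<longrightarrow> emeasure \<mu> K < \<infinity>) \<and>
    (\<forall>B\<in>sets borel. emeasure \<mu> B = (SUP K\<in>{K. K \<subseteq> B \<and> compact K}. emeasure \<mu> K))"

definition Cc :: "('a::euclidean_space \<Rightarrow> real) \<Rightarrow> bool"
  where "Cc \<psi> \<longleftrightarrow> continuous_on UNIV \<psi> \<and> compact (closure (support_on UNIV \<psi>))"

definition pderiv_dir :: "'a::euclidean_space \<Rightarrow> ('a \<Rightarrow> real) \<Rightarrow> 'a \<Rightarrow> real"
  where "pderiv_dir b f x = deriv (\<lambda>h. f (x + h *\<^sub>R b)) 0"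

definition pdifferentiable_dir :: "'a::euclidean_space \<Rightarrow> ('a \<Rightarrow> real) \<Rightarrow> 'a \<Rightarrow> bool"
  where "pdifferentiable_dir b f x \<longleftrightarrow> (\<lambda>h. f (x + h *\<^sub>R b)) field_differentiable (at 0)"

definition laplacian :: "('a::euclidean_space \<Rightarrow> real) \<Rightarrow> 'a \<Rightarrow> real"
  where "laplacian f x = (\<Sum>b\<in>Basis. pderiv_dir b (pderiv_dir b f) x)"

text \<open>The derivative in \<open>t\<close> is one-sided at \<open>t = 0\<close> and two-sided for \<open>t > 0\<close>.\<close>

definition time_deriv :: "('a \<Rightarrow> real \<Rightarrow> real) \<Rightarrow> 'a \<Rightarrow> real \<Rightarrow> real"
  where "time_deriv \<phi> x t = vector_derivative (\<phi> x) (at t within {0..})"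

text \<open>
  Test functions matter only on \<open>strip T\<close>; their values elsewhere are arbitrary.
  As usual for the parabolic class, \<open>C\<^sup>2\<close> in \<open>x\<close> and \<open>C\<^sup>1\<close> in \<open>t\<close> means that \<open>\<phi>\<close> and the
  derivatives concerned are continuous in \<open>(x, t)\<close> jointly, up to \<open>t = 0\<close>.  The support may
  meet \<open>t = 0\<close> but stays away from \<open>t = T\<close>.
\<close>

definition test_fun :: "ereal \<Rightarrow> ('a::euclidean_space \<Rightarrow> real \<Rightarrow> real) \<Rightarrow> bool"
  where "test_fun T \<phi> \<longleftrightarrow>
    (let S = strip T; supp = closure (support_on S (\<lambda>(x, t). \<phi> x t)) in
      compact supp \<and> supp \<subseteq> S \<and>
      continuous_on S (\<lambda>(x, t). \<phi> x t) \<and>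
      (\<forall>(x, t)\<in>S. \<phi> x differentiable (at t within {0..})) \<and>
      continuous_on S (\<lambda>(x, t). time_deriv \<phi> x t) \<and>
      (\<forall>b\<in>Basis.
        (\<forall>(x, t)\<in>S. pdifferentiable_dir b (\<lambda>y. \<phi> y t) x) \<and>
        continuous_on S (\<lambda>(x, t). pderiv_dir b (\<lambda>y. \<phi> y t) x)) \<and>
      (\<forall>b\<in>Basis. \<forall>c\<in>Basis.
        (\<forall>(x, t)\<in>S. pdifferentiable_dir c (pderiv_dir b (\<lambda>y. \<phi> y t)) x) \<and>
        continuous_on S (\<lambda>(x, t). pderiv_dir c (pderiv_dir b (\<lambda>y. \<phi> y t)) x)))"

definition Lp_loc :: "real \<Rightarrow> ereal \<Rightarrow> ('a::euclidean_space \<Rightarrow> real \<Rightarrow> real) \<Rightarrow> bool"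
  where "Lp_loc p T u \<longleftrightarrow>
    set_borel_measurable lebesgue (strip T) (\<lambda>(x, t). u x t) \<and>
    (\<forall>K. compact K \<and> K \<subseteq> strip T \<longrightarrow>
      set_integrable lebesgue K (\<lambda>(x, t). \<bar>u x t\<bar> powr p))"

text \<open>
  Elements of \<open>L\<^sup>p\<^sub>l\<^sub>o\<^sub>c\<close> are given by representatives, so nonnegativity is required almost everywhere.
\<close>

definition admissible :: "real \<Rightarrow> ereal \<Rightarrow> ('a::euclidean_space \<Rightarrow> real \<Rightarrow> real) \<Rightarrow> bool"
  where "admissible p T u \<longleftrightarrow>
    Lp_loc p T u \<and>
    (AE (x, t) in lebesgue. 0 < t \<and> ereal t < T \<longrightarrow> 0 \<le> u x t)"

text \<open>
  The integral over \<open>\<real>\<^sup>N \<times> (\<tau>, T)\<close> in the weak formulation.  For admissible \<open>u\<close>, test functions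
  \<open>\<phi>\<close> and \<open>0 < m \<le> p\<close>, \<open>1 \<le> p\<close>, the integrand is integrable there, because
  \<open>u\<close> and \<open>u\<^sup>m\<close> are bounded by \<open>1 + u\<^sup>p\<close>.
\<close>

definition weak_integral ::
  "real \<Rightarrow> real \<Rightarrow> real \<Rightarrow> ereal \<Rightarrow> ('a::euclidean_space \<Rightarrow> real \<Rightarrow> real) \<Rightarrow>
    ('a \<Rightarrow> real \<Rightarrow> real) \<Rightarrow> real"
  where "weak_integral m p \<tau> T u \<phi> =
    (LINT t:{t. \<tau> < t \<and> ereal t < T}|lebesgue. LINT x|lebesgue.
      - u x t * time_deriv \<phi> x t
      - u x t powr m * laplacian (\<lambda>y. \<phi> y t) x
      - u x t powr p * \<phi> x t)"

definition solution_E ::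
  "real \<Rightarrow> real \<Rightarrow> ereal \<Rightarrow> ('a::euclidean_space \<Rightarrow> real \<Rightarrow> real) \<Rightarrow> bool"
  where "solution_E m p T u \<longleftrightarrow>
    admissible p T u \<and>
    (\<forall>\<phi>. test_fun T \<phi> \<longrightarrow>
      (AE \<tau> in lebesgue. 0 < \<tau> \<and> ereal \<tau> < T \<longrightarrow>
        weak_integral m p \<tau> T u \<phi> = (LINT x|lebesgue. u x \<tau> * \<phi> x \<tau>)))"

definition solution_P ::
  "real \<Rightarrow> real \<Rightarrow> ereal \<Rightarrow> 'a::euclidean_space measure \<Rightarrow> ('a \<Rightarrow> real \<Rightarrow> real) \<Rightarrow> bool"
  where "solution_P m p T \<mu> u \<longleftrightarrow>
    admissible p T u \<and>
    (\<forall>\<phi>. test_fun T \<phi> \<longrightarrow> weak_integral m p 0 T u \<phi> = (LINT x|\<mu>. \<phi> x 0))"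

definition ess_lim_0 :: "(real \<Rightarrow> real) \<Rightarrow> real \<Rightarrow> bool"
  where "ess_lim_0 f l \<longleftrightarrow>
    (\<forall>\<epsilon>>0. \<exists>\<delta>>0. AE t in lebesgue. 0 < t \<and> t < \<delta> \<longrightarrow> \<bar>f t - l\<bar> < \<epsilon>)"

definition initial_trace ::
  "('a::euclidean_space \<Rightarrow> real \<Rightarrow> real) \<Rightarrow> 'a measure \<Rightarrow> bool"
  where "initial_trace u \<nu> \<longleftrightarrow>
    radon \<nu> \<and>
    (\<forall>\<psi>. Cc \<psi> \<longrightarrow> ess_lim_0 (\<lambda>t. LINT x|lebesgue. u x t * \<psi> x) (LINT x|\<nu>. \<psi> x))"

end

(*
  Fix a test function phi.  Since u^p is integrable up to t = 0, the weak identity makes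
  t |-> int u(x,t) phi(x,t) dx converge essentially as t tends to 0.  Taking phi = psi(x) zeta(t) and
  approximating psi in C_c by C^2 functions (Stone-Weierstrass times a fixed cutoff), the limit is a
  positive linear functional on C_c, so the Riesz theorem yields the trace.

  For the bounds, test with phi = (1 - log rho / L)_+^k, rho = 1 + |x-z|^2/sigma^2 + (t/tau)^(2 theta).
  Young's inequality absorbs u and u^m into u^p phi and leaves the integral of a multiple of
  rho^(-p/(p-m)) over {rho < e^L}, which is summed over the shells e^j <= rho < e^(j+1).  For p <> p_m
  a fixed L and tau = a sigma^(1/theta) suffice.  For p = p_m every shell contributes equally, and
  L ~ log(e + T^theta/sigma) together with tau = a L^(-(1-m)N/2) sigma^(1/theta) gives the power -N/2
  of the logarithm.

  For (2), testing with phi(x,t) zeta(t) and varying zeta recovers the identity of (E) for almost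
  every tau, by the fundamental lemma of the calculus of variations.
*)
theory Submission
  imports Defs
begin


section \<open>The Riesz representation theorem\<close>

text \<open>Why these exponents: the first derivative of the logarithmic cut-off brings a factor
  1/(L rho). With beta = 2 theta = (p - m)/(p - 1), the time derivative of rho adds at most rho^(1 -
  1/beta) up to constants, so the coefficient of u decays like rho^(-1/beta), while that of u^m
  decays like rho^(-1). The conjugate exponents p/(p - 1) and p/(p - m) turn both into the same
  power rho^(-p/(p - m)). The set rho < e^(j+1) has volume of order e^(j (N/2 + 1/beta)), and N/2 +
  1/beta - p/(p - m) = N/2 - 1/(p - m) vanishes exactly at p = p_m.

  The obstacle for the trace is that the exceptional set of times depends on the test function.
  Essential limits are therefore taken along a filter. Approximation errors are bounded by a
  multiple of one fixed nonnegative C^2 function with compact support, whose own pairing with u is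
  already known to converge; this supplies the local mass bound near t = 0 that a uniform error
  would still lack.\<close>

lemma Cc_iff:
  "Cc \<psi> \<longleftrightarrow> continuous_on UNIV \<psi> \<and> (\<exists>R. \<forall>x. R < norm x \<longrightarrow> \<psi> x = 0)"
proof -
  have "compact (closure (support_on UNIV \<psi>)) \<longleftrightarrow> bounded (support_on UNIV \<psi>)"
    by simp
  also have "\<dots> \<longleftrightarrow> (\<exists>R. \<forall>x. R < norm x \<longrightarrow> \<psi> x = 0)"
    unfolding bounded_iff support_on_def by (auto simp: not_less[symmetric])
  finally show ?thesis by (simp add: Cc_def)
qed

lemma Cc_continuous: "Cc \<psi> \<Longrightarrow> continuous_on S \<psi>"
  using continuous_on_subset by (auto simp: Cc_def)

lemma Cc_measurable: "Cc f \<Longrightarrow> f \<in> borel_measurable borel"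
  by (intro borel_measurable_continuous_onI Cc_continuous)

lemma Cc_add: "Cc f \<Longrightarrow> Cc g \<Longrightarrow> Cc (\<lambda>x. f x + g x)"
  unfolding Cc_iff
proof (elim conjE exE, intro conjI)
  fix R1 R2 assume "\<forall>x. R1 < norm x \<longrightarrow> f x = 0" "\<forall>x. R2 < norm x \<longrightarrow> g x = 0"
  then show "\<exists>R. \<forall>x. R < norm x \<longrightarrow> f x + g x = 0" by (intro exI[of _ "max R1 R2"]) auto
qed (auto intro: continuous_intros)

lemma Cc_mult: "Cc f \<Longrightarrow> continuous_on UNIV g \<Longrightarrow> Cc (\<lambda>x. f x * g x)"
  unfolding Cc_iff by (auto intro!: continuous_intros)

lemma Cc_cmult: "Cc f \<Longrightarrow> Cc (\<lambda>x. c * f x)"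
  using Cc_mult[of f "\<lambda>_. c"] by (simp add: mult.commute)

lemma Cc_diff: "Cc f \<Longrightarrow> Cc g \<Longrightarrow> Cc (\<lambda>x. f x - g x)"
  using Cc_add[of f "\<lambda>x. - 1 * g x"] Cc_cmult[of g "-1"] by simp

lemma Cc_compose:
  assumes "Cc f" "continuous_on UNIV g" "g 0 = (0::real)"
  shows "Cc (\<lambda>x. g (f x))"
  using assms continuous_on_compose2[of UNIV g UNIV f] unfolding Cc_iff by (auto; metis)

lemma Cc_zero: "Cc (\<lambda>_. 0)"
  by (auto simp: Cc_iff)

lemma Cc_sum: "(\<And>i. i \<in> I \<Longrightarrow> Cc (f i)) \<Longrightarrow> Cc (\<lambda>x. \<Sum>i\<in>I. f i x)"
  by (induction I rule: infinite_finite_induct) (auto intro: Cc_zero Cc_add)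

lemma Cc_plateau:
  "\<exists>\<eta>::'a::euclidean_space \<Rightarrow> real. Cc \<eta> \<and> (\<forall>x. 0 \<le> \<eta> x) \<and> (\<forall>x. norm x \<le> R \<longrightarrow> \<eta> x = 1)"
proof (intro exI conjI)
  let ?\<eta> = "\<lambda>x::'a. max 0 (min 1 (R + 1 - norm x))"
  show "Cc ?\<eta>"
    unfolding Cc_iff by (auto intro!: continuous_intros exI[of _ "R+1"])
qed auto

lemma Cc_bounded: assumes "Cc (f::'a::euclidean_space \<Rightarrow> real)" obtains B where "B > 0" "\<And>x. \<bar>f x\<bar> \<le> B"
proof -
  obtain R where R: "\<And>x. R < norm x \<Longrightarrow> f x = 0" using assms by (auto simp: Cc_iff)
  have "bounded (f ` cball 0 R)"
    by (intro compact_imp_bounded compact_continuous_image Cc_continuous assms compact_cball)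
  then obtain B where "\<forall>y\<in>f ` cball 0 R. norm y \<le> B" by (auto simp only: bounded_iff)
  then have B: "\<And>x. norm x \<le> R \<Longrightarrow> \<bar>f x\<bar> \<le> B" by simp
  show thesis
  proof (rule that[of "max B 1"])
    fix x show "\<bar>f x\<bar> \<le> max B 1"
      by (cases "norm x \<le> R") (use B[of x] R[of x] in auto)
  qed simp
qed

text \<open>Phrased through finiteness on compact sets, so that it serves the Riesz measure, Radon
  measures and \<open>lborel\<close> alike.\<close>

lemma Cc_integrable:
  fixes f :: "'a::euclidean_space \<Rightarrow> real"
  assumes f: "Cc f" and \<nu>: "sets \<nu> = sets borel" "\<And>K. compact K \<Longrightarrow> emeasure \<nu> K < \<infinity>"
  shows "integrable \<nu> f"
proof -
  obtain R where R: "\<And>x. R < norm x \<Longrightarrow> f x = 0" using f by (auto simp: Cc_iff)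
  obtain B where B: "B > 0" "\<And>x. \<bar>f x\<bar> \<le> B" using Cc_bounded[OF f] by metis
  have "f \<in> borel_measurable borel"
    by (rule Cc_measurable[OF f])
  then have m: "f \<in> borel_measurable \<nu>"
    using measurable_cong_sets[OF \<nu>(1) refl] by blast
  show ?thesis
  proof (rule integrableI_bounded_set[of "cball 0 R" \<nu> f B])
    show "cball 0 R \<in> sets \<nu>" by (simp add: \<nu>(1))
    show "AE x in \<nu>. x \<in> cball 0 R \<longrightarrow> norm (f x) \<le> B" using B by simp
    show "AE x in \<nu>. x \<notin> cball 0 R \<longrightarrow> f x = 0" using R by simp
  qed (use m \<nu>(2)[OF compact_cball] in auto)
qed

lemma suminf_prod_decode_ennreal:
  fixes h :: "nat \<Rightarrow> nat \<Rightarrow> ennreal"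
  shows "(\<Sum>n. case prod_decode n of (i, j) \<Rightarrow> h i j) = (\<Sum>i. \<Sum>j. h i j)"
  using suminf_ennreal_2dimen[of "\<lambda>i. \<Sum>j. h i j" "\<lambda>(i,j). h i j"] by simp

section \<open>Positive functionals on C_c and the outer measure they induce\<close>

locale positive_functional =
  fixes \<Lambda> :: "('a::euclidean_space \<Rightarrow> real) \<Rightarrow> real"
  assumes add: "Cc f \<Longrightarrow> Cc g \<Longrightarrow> \<Lambda> (\<lambda>x. f x + g x) = \<Lambda> f + \<Lambda> g"
    and scale: "Cc f \<Longrightarrow> \<Lambda> (\<lambda>x. c * f x) = c * \<Lambda> f"
    and nonneg: "Cc f \<Longrightarrow> (\<And>x. 0 \<le> f x) \<Longrightarrow> 0 \<le> \<Lambda> f"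
begin

lemma zero: "\<Lambda> (\<lambda>_. 0) = 0"
  using scale[of "\<lambda>_. 0" 0] Cc_zero by simp

lemma diff: "Cc f \<Longrightarrow> Cc g \<Longrightarrow> \<Lambda> (\<lambda>x. f x - g x) = \<Lambda> f - \<Lambda> g"
  using add[of f "\<lambda>x. -1 * g x"] scale[of g "-1"] Cc_cmult[of g "-1"] by simp

lemma mono: "Cc f \<Longrightarrow> Cc g \<Longrightarrow> (\<And>x. f x \<le> g x) \<Longrightarrow> \<Lambda> f \<le> \<Lambda> g"
  using nonneg[of "\<lambda>x. g x - f x"] diff[of g f] Cc_diff[of g f] by simp

lemma sum: "(\<And>i. i \<in> I \<Longrightarrow> Cc (f i)) \<Longrightarrow> \<Lambda> (\<lambda>x. \<Sum>i\<in>I. f i x) = (\<Sum>i\<in>I. \<Lambda> (f i))"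
  by (induction I rule: infinite_finite_induct) (auto simp: zero add Cc_sum)

definition pos :: "(nat \<Rightarrow> 'a \<Rightarrow> real) \<Rightarrow> bool"
  where "pos f \<longleftrightarrow> (\<forall>n. Cc (f n) \<and> (\<forall>x. 0 \<le> f n x))"

text \<open>Countable sums of functions replace coverings by open sets. Merging and cutting covers
  then takes place inside C_c, where \<Lambda> acts; the sums live in \<open>ennreal\<close> because
  they may diverge.\<close>

definition covers :: "'a set \<Rightarrow> (nat \<Rightarrow> 'a \<Rightarrow> real) set"
  where "covers E = {f. pos f \<and> (\<forall>x\<in>E. 1 \<le> (\<Sum>n. ennreal (f n x)))}"

definition cost :: "(nat \<Rightarrow> 'a \<Rightarrow> real) \<Rightarrow> ennreal"
  where "cost f = (\<Sum>n. ennreal (\<Lambda> (f n)))"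

definition outer :: "'a set \<Rightarrow> ennreal"
  where "outer E = (INF f\<in>covers E. cost f)"

lemma outer_le: "f \<in> covers E \<Longrightarrow> outer E \<le> cost f"
  unfolding outer_def by (rule INF_lower)

lemma le_outer: "(\<And>f. f \<in> covers E \<Longrightarrow> c \<le> cost f) \<Longrightarrow> c \<le> outer E"
  unfolding outer_def by (rule INF_greatest)

lemma pos_\<Lambda>: "pos f \<Longrightarrow> 0 \<le> \<Lambda> (f n)"
  by (auto simp: pos_def intro: nonneg)

text \<open>Flattening by \<open>prod_decode\<close> keeps the total cost and the pointwise sums,
  because nonnegative terms may be rearranged. Countable subadditivity and the splitting along
  closed sets both rest on it.\<close>

lemma merge:
  assumes "\<And>i. pos (f i)"
  defines "F \<equiv> \<lambda>n. case prod_decode n of (i, j) \<Rightarrow> f i j"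
  shows "pos F" "cost F = (\<Sum>i. cost (f i))"
    "(\<Sum>n. ennreal (F n x)) = (\<Sum>i. \<Sum>j. ennreal (f i j x))"
proof -
  show "pos F" using assms by (auto simp: pos_def split: prod.split)
  have "(\<Sum>n. ennreal (F n x)) = (\<Sum>n. case prod_decode n of (i, j) \<Rightarrow> ennreal (f i j x))"
    by (intro arg_cong[where f=suminf] ext) (auto simp: F_def split: prod.split)
  then show "(\<Sum>n. ennreal (F n x)) = (\<Sum>i. \<Sum>j. ennreal (f i j x))"
    by (simp add: suminf_prod_decode_ennreal)
  have "cost F = (\<Sum>n. case prod_decode n of (i, j) \<Rightarrow> ennreal (\<Lambda> (f i j)))"
    unfolding cost_def by (intro arg_cong[where f=suminf] ext) (auto simp: F_def split: prod.split)
  then show "cost F = (\<Sum>i. cost (f i))"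
    by (simp add: suminf_prod_decode_ennreal cost_def)
qed

lemma outer_mono: "A \<subseteq> B \<Longrightarrow> outer A \<le> outer B"
  by (intro le_outer outer_le) (auto simp: covers_def)

lemma outer_empty: "outer {} = 0"
proof -
  have "(\<lambda>_ _. 0) \<in> covers {}" by (auto simp: covers_def pos_def Cc_zero)
  from outer_le[OF this] show ?thesis by (simp add: cost_def zero)
qed

lemma outer_UN_le: "outer (\<Union>i. A i) \<le> (\<Sum>i. outer (A i))"
proof (rule ennreal_le_epsilon)
  fix e :: real assume fin: "(\<Sum>i. outer (A i)) < top" and e: "0 < e"
  \<comment> \<open>Finiteness of the sum makes each \<open>outer (A i)\<close> finite, which leaves
    strict room for an excess; the excesses add up to e.\<close>
  have "\<exists>f\<in>covers (A i). cost f < outer (A i) + ennreal (e * (1/2)^Suc i)" for i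
  proof -
    have "outer (A i) < top"
      using fin by (metis ennreal_suminf_lessD)
    then have "outer (A i) < outer (A i) + ennreal (e * (1/2)^Suc i)"
      using e by (auto simp: ennreal_add_eq_top intro: ennreal_less_top intro!: ennreal_add_left_cancel_less[THEN iffD2, of _ 0, simplified])
    then show ?thesis unfolding outer_def[of "A i"] INF_less_iff by simp
  qed
  then obtain f where f: "\<And>i. f i \<in> covers (A i)" "\<And>i. cost (f i) < outer (A i) + ennreal (e * (1/2)^Suc i)"
    by metis
  define F where "F = (\<lambda>n. case prod_decode n of (i, j) \<Rightarrow> f i j)"
  have p: "pos (f i)" for i using f(1) by (auto simp: covers_def)
  have "1 \<le> (\<Sum>n. ennreal (F n x))" if "x \<in> A i" for x i
  proof -
    have "1 \<le> (\<Sum>j. ennreal (f i j x))" using f(1)[of i] that by (auto simp: covers_def)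
    also have "\<dots> \<le> (\<Sum>i. \<Sum>j. ennreal (f i j x))"
      using sum_le_suminf[of "\<lambda>i. \<Sum>j. ennreal (f i j x)" "{i}"] by simp
    finally show ?thesis using merge(3)[of f, OF p] by (simp add: F_def)
  qed
  then have "F \<in> covers (\<Union>i. A i)"
    using merge(1)[of f, OF p] by (auto simp: covers_def F_def)
  from outer_le[OF this] have "outer (\<Union>i. A i) \<le> (\<Sum>i. cost (f i))"
    using merge(2)[of f, OF p] by (simp add: F_def)
  also have "\<dots> \<le> (\<Sum>i. outer (A i) + ennreal (e * (1/2)^Suc i))"
    by (intro suminf_le less_imp_le f) auto
  also have "\<dots> = (\<Sum>i. outer (A i)) + (\<Sum>i. ennreal (e * (1/2)^Suc i))"
    by (intro suminf_add[symmetric]) auto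
  also have "(\<Sum>i. ennreal (e * (1/2)^Suc i)) = ennreal e"
    using sums_mult[OF power_half_series, of e] e
    by (intro suminf_ennreal_eq) auto
  finally show "outer (\<Union>i. A i) \<le> (\<Sum>i. outer (A i)) + ennreal e" .
qed


lemma outer_Un_le: "outer (A \<union> B) \<le> outer A + outer B"
proof -
  let ?A = "\<lambda>i::nat. if i = 0 then A else if i = 1 then B else {}"
  have "A \<union> B = (\<Union>i. ?A i)" by (auto split: if_splits)
  then have "outer (A \<union> B) \<le> (\<Sum>i. outer (?A i))" using outer_UN_le[of ?A] by simp
  also have "\<dots> = (\<Sum>i\<in>{0,1}. outer (?A i))"
    by (intro suminf_finite) (auto simp: outer_empty)
  finally show ?thesis by simp
qed

text \<open>The functions \<open>h j\<close> decrease to the indicator of \<open>F\<close>, so the differences \<open>f n * (h j - h (Suc j))\<close>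
  cover \<open>E - F\<close> while \<open>f n * h k\<close> covers \<open>E \<inter> F\<close>; both together cost no more than \<open>f\<close>.\<close>

lemma outer_split_closed:
  assumes F: "closed F" "F \<noteq> {}"
  shows "outer (E \<inter> F) + outer (E - F) \<le> outer E"
proof (rule le_outer)
  fix f assume f: "f \<in> covers E"
  then have p: "\<And>n. Cc (f n)" "\<And>n x. 0 \<le> f n x" by (auto simp: covers_def pos_def)
  define h where "h j x = max 0 (1 - real j * infdist x F)" for j x
  have hcont: "continuous_on UNIV (h j)" for j
    unfolding h_def by (intro continuous_intros)
  have h0: "h 0 x = 1" and hnn: "0 \<le> h j x" and hF: "x \<in> F \<Longrightarrow> h j x = 1" for j x
    by (auto simp: h_def)
  have hdec: "h (Suc j) x \<le> h j x" for j x
    unfolding h_def by (intro max.mono diff_mono mult_right_mono) (auto simp: infdist_nonneg)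
  have hlim: "(\<lambda>j. h j x) \<longlonglongrightarrow> 0" if "x \<notin> F" for x
  proof (rule tendsto_eventually)
    have pos: "infdist x F > 0"
      using that F in_closed_iff_infdist_zero[of F x] infdist_nonneg[of x F] by auto
    obtain N where N: "1 / infdist x F < real N" using reals_Archimedean2 by blast
    show "\<forall>\<^sub>F j in sequentially. h j x = 0"
      using eventually_ge_at_top[of N]
    proof eventually_elim
      fix j assume "N \<le> j"
      then have "1 / infdist x F < real j" using N by linarith
      then show "h j x = 0" using pos by (simp add: h_def field_simps)
    qed
  qed
  define d where "d j n x = f n x * (h j x - h (Suc j) x)" for j n x
  have dCc: "Cc (d j n)" for j n unfolding d_def
    by (intro Cc_mult p continuous_intros hcont)
  have dpos: "pos (d j)" for j
    unfolding pos_def using dCc p hdec by (auto simp: d_def)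
  have fhCc: "Cc (\<lambda>x. f n x * h k x)" for n k by (intro Cc_mult p hcont)
  have fhpos: "pos (\<lambda>n x. f n x * h k x)" for k
    unfolding pos_def using fhCc p hnn by auto
  have 1: "outer (E - F) \<le> (\<Sum>j. cost (d j))"
  proof -
    let ?G = "\<lambda>n. case prod_decode n of (j, i) \<Rightarrow> d j i"
    have "1 \<le> (\<Sum>n. ennreal (?G n x))" if x: "x \<in> E" "x \<notin> F" for x
    proof -
      have "(\<lambda>j. h j x - h (Suc j) x) sums (h 0 x - 0)"
        by (rule telescope_sums'[OF hlim[OF x(2)]])
      then have "(\<lambda>j. d j n x) sums (f n x)" for n
        unfolding d_def using sums_mult[of _ 1 "f n x"] h0 by fastforce
      then have s: "(\<Sum>j. ennreal (d j n x)) = ennreal (f n x)" for n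
        using dpos by (intro suminf_ennreal_eq) (auto simp: pos_def)
      have "1 \<le> (\<Sum>n. ennreal (f n x))" using f x by (auto simp: covers_def)
      also have "\<dots> = (\<Sum>n. \<Sum>j. ennreal (d j n x))" by (simp add: s)
      \<comment> \<open>The sums are exchanged by reading one of them as an integral over the
        counting measure.\<close>
      also have "\<dots> = (\<Sum>j. \<Sum>n. ennreal (d j n x))"
        using nn_integral_count_space_nat[of "\<lambda>n. \<Sum>j. ennreal (d j n x)"] 
          nn_integral_suminf[of "\<lambda>j n. ennreal (d j n x)" "count_space UNIV"]
        by (simp add: nn_integral_count_space_nat)
      finally show ?thesis using merge(3)[of d, OF dpos] by simp
    qed
    then have "?G \<in> covers (E - F)"
      using merge(1)[of d, OF dpos] by (auto simp: covers_def)
    from outer_le[OF this] show ?thesis using merge(2)[of d, OF dpos] by simp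
  qed
  have 2: "outer (E \<inter> F) \<le> cost (\<lambda>n x. f n x * h k x)" for k
    using f fhpos hF by (intro outer_le) (auto simp: covers_def)
  \<comment> \<open>Invariant of the telescoping: the pieces cut off in the first k steps and the
    remainder \<open>f n * h k\<close> always add up to f, because \<open>h 0\<close> is 1.\<close>
  have 3: "cost (\<lambda>n x. f n x * h k x) + (\<Sum>j<k. cost (d j)) = cost f" for k
  proof (induction k)
    case (Suc k)
    have "\<Lambda> (\<lambda>x. f n x * h k x) = \<Lambda> (\<lambda>x. f n x * h (Suc k) x) + \<Lambda> (d k n)" for n
      using add[OF fhCc[of n "Suc k"] dCc[of k n]] by (simp add: d_def algebra_simps)
    then have "ennreal (\<Lambda> (\<lambda>x. f n x * h k x)) = ennreal (\<Lambda> (\<lambda>x. f n x * h (Suc k) x)) + ennreal (\<Lambda> (d k n))" for n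
      using pos_\<Lambda>[OF fhpos[of "Suc k"], of n] pos_\<Lambda>[OF dpos[of k], of n] by simp
    then have "cost (\<lambda>n x. f n x * h k x) = cost (\<lambda>n x. f n x * h (Suc k) x) + cost (d k)"
      unfolding cost_def by (subst suminf_add) auto
    then show ?case using Suc by (simp add: ac_simps)
  qed (simp add: h0)
  have "outer (E \<inter> F) + (\<Sum>j. cost (d j)) \<le> cost f"
  proof (rule LIMSEQ_le_const2)
    show "(\<lambda>k. outer (E \<inter> F) + (\<Sum>j<k. cost (d j))) \<longlonglongrightarrow> outer (E \<inter> F) + (\<Sum>j. cost (d j))"
      by (intro tendsto_add tendsto_const summable_LIMSEQ) auto
    show "\<exists>N. \<forall>k\<ge>N. outer (E \<inter> F) + (\<Sum>j<k. cost (d j)) \<le> cost f"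
      using add_right_mono[OF 2] 3 by metis
  qed
  then show "outer (E \<inter> F) + outer (E - F) \<le> cost f"
    using 1 by (meson add_left_mono order_trans)
qed

lemma outer_upper:
  assumes "Cc g" "\<And>x. 0 \<le> g x" "\<And>x. x \<in> E \<Longrightarrow> 1 \<le> g x"
  shows "outer E \<le> ennreal (\<Lambda> g)"
proof -
  let ?f = "\<lambda>n::nat. if n = 0 then g else (\<lambda>_. 0)"
  have s: "(\<Sum>n. if n = 0 then c else 0) = c" for c :: ennreal
    by (subst suminf_finite[of "{0}"]) auto
  have e: "ennreal (?f n x) = (if n = 0 then ennreal (g x) else 0)" for n x by simp
  have "?f \<in> covers E"
    using assms by (auto simp: covers_def pos_def Cc_zero e s simp del: if_distrib)
  moreover have "cost ?f = (\<Sum>n. if n = 0 then ennreal (\<Lambda> g) else 0)"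
    unfolding cost_def by (intro arg_cong[where f=suminf] ext) (auto simp: zero)
  ultimately show ?thesis using outer_le by (metis s)
qed

text \<open>Compactness in the manner of Dini: at each point some finite partial sum of the cover
  exceeds g - \<epsilon>, and partial sums increase, so one stage M works on a ball containing the
  support of g. The plateau \<eta> turns the loss of \<epsilon> into a function of C_c, to which
  \<Lambda> applies.\<close>

lemma outer_lower:
  assumes g: "Cc g" "\<And>x. 0 \<le> g x" "\<And>x. g x \<le> 1" "\<And>x. x \<notin> E \<Longrightarrow> g x = 0"
  shows "ennreal (\<Lambda> g) \<le> outer E"
proof (rule le_outer)
  fix f assume f: "f \<in> covers E"
  then have pf: "pos f" and p: "\<And>n. Cc (f n)" "\<And>n x. 0 \<le> f n x" by (auto simp: covers_def pos_def)
  obtain R where R: "\<And>x. R < norm x \<Longrightarrow> g x = 0" using g(1) by (auto simp: Cc_iff)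
  obtain \<eta> where \<eta>: "Cc \<eta>" "\<And>x. 0 \<le> \<eta> x" "\<And>x::'a. norm x \<le> R \<Longrightarrow> \<eta> x = 1"
    using Cc_plateau[of R] by metis
  have main: "ennreal (\<Lambda> g) \<le> cost f + ennreal (\<epsilon> * \<Lambda> \<eta>)" if \<epsilon>: "\<epsilon> > 0" for \<epsilon>
  proof -
    let ?U = "\<lambda>M. {x. g x - \<epsilon> < (\<Sum>i<M. f i x)}"
    have op: "open (?U M)" for M
      by (intro open_Collect_less continuous_intros Cc_continuous g p)
    have cov: "\<exists>M. x \<in> ?U M" for x
    proof (cases "x \<in> E")
      case True
      then have "1 \<le> (\<Sum>n. ennreal (f n x))" using f by (auto simp: covers_def)
      moreover have "ennreal (g x - \<epsilon>) < 1" using g(3)[of x] \<epsilon> 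
        by (metis add.commute diff_less_eq ennreal_1 ennreal_less_iff less_add_same_cancel1 linorder_not_less order_less_le_trans zero_less_one ennreal_neg ennreal_zero_less_one nle_le)
      ultimately have "ennreal (g x - \<epsilon>) < (\<Sum>n. ennreal (f n x))" by order
      moreover have "(\<lambda>M. \<Sum>i<M. ennreal (f i x)) \<longlonglongrightarrow> (\<Sum>n. ennreal (f n x))"
        by (intro summable_LIMSEQ) auto
      ultimately have "\<forall>\<^sub>F M in sequentially. ennreal (g x - \<epsilon>) < (\<Sum>i<M. ennreal (f i x))"
        by (rule order_tendstoD(1)[rotated])
      then obtain M where "ennreal (g x - \<epsilon>) < (\<Sum>i<M. ennreal (f i x))"
        by (auto simp: eventually_sequentially)
      then have "ennreal (g x - \<epsilon>) < ennreal (\<Sum>i<M. f i x)"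
        using p by (simp add: sum_ennreal)
      then have "g x - \<epsilon> < (\<Sum>i<M. f i x)"
        by (metis ennreal_leI linorder_not_less)
      then show ?thesis by auto
    next
      case False
      \<comment> \<open>Off E the function g is 0, so already the empty sum exceeds g x -
        \<epsilon>.\<close>
      then show ?thesis using g(4)[of x] \<epsilon> by (intro exI[of _ 0]) auto
    qed
    obtain C where C: "C \<subseteq> UNIV" "finite C" "cball 0 R \<subseteq> (\<Union>M\<in>C. ?U M)"
      by (rule compactE_image[OF compact_cball, of UNIV ?U 0 R]) (use op cov in auto)
    define M where "M = Max (insert 0 C)"
    have CM: "j \<le> M" if "j \<in> C" for j using C(2) that by (simp add: M_def)
    have ge: "g x \<le> (\<Sum>i<M. f i x) + \<epsilon> * \<eta> x" for x
    proof (cases "norm x \<le> R")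
      case True
      then have "x \<in> (\<Union>M\<in>C. ?U M)" using C(3) by (meson mem_cball_0 subsetD)
      then obtain j where j: "j \<in> C" "g x - \<epsilon> < (\<Sum>i<j. f i x)" by blast
      have "(\<Sum>i<j. f i x) \<le> (\<Sum>i<M. f i x)"
        using CM[OF j(1)] p by (intro sum_mono2) auto
      then show ?thesis using j \<eta>(3)[OF True] by simp
    next
      case False
      then show ?thesis using R[of x] \<eta>(2)[of x] \<epsilon> p by (auto intro!: add_nonneg_nonneg sum_nonneg)
    qed
    have "\<Lambda> g \<le> \<Lambda> (\<lambda>x. (\<Sum>i<M. f i x) + \<epsilon> * \<eta> x)"
      by (intro mono ge g Cc_add Cc_sum Cc_cmult p \<eta>)
    also have "\<dots> = (\<Sum>i<M. \<Lambda> (f i)) + \<epsilon> * \<Lambda> \<eta>"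
      by (simp add: add Cc_sum Cc_cmult p \<eta> sum scale)
    finally have "ennreal (\<Lambda> g) \<le> ennreal (\<Sum>i<M. \<Lambda> (f i)) + ennreal (\<epsilon> * \<Lambda> \<eta>)"
      using pos_\<Lambda>[OF pf] nonneg[OF \<eta>(1,2)] \<epsilon>
      by (metis (no_types, lifting) ennreal_leI ennreal_plus less_imp_le mult_nonneg_nonneg sum_nonneg)
    also have "ennreal (\<Sum>i<M. \<Lambda> (f i)) = (\<Sum>i<M. ennreal (\<Lambda> (f i)))"
      using pos_\<Lambda>[OF pf] by (simp add: sum_ennreal)
    also have "\<dots> \<le> cost f"
      unfolding cost_def by (intro sum_le_suminf) auto
    finally show ?thesis by (simp add: add_right_mono)
  qed
  show "ennreal (\<Lambda> g) \<le> cost f"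
  proof (rule ennreal_le_epsilon)
    fix e :: real assume e: "0 < e"
    have nn: "0 \<le> \<Lambda> \<eta>" using nonneg[OF \<eta>(1,2)] .
    \<comment> \<open>The 1 in the denominator covers the case \<Lambda> \<eta> = 0.\<close>
    have "ennreal (\<Lambda> g) \<le> cost f + ennreal (e / (\<Lambda> \<eta> + 1) * \<Lambda> \<eta>)"
      using nn e by (intro main) auto
    also have "\<dots> \<le> cost f + ennreal e"
      using nn e by (intro add_left_mono ennreal_leI) (simp add: field_simps)
    finally show "ennreal (\<Lambda> g) \<le> cost f + ennreal e" .
  qed
qed

text \<open>A discrete layer-cake decomposition: summand k holds the part of y between the heights k
  and k + 1.\<close>

lemma sum_layers:
  fixes y :: real
  assumes "0 \<le> y"
  shows "(\<Sum>k<K. min 1 (max 0 (y - real k))) = min y (real K)"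
  using assms by (induction K) auto

section \<open>Caratheodory measurability and the representing measure\<close>

lemma outer_space: "outer_measure_space (Pow UNIV) outer"
  unfolding outer_measure_space_def positive_def increasing_def countably_subadditive_def
  using outer_empty outer_mono outer_UN_le by auto

lemma closed_in_lambda_system:
  assumes "closed F"
  shows "F \<in> lambda_system UNIV (Pow UNIV) outer"
\<comment> \<open>The empty set is treated apart because \<open>infdist x {}\<close> is 0 by
  convention: the cut-offs of \<open>outer_split_closed\<close> would then stay equal to 1 instead
  of decreasing to the indicator.\<close>
proof (cases "F = {}")
  case True
  then show ?thesis by (auto simp: lambda_system_def outer_empty)
next
  case False
  have "outer (F \<inter> E) + outer (E - F) = outer E" for E
  proof (rule antisym)
    have "E = (F \<inter> E) \<union> (E - F)" by blast
    then show "outer E \<le> outer (F \<inter> E) + outer (E - F)" using outer_Un_le by metis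
  qed (use outer_split_closed[OF assms False, of E] in \<open>simp add: Int_commute\<close>)
  moreover have "(UNIV - F) \<inter> E = E - F" for E by blast
  ultimately show ?thesis by (auto simp: lambda_system_def)
qed

definition riesz_measure :: "'a measure"
  where "riesz_measure = measure_of UNIV (sets borel) outer"

lemma sets_riesz_measure [simp, measurable_cong]: "sets riesz_measure = sets borel"
  unfolding riesz_measure_def using sets.sigma_sets_eq[of "borel::'a measure"] by (simp add: sets_measure_of_conv)

lemma space_riesz_measure [simp]: "space riesz_measure = UNIV"
  unfolding riesz_measure_def by (simp add: space_measure_of_conv)

text \<open>\<open>measure_of\<close> returns \<open>outer\<close> only once \<open>outer\<close> is
  known to be a measure on the Borel sets. Closed sets lie in the Caratheodory system and generate
  the Borel sets, so the restriction of \<open>outer\<close> is one.\<close>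

lemma emeasure_riesz_measure: assumes "A \<in> sets borel" shows "emeasure riesz_measure A = outer A"
proof -
  interpret S: sigma_algebra UNIV "Pow (UNIV::'a set)" by (rule sigma_algebra_Pow)
  let ?L = "lambda_system UNIV (Pow UNIV) outer"
  have L: "measure_space UNIV ?L outer" by (rule S.caratheodory_lemma[OF outer_space])
  then have sL: "sigma_algebra UNIV ?L" by (simp add: measure_space_def)
  have "sets (borel::'a measure) = sigma_sets UNIV (Collect closed)"
    unfolding borel_eq_closed by simp
  also have "\<dots> \<subseteq> ?L"
    using closed_in_lambda_system by (intro sigma_algebra.sigma_sets_subset[OF sL]) auto
  finally have sub: "sets borel \<subseteq> ?L" .
  have "measure_space UNIV (sets borel) outer"
    by (rule measure_down[OF L]) (use sub sets.sigma_algebra_axioms[of "borel::'a measure"] in auto)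
  then have "positive (sets borel) outer" "countably_additive (sets borel) outer"
    by (auto simp: measure_space_def)
  then show ?thesis
    using assms emeasure_measure_of_sigma[of UNIV "sets borel" outer A] sets.sigma_algebra_axioms[of "borel::'a measure"]
    by (simp add: riesz_measure_def)
qed

lemma riesz_measure_compact: assumes "compact K" shows "emeasure riesz_measure K < \<infinity>"
proof -
  obtain R where R: "K \<subseteq> cball 0 R"
    using compact_imp_bounded[OF assms] by (auto simp: bounded_iff subset_eq)
  obtain \<eta> where \<eta>: "Cc \<eta>" "\<And>x. 0 \<le> \<eta> x" "\<And>x::'a. norm x \<le> R \<Longrightarrow> \<eta> x = 1"
    using Cc_plateau[of R] by metis
  have "outer K \<le> ennreal (\<Lambda> \<eta>)"
    using R \<eta> by (intro outer_upper) auto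
  then show ?thesis
    using assms by (simp add: emeasure_riesz_measure compact_imp_closed order_le_less_trans)
qed

lemma integrable_riesz_measure: "Cc f \<Longrightarrow> integrable riesz_measure f"
  by (rule Cc_integrable) (use riesz_measure_compact in auto)

text \<open>For layer k of n f, both the integral and the value of \<Lambda> lie between the
  measures of the sets n f > k + 1 and n f > k. Summed over k, the discrepancy telescopes to at most
  the measure of the set f > 0; division by n sends it to 0.\<close>

lemma integral_riesz_measure_nonneg:
  assumes f: "Cc f" "\<And>x. 0 \<le> f x"
  shows "(LINT x|riesz_measure. f x) = \<Lambda> f"
proof -
  obtain R where R: "\<And>x. R < norm x \<Longrightarrow> f x = 0" using f by (auto simp: Cc_iff)
  define M where "M n k = measure riesz_measure {x. real n * f x > real k}" for n k :: nat
  have op: "open {x. real n * f x > real k}" for n k :: nat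
    by (intro open_Collect_less continuous_intros Cc_continuous f)
  have fin: "emeasure riesz_measure {x. real n * f x > real k} < \<infinity>" for n k
  proof (rule order_le_less_trans)
    show "emeasure riesz_measure {x. real n * f x > real k} \<le> emeasure riesz_measure (cball 0 R)"
      using R by (intro emeasure_mono) (auto simp: not_le[symmetric] intro: leI dest!: R)
  qed (rule riesz_measure_compact[OF compact_cball])
  have M: "ennreal (M n k) = outer {x. real n * f x > real k}" for n k
  proof -
    have "ennreal (M n k) = emeasure riesz_measure {x. real n * f x > real k}"
      unfolding M_def using fin[of k n] by (intro emeasure_eq_ennreal_measure[symmetric]) auto
    then show ?thesis by (simp add: emeasure_riesz_measure borel_open[OF op])
  qed
  have bound: "\<bar>(LINT x|riesz_measure. f x) - \<Lambda> f\<bar> \<le> M 1 0 / real n" if n: "n > 0" for n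
  proof -
    define g where "g k x = min 1 (max 0 (real n * f x - real k))" for k x
    have gCc: "Cc (g k)" for k
      unfolding g_def by (rule Cc_compose[OF f(1)]) (auto intro!: continuous_intros)
    have g01: "0 \<le> g k x" "g k x \<le> 1" for k x by (auto simp: g_def)
    obtain B where B: "B > 0" "\<And>x. \<bar>f x\<bar> \<le> B" using Cc_bounded[OF f(1)] by metis
    obtain K :: nat where K: "real n * B \<le> real K" using real_arch_simple by blast
    have "real n * f x \<le> real K" for x
      using B(2)[of x] K by (smt (verit) mult_left_mono of_nat_0_le_iff)
    then have sum_g: "(\<Sum>k<K. g k x) = real n * f x" for x
      using sum_layers[of "real n * f x" K] f by (simp add: g_def)
    have \<Lambda>1: "\<Lambda> (g k) \<le> M n k" for k
    proof -
      have "ennreal (\<Lambda> (g k)) \<le> ennreal (M n k)"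
        unfolding M by (rule outer_lower) (auto simp: gCc g01, auto simp: g_def)
      then show ?thesis by (simp add: M_def)
    qed
    have \<Lambda>2: "M n (Suc k) \<le> \<Lambda> (g k)" for k
    proof -
      have "ennreal (M n (Suc k)) \<le> ennreal (\<Lambda> (g k))"
        unfolding M by (rule outer_upper) (auto simp: gCc g01, auto simp: g_def)
      then show ?thesis using nonneg[OF gCc g01(1), of k] by simp
    qed
    have ind: "integrable riesz_measure (indicator {x. real n * f x > real k} :: 'a \<Rightarrow> real)" for k
      using fin[of k n] op[of k n] by (intro integrable_real_indicator) auto
    have I1: "(LINT x|riesz_measure. g k x) \<le> M n k" for k
    proof -
      have "(LINT x|riesz_measure. g k x) \<le> (LINT x|riesz_measure. indicator {x. real n * f x > real k} x)"
        by (rule integral_mono[OF integrable_riesz_measure[OF gCc] ind]) (auto simp: g_def indicator_def)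
      then show ?thesis by (simp add: M_def)
    qed
    have I2: "M n (Suc k) \<le> (LINT x|riesz_measure. g k x)" for k
    proof -
      have "(LINT x|riesz_measure. indicator {x. real n * f x > real (Suc k)} x) \<le> (LINT x|riesz_measure. g k x)"
        by (rule integral_mono[OF ind integrable_riesz_measure[OF gCc]]) (auto simp: g_def indicator_def)
      then show ?thesis by (simp add: M_def)
    qed
    have "real n * ((LINT x|riesz_measure. f x) - \<Lambda> f) = (LINT x|riesz_measure. real n * f x) - \<Lambda> (\<lambda>x. real n * f x)"
      by (simp add: scale f(1) algebra_simps)
    also have "\<dots> = (LINT x|riesz_measure. (\<Sum>k<K. g k x)) - \<Lambda> (\<lambda>x. \<Sum>k<K. g k x)"
      by (simp add: sum_g)
    also have "\<dots> = (\<Sum>k<K. (LINT x|riesz_measure. g k x) - \<Lambda> (g k))"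
      by (simp add: sum gCc integrable_riesz_measure sum_subtractf)
    finally have "\<bar>real n * ((LINT x|riesz_measure. f x) - \<Lambda> f)\<bar> \<le> (\<Sum>k<K. \<bar>(LINT x|riesz_measure. g k x) - \<Lambda> (g k)\<bar>)"
      by (simp add: sum_abs)
    also have "\<dots> \<le> (\<Sum>k<K. M n k - M n (Suc k))"
      using \<Lambda>1 \<Lambda>2 I1 I2 by (intro sum_mono) (smt (verit))
    also have "\<dots> = M n 0 - M n K"
      by (rule sum_lessThan_telescope')
    \<comment> \<open>For n > 0 the sets n f > 0 and f > 0 coincide, so the bound no longer depends
      on n.\<close>
    also have "\<dots> \<le> M 1 0"
      using n by (simp add: M_def zero_less_mult_iff)
    finally have "real n * \<bar>(LINT x|riesz_measure. f x) - \<Lambda> f\<bar> \<le> M 1 0"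
      unfolding abs_mult abs_of_nat .
    then show ?thesis using n by (simp add: pos_le_divide_eq mult.commute)
  qed
  have "(\<lambda>n. M 1 0 / real n) \<longlonglongrightarrow> 0" by (rule lim_const_over_n)
  then have "\<bar>(LINT x|riesz_measure. f x) - \<Lambda> f\<bar> \<le> 0"
    by (rule LIMSEQ_le_const) (use bound in \<open>auto intro!: exI[of _ 1]\<close>)
  then show ?thesis by simp
qed

theorem riesz_representation:
  assumes "Cc f"
  shows "(LINT x|riesz_measure. f x) = \<Lambda> f"
proof -
  have 1: "Cc (\<lambda>x. max (f x) 0)" "Cc (\<lambda>x. max (- f x) 0)"
    by (rule Cc_compose[OF assms], auto intro!: continuous_intros)+
  have "f = (\<lambda>x. max (f x) 0 - max (- f x) 0)" by auto
  then have "(LINT x|riesz_measure. f x) = (LINT x|riesz_measure. max (f x) 0 - max (- f x) 0)"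
      "\<Lambda> f = \<Lambda> (\<lambda>x. max (f x) 0 - max (- f x) 0)"
    by metis+
  then show ?thesis
    using 1 by (simp add: diff integrable_riesz_measure integral_riesz_measure_nonneg)
qed

end


section \<open>Radon measures\<close>

text \<open>In a Euclidean space local finiteness already gives inner regularity: the restriction to
  each closed ball is a finite Borel measure, and countably many balls exhaust the space.\<close>

lemma radonI:
  fixes \<nu> :: "'a::euclidean_space measure"
  assumes s: "sets \<nu> = sets borel" and fin: "\<And>K. compact K \<Longrightarrow> emeasure \<nu> K < \<infinity>"
  shows "radon \<nu>"
  unfolding radon_def
proof (intro conjI allI impI ballI)
  fix B :: "'a set" assume B: "B \<in> sets borel"
  show "emeasure \<nu> B = (SUP K\<in>{K. K \<subseteq> B \<and> compact K}. emeasure \<nu> K)"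
  proof (rule antisym)
    have "(\<Union>n. B \<inter> cball 0 (real n)) = B"
      using real_arch_simple by auto
    moreover have "incseq (\<lambda>n. B \<inter> cball 0 (real n))"
      by (auto simp: incseq_def)
    ultimately have "emeasure \<nu> B = (SUP n. emeasure \<nu> (B \<inter> cball 0 (real n)))"
      using SUP_emeasure_incseq[of "\<lambda>n. B \<inter> cball 0 (real n)" \<nu>] B s by (metis (no_types, lifting) image_subsetI sets.Int borel_closed closed_cball)
    also have "\<dots> \<le> (SUP K\<in>{K. K \<subseteq> B \<and> compact K}. emeasure \<nu> K)"
    proof (rule SUP_least)
      fix n :: nat
      let ?C = "cball (0::'a) (real n)"
      let ?\<nu> = "density \<nu> (indicator ?C)"
      have C: "?C \<in> sets \<nu>" by (simp add: s)
      have em: "emeasure ?\<nu> A = emeasure \<nu> (A \<inter> ?C)" if "A \<in> sets borel" for A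
      proof -
        have "emeasure ?\<nu> A = (\<integral>\<^sup>+ x. indicator ?C x * indicator A x \<partial>\<nu>)"
          using that C borel_measurable_indicator[OF C] by (subst emeasure_density) (auto simp: s)
        also have "\<dots> = (\<integral>\<^sup>+ x. indicator (A \<inter> ?C) x \<partial>\<nu>)"
          by (intro nn_integral_cong) (auto simp: indicator_def)
        finally show ?thesis using that by (simp add: s)
      qed
      have "space ?\<nu> = UNIV" using sets_eq_imp_space_eq[OF s] by simp
      then have "emeasure ?\<nu> (space ?\<nu>) \<noteq> \<infinity>"
        using em[of UNIV] fin[OF compact_cball, of 0 "real n"] by simp
      then have "emeasure ?\<nu> B = (SUP K\<in>{K. K \<subseteq> B \<and> compact K}. emeasure ?\<nu> K)"
        by (intro inner_regular) (auto simp: s B)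
      also have "\<dots> \<le> (SUP K\<in>{K. K \<subseteq> B \<and> compact K}. emeasure \<nu> K)"
      proof (rule SUP_mono)
        fix K assume K: "K \<in> {K. K \<subseteq> B \<and> compact K}"
        then have "emeasure ?\<nu> K \<le> emeasure \<nu> (K \<inter> ?C)" by (simp add: em borel_compact)
        moreover have "K \<inter> ?C \<in> {K. K \<subseteq> B \<and> compact K}" using K by (auto intro: compact_Int)
        ultimately show "\<exists>K'\<in>{K. K \<subseteq> B \<and> compact K}. emeasure ?\<nu> K \<le> emeasure \<nu> K'" by blast
      qed
      finally show "emeasure \<nu> (B \<inter> ?C) \<le> (SUP K\<in>{K. K \<subseteq> B \<and> compact K}. emeasure \<nu> K)"
        using em[OF B] by simp
    qed
    finally show "emeasure \<nu> B \<le> (SUP K\<in>{K. K \<subseteq> B \<and> compact K}. emeasure \<nu> K)" .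
    show "(SUP K\<in>{K. K \<subseteq> B \<and> compact K}. emeasure \<nu> K) \<le> emeasure \<nu> B"
      by (rule SUP_least) (use B s in \<open>auto intro: emeasure_mono\<close>)
  qed
qed (use s fin in auto)

lemma radon_integrable: "radon \<nu> \<Longrightarrow> Cc f \<Longrightarrow> integrable \<nu> f"
  by (rule Cc_integrable) (auto simp: radon_def)

lemma radon_compact_eq:
  fixes K :: "'a::euclidean_space set"
  assumes \<mu>: "radon \<mu>" and \<nu>: "radon \<nu>"
    and eq: "\<And>f. Cc f \<Longrightarrow> (\<And>x. 0 \<le> f x) \<Longrightarrow> (LINT x|\<mu>. f x) = (LINT x|\<nu>. f x)"
    and K: "compact K" "K \<noteq> {}"
  shows "emeasure \<mu> K = emeasure \<nu> K"
proof -
  \<comment> \<open>\<open>Suc j\<close> in place of j makes every \<open>f j\<close> vanish at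
    distance 1 or more from K, so \<open>f 0\<close> is an integrable majorant of the whole
    sequence.\<close>
  define f where "f j x = max 0 (1 - real (Suc j) * infdist x K)" for j x
  have fCc: "Cc (f j)" for j
    unfolding Cc_iff
  proof
    show "continuous_on UNIV (f j)" unfolding f_def by (intro continuous_intros)
    obtain R where R: "\<And>x. x \<in> K \<Longrightarrow> norm x \<le> R"
      using compact_imp_bounded[OF K(1)] by (auto simp: bounded_iff)
    show "\<exists>R. \<forall>x. R < norm x \<longrightarrow> f j x = 0"
    proof (intro exI[of _ "R + 1"] allI impI)
      fix x :: 'a assume x: "R + 1 < norm x"
      have "1 \<le> infdist x K"
        unfolding infdist_notempty[OF K(2)]
      proof (rule cINF_greatest[OF K(2)])
        fix y assume "y \<in> K"
        then show "1 \<le> dist x y" using R[of y] x norm_triangle_ineq2[of x y] by (simp add: dist_norm)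
      qed
      then have "1 * 1 \<le> real (Suc j) * infdist x K" by (intro mult_mono) auto
      then show "f j x = 0" by (simp add: f_def)
    qed
  qed
  have lim: "(\<lambda>j. f j x) \<longlonglongrightarrow> indicator K x" for x
  proof (cases "x \<in> K")
    case True
    then show ?thesis by (simp add: f_def)
  next
    case False
    have pos: "infdist x K > 0"
      using False K in_closed_iff_infdist_zero[of K x] infdist_nonneg[of x K] compact_imp_closed by fastforce
    obtain N where N: "1 / infdist x K < real N" using reals_Archimedean2 by blast
    have "\<forall>\<^sub>F j in sequentially. f j x = 0"
      using eventually_ge_at_top[of N]
    proof eventually_elim
      fix j assume "N \<le> j"
      then have "1 / infdist x K < real (Suc j)" using N by linarith
      then show "f j x = 0" using pos by (simp add: f_def field_simps)
    qed
    then show ?thesis using False by (simp add: tendsto_eventually)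
  qed
  have le: "norm (f j x) \<le> f 0 x" for j x
  proof -
    have "1 * infdist x K \<le> real (Suc j) * infdist x K"
      using infdist_nonneg[of x K] by (intro mult_right_mono) auto
    then show ?thesis by (simp add: f_def)
  qed
  have conv: "(\<lambda>j. LINT x|M. f j x) \<longlonglongrightarrow> measure M K" if M: "radon M" for M
  proof -
    have [simp]: "sets M = sets borel" "space M = UNIV"
      using M sets_eq_imp_space_eq[of M borel] by (auto simp: radon_def)
    have "(\<lambda>j. LINT x|M. f j x) \<longlonglongrightarrow> (LINT x|M. indicator K x)"
    proof (rule integral_dominated_convergence[where w="f 0"])
      show "(indicator K :: 'a \<Rightarrow> real) \<in> borel_measurable M"
        using K by (intro borel_measurable_indicator) (auto simp: borel_compact)
    qed (use radon_integrable[OF M fCc] lim le in auto)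
    then show ?thesis by simp
  qed
  have "measure \<mu> K = measure \<nu> K"
  proof (rule LIMSEQ_unique[OF conv[OF \<mu>]])
    have "(LINT x|\<mu>. f j x) = (LINT x|\<nu>. f j x)" for j
      by (rule eq[OF fCc]) (simp add: f_def)
    then show "(\<lambda>j. LINT x|\<mu>. f j x) \<longlonglongrightarrow> measure \<nu> K" using conv[OF \<nu>] by simp
  qed
  moreover have "emeasure \<mu> K \<noteq> \<infinity>" "emeasure \<nu> K \<noteq> \<infinity>"
    using \<mu> \<nu> K by (auto simp: radon_def less_top)
  ultimately show ?thesis by (simp add: emeasure_eq_ennreal_measure)
qed

lemma radon_eqI:
  assumes \<mu>: "radon \<mu>" and \<nu>: "radon \<nu>"
    and eq: "\<And>f. Cc f \<Longrightarrow> (\<And>x. 0 \<le> f x) \<Longrightarrow> (LINT x|\<mu>. f x) = (LINT x|\<nu>. f x)"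
  shows "\<mu> = \<nu>"
proof (rule measure_eqI)
  show "sets \<mu> = sets \<nu>" using \<mu> \<nu> by (simp add: radon_def)
  fix B assume "B \<in> sets \<mu>"
  then have B: "B \<in> sets borel" using \<mu> by (simp add: radon_def)
  have "emeasure \<mu> K = emeasure \<nu> K" if "compact K" for K
    using radon_compact_eq[OF \<mu> \<nu> eq that] by (cases "K = {}") auto
  then have "(SUP K\<in>{K. K \<subseteq> B \<and> compact K}. emeasure \<mu> K) = (SUP K\<in>{K. K \<subseteq> B \<and> compact K}. emeasure \<nu> K)"
    by (intro SUP_cong) auto
  then show "emeasure \<mu> B = emeasure \<nu> B" using \<mu> \<nu> B unfolding radon_def by metis
qed


section \<open>Parabolic test functions\<close>

text \<open>\<open>par T \<phi> \<phi>t D D2\<close> records the parabolic derivatives of \<open>\<phi>\<close> on the strip: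
  \<open>\<phi>t\<close> in time, \<open>D b\<close> in direction \<open>b\<close> and \<open>D2 b c\<close> in directions \<open>b\<close>, then \<open>c\<close>.
  Carrying them along spares the choice operators hidden in \<open>deriv\<close>.\<close>

definition par :: "ereal \<Rightarrow> ('a::euclidean_space \<Rightarrow> real \<Rightarrow> real) \<Rightarrow> ('a \<Rightarrow> real \<Rightarrow> real) \<Rightarrow>
    ('a \<Rightarrow> 'a \<Rightarrow> real \<Rightarrow> real) \<Rightarrow> ('a \<Rightarrow> 'a \<Rightarrow> 'a \<Rightarrow> real \<Rightarrow> real) \<Rightarrow> bool"
  where "par T \<phi> \<phi>t D D2 \<longleftrightarrow>
    continuous_on (strip T) (\<lambda>(x, t). \<phi> x t) \<and>
    continuous_on (strip T) (\<lambda>(x, t). \<phi>t x t) \<and>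
    (\<forall>b\<in>Basis. continuous_on (strip T) (\<lambda>(x, t). D b x t)) \<and>
    (\<forall>b\<in>Basis. \<forall>c\<in>Basis. continuous_on (strip T) (\<lambda>(x, t). D2 b c x t)) \<and>
    (\<forall>x t. (x, t) \<in> strip T \<longrightarrow>
      (\<phi> x has_real_derivative \<phi>t x t) (at t within {0..}) \<and>
      (\<forall>b\<in>Basis. ((\<lambda>h. \<phi> (x + h *\<^sub>R b) t) has_real_derivative D b x t) (at 0)) \<and>
      (\<forall>b\<in>Basis. \<forall>c\<in>Basis. ((\<lambda>h. D b (x + h *\<^sub>R c) t) has_real_derivative D2 b c x t) (at 0)))"

lemma strip_iff: "(x, t) \<in> strip T \<longleftrightarrow> 0 \<le> t \<and> ereal t < T"
  by (simp add: strip_def)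

lemma box_subset_strip: "ereal T1 < T \<Longrightarrow> A \<times> {0..T1} \<subseteq> strip T"
  by (auto simp: strip_def) (meson ereal_less_eq(3) order_le_less_trans)

lemma parD:
  assumes "par T \<phi> \<phi>t D D2"
  shows "continuous_on (strip T) (\<lambda>(x, t). \<phi> x t)"
    "continuous_on (strip T) (\<lambda>(x, t). \<phi>t x t)"
    "b \<in> Basis \<Longrightarrow> continuous_on (strip T) (\<lambda>(x, t). D b x t)"
    "b \<in> Basis \<Longrightarrow> c \<in> Basis \<Longrightarrow> continuous_on (strip T) (\<lambda>(x, t). D2 b c x t)"
    "(x, t) \<in> strip T \<Longrightarrow> (\<phi> x has_real_derivative \<phi>t x t) (at t within {0..})"
    "(x, t) \<in> strip T \<Longrightarrow> b \<in> Basis \<Longrightarrow> ((\<lambda>h. \<phi> (x + h *\<^sub>R b) t) has_real_derivative D b x t) (at 0)"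
    "(x, t) \<in> strip T \<Longrightarrow> b \<in> Basis \<Longrightarrow> c \<in> Basis \<Longrightarrow> ((\<lambda>h. D b (x + h *\<^sub>R c) t) has_real_derivative D2 b c x t) (at 0)"
  using assms unfolding par_def by blast+

text \<open>Makes one-sided time derivatives unique, also at t = 0.\<close>

lemma at_within_atLeast_neq_bot: "0 \<le> t \<Longrightarrow> at t within {0..} \<noteq> (bot :: real filter)"
proof -
  assume "0 \<le> t"
  then have "at t within {t<..} \<le> at t within {0..}" by (intro at_le) auto
  then show ?thesis using trivial_limit_at_right_real[of t] by (metis bot.extremum_uniqueI)
qed

lemma par_derivs:
  assumes "par T \<phi> \<phi>t D D2" "(x, t) \<in> strip T"
  shows "time_deriv \<phi> x t = \<phi>t x t"
    "b \<in> Basis \<Longrightarrow> pderiv_dir b (\<lambda>y. \<phi> y t) x = D b x t"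
    "b \<in> Basis \<Longrightarrow> c \<in> Basis \<Longrightarrow> pderiv_dir c (pderiv_dir b (\<lambda>y. \<phi> y t)) x = D2 b c x t"
    "laplacian (\<lambda>y. \<phi> y t) x = (\<Sum>b\<in>Basis. D2 b b x t)"
proof -
  note d = parD[OF assms(1)]
  have S: "(y, t) \<in> strip T" for y :: 'a using assms(2) by (simp add: strip_iff)
  show "time_deriv \<phi> x t = \<phi>t x t"
    unfolding time_deriv_def
    using d(5)[OF S] at_within_atLeast_neq_bot[of t] assms(2)
    by (intro vector_derivative_within) (auto simp: has_real_derivative_iff_has_vector_derivative strip_iff)
  have 1: "b \<in> Basis \<Longrightarrow> pderiv_dir b (\<lambda>y. \<phi> y t) y = D b y t" for b y
    unfolding pderiv_dir_def using d(6)[OF S] by (auto intro: DERIV_imp_deriv)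
  then show "b \<in> Basis \<Longrightarrow> pderiv_dir b (\<lambda>y. \<phi> y t) x = D b x t" .
  have 2: "b \<in> Basis \<Longrightarrow> c \<in> Basis \<Longrightarrow> pderiv_dir c (pderiv_dir b (\<lambda>y. \<phi> y t)) x = D2 b c x t" for b c
    unfolding pderiv_dir_def[of c] using d(7)[OF S, of b c] by (simp add: 1 DERIV_imp_deriv)
  then show "b \<in> Basis \<Longrightarrow> c \<in> Basis \<Longrightarrow> pderiv_dir c (pderiv_dir b (\<lambda>y. \<phi> y t)) x = D2 b c x t" .
  show "laplacian (\<lambda>y. \<phi> y t) x = (\<Sum>b\<in>Basis. D2 b b x t)"
    unfolding laplacian_def using 2 by (intro sum.cong) auto
qed

lemma test_fun_par:
  assumes "test_fun T \<phi>"
  shows "par T \<phi> (time_deriv \<phi>) (\<lambda>b x t. pderiv_dir b (\<lambda>y. \<phi> y t) x)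
    (\<lambda>b c x t. pderiv_dir c (pderiv_dir b (\<lambda>y. \<phi> y t)) x)"
proof -
  have 1: "(\<phi> x has_real_derivative time_deriv \<phi> x t) (at t within {0..})" if "(x, t) \<in> strip T" for x t
  proof -
    have "\<phi> x differentiable (at t within {0..})"
      using assms that unfolding test_fun_def Let_def by fast
    then show ?thesis
      unfolding time_deriv_def has_real_derivative_iff_has_vector_derivative
      by (simp add: vector_derivative_works[symmetric])
  qed
  have 2: "((\<lambda>h. f (x + h *\<^sub>R b)) has_real_derivative pderiv_dir b f x) (at 0)" if "pdifferentiable_dir b f x" for b f and x :: 'a
    using that unfolding pdifferentiable_dir_def pderiv_dir_def
    by (simp add: DERIV_deriv_iff_field_differentiable)
  have 3: "pdifferentiable_dir b (\<lambda>y. \<phi> y t) x" if "(x, t) \<in> strip T" "b \<in> Basis" for x t b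
    using assms that unfolding test_fun_def Let_def by fast
  have 4: "pdifferentiable_dir c (pderiv_dir b (\<lambda>y. \<phi> y t)) x" if "(x, t) \<in> strip T" "b \<in> Basis" "c \<in> Basis" for x t b c
    using assms that unfolding test_fun_def Let_def by fast
  show ?thesis
    unfolding par_def using 1 2[OF 3] 2[OF 4] assms unfolding test_fun_def Let_def by simp
qed

text \<open>A quantitative form of compact support, read on the strip alone because values elsewhere
  are arbitrary. It passes directly to products and derivatives, unlike a closure.\<close>

definition vanishes :: "real \<Rightarrow> real \<Rightarrow> ereal \<Rightarrow> ('a::euclidean_space \<Rightarrow> real \<Rightarrow> real) \<Rightarrow> bool"
  where "vanishes R T1 T \<phi> \<longleftrightarrow> (\<forall>x t. (x, t) \<in> strip T \<longrightarrow> R < norm x \<or> T1 < t \<longrightarrow> \<phi> x t = 0)"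

lemma test_funI:
  assumes p: "par T \<phi> \<phi>t D D2" and v: "vanishes R T1 T \<phi>" and T1: "ereal T1 < T"
  shows "test_fun T \<phi>"
proof -
  note d = parD[OF p] and e = par_derivs[OF p]
  let ?K = "cball (0::'a) R \<times> {0..T1}"
  let ?supp = "closure (support_on (strip T) (\<lambda>(x, t). \<phi> x t))"
  have "support_on (strip T) (\<lambda>(x, t). \<phi> x t) \<subseteq> ?K"
    using v by (force simp: support_on_def vanishes_def strip_iff not_less[symmetric])
  then have sub: "?supp \<subseteq> ?K"
    by (intro closure_minimal closed_Times) auto
  have "compact ?K" by (intro compact_Times) auto
  then have comp: "compact ?supp"
    using sub by (metis closed_closure compact_Int_closed inf.absorb_iff2)
  have "?K \<subseteq> strip T"
    by (rule box_subset_strip[OF T1])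
  then have subS: "?supp \<subseteq> strip T" using sub by blast
  have c: "continuous_on (strip T) (\<lambda>(x, t). time_deriv \<phi> x t)"
    using d(2) by (rule continuous_on_eq) (auto simp: e)
  have c1: "continuous_on (strip T) (\<lambda>(x, t). pderiv_dir b (\<lambda>y. \<phi> y t) x)" if "b \<in> Basis" for b
    using d(3)[OF that] by (rule continuous_on_eq) (auto simp: e that)
  have c2: "continuous_on (strip T) (\<lambda>(x, t). pderiv_dir c (pderiv_dir b (\<lambda>y. \<phi> y t)) x)" if "b \<in> Basis" "c \<in> Basis" for b c
    using d(4)[OF that] by (rule continuous_on_eq) (auto simp: e that)
  have t1: "\<phi> x differentiable (at t within {0..})" if "(x, t) \<in> strip T" for x t
    using d(5)[OF that] by (auto simp: real_differentiable_def)
  have t2: "pdifferentiable_dir b (\<lambda>y. \<phi> y t) x" if "(x, t) \<in> strip T" "b \<in> Basis" for x t b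
    using d(6)[OF that] by (auto simp: pdifferentiable_dir_def field_differentiable_def)
  have t3: "pdifferentiable_dir c (pderiv_dir b (\<lambda>y. \<phi> y t)) x" if "(x, t) \<in> strip T" "b \<in> Basis" "c \<in> Basis" for x t b c
  proof -
    \<comment> \<open>A second derivative compares first derivatives along a line in x, and the
      strip contains the whole time slice.\<close>
    have "(y, t) \<in> strip T" for y :: 'a using that by (simp add: strip_iff)
    then have "(\<lambda>h. pderiv_dir b (\<lambda>y. \<phi> y t) (x + h *\<^sub>R c)) = (\<lambda>h. D b (x + h *\<^sub>R c) t)"
      using that by (simp add: e)
    then show ?thesis
      using d(7)[OF that] by (auto simp: pdifferentiable_dir_def field_differentiable_def)
  qed
  show ?thesis
    unfolding test_fun_def Let_def
    using comp subS c c1 c2 t1 t2 t3 d(1) by auto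
qed

lemma horizon: assumes "0 < T" obtains T1 where "0 < T1" "ereal T1 < T"
  using assms by (metis ereal_dense2 ereal_less(2))

lemma test_fun_vanishes:
  assumes "test_fun T \<phi>" "0 < T"
  obtains R T1 where "0 < R" "0 < T1" "ereal T1 < T" "vanishes R T1 T \<phi>"
proof -
  let ?supp = "closure (support_on (strip T) (\<lambda>(x, t). \<phi> x t))"
  have s: "compact ?supp" "?supp \<subseteq> strip T" using assms by (auto simp: test_fun_def Let_def)
  obtain R where R: "\<And>z. z \<in> ?supp \<Longrightarrow> norm z \<le> R" using compact_imp_bounded[OF s(1)] by (auto simp: bounded_iff)
  \<comment> \<open>\<open>T2\<close> makes the bound on time positive and stands in for it when the
    support is empty.\<close>
  obtain T2 where T2: "0 < T2" "ereal T2 < T" by (rule horizon[OF assms(2)])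
  have "\<exists>T3. ereal T3 < T \<and> (\<forall>z\<in>?supp. snd z \<le> T3)"
  proof (cases "?supp = {}")
    case False
    have "compact (snd ` ?supp)" by (intro compact_continuous_image s continuous_intros)
    then obtain T3 where "T3 \<in> snd ` ?supp" "\<forall>t\<in>snd ` ?supp. t \<le> T3"
      using compact_attains_sup[of "snd ` ?supp"] False by auto
    then show ?thesis using s(2) by (force simp: strip_def)
  qed (use T2 in auto)
  then obtain T3 where T3: "ereal T3 < T" "\<And>z. z \<in> ?supp \<Longrightarrow> snd z \<le> T3" by blast
  show thesis
  proof (rule that[of "max R 1" "max T2 T3"])
    show "vanishes (max R 1) (max T2 T3) T \<phi>"
      unfolding vanishes_def
    proof (intro allI impI)
      fix x :: 'a and t assume S: "(x, t) \<in> strip T" and out: "max R 1 < norm x \<or> max T2 T3 < t"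
      show "\<phi> x t = 0"
      proof (rule ccontr)
        assume "\<phi> x t \<noteq> 0"
        then have "(x, t) \<in> ?supp" using S by (intro subsetD[OF closure_subset]) (auto simp: support_on_def)
        then show False using R[of "(x, t)"] T3(2)[of "(x, t)"] norm_fst_le[of x t] out by (auto simp: max_def split: if_splits)
      qed
    qed
  qed (use T2 T3 in \<open>auto simp: max_def\<close>)
qed

lemma ereal_less_room: assumes "ereal t < T" obtains d where "0 < d" "ereal (t + d) < T"
proof -
  obtain s where "ereal t < ereal s" "ereal s < T" using assms by (metis ereal_dense2)
  then show ?thesis by (intro that[of "s - t"]) auto
qed

text \<open>The exterior of the box is given by strict inequalities, so \<phi> vanishes near each of
  its points within the strip, and uniqueness of derivatives applies.\<close>

lemma vanishes_derivs:
  assumes p: "par T \<phi> \<phi>t D D2" and v: "vanishes R T1 T \<phi>"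
  shows "vanishes R T1 T \<phi>t" "b \<in> Basis \<Longrightarrow> vanishes R T1 T (D b)"
    "b \<in> Basis \<Longrightarrow> c \<in> Basis \<Longrightarrow> vanishes R T1 T (D2 b c)"
proof -
  note d = parD[OF p]
  show "vanishes R T1 T \<phi>t"
    unfolding vanishes_def
  proof (intro allI impI)
    fix x :: 'a and t assume S: "(x, t) \<in> strip T" and out: "R < norm x \<or> T1 < t"
    \<comment> \<open>\<open>d1\<close> keeps nearby times below T, where alone vanishing is known;
      \<open>d2\<close> keeps them beyond T1 if x lies in the ball.\<close>
    obtain d1 where d1: "0 < d1" "ereal (t + d1) < T" using S ereal_less_room by (auto simp: strip_iff)
    obtain d2 where d2: "0 < d2" "R < norm x \<or> T1 < t - d2"
    proof (cases "R < norm x")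
      case False
      then show ?thesis using out that[of "(t - T1)/2"] by (auto simp: field_simps)
    qed (use that[of 1] in auto)
    have "((\<lambda>_. 0) has_real_derivative \<phi>t x t) (at t within {0..})"
    proof (rule has_field_derivative_transform_within[OF d(5)[OF S], of "min d1 d2"])
      fix s assume s: "s \<in> {0..}" "dist s t < min d1 d2"
      then have "ereal s < T" using d1(2) by (auto simp: dist_real_def intro!: order_less_trans[OF _ d1(2)])
      then show "\<phi> x s = 0" using v s d2 by (auto simp: vanishes_def strip_iff dist_real_def)
    qed (use d1 d2 S in \<open>auto simp: strip_iff\<close>)
    then show "\<phi>t x t = 0"
      using vector_derivative_unique_within[OF at_within_atLeast_neq_bot[of t], of "\<lambda>_. 0" "\<phi>t x t" 0] S
      by (simp add: has_real_derivative_iff_has_vector_derivative strip_iff)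
  qed
  have gen: "vanishes R T1 T F'"
    if F: "vanishes R T1 T F" and F': "\<And>x t. (x, t) \<in> strip T \<Longrightarrow> ((\<lambda>h. F (x + h *\<^sub>R b) t) has_real_derivative F' x t) (at 0)"
    for F F' :: "'a \<Rightarrow> real \<Rightarrow> real" and b :: 'a
    unfolding vanishes_def
  proof (intro allI impI)
    fix x :: 'a and t assume S: "(x, t) \<in> strip T" and out: "R < norm x \<or> T1 < t"
    have "continuous_on UNIV (\<lambda>h. norm (x + h *\<^sub>R b))" by (intro continuous_intros)
    then have "open {h. R < norm (x + h *\<^sub>R b)}"
      by (intro open_Collect_less continuous_intros)
    moreover have "0 \<in> {h. R < norm (x + h *\<^sub>R b)}" if "R < norm x" using that by simp
    ultimately obtain e where e: "e > 0" "R < norm x \<Longrightarrow> ball 0 e \<subseteq> {h. R < norm (x + h *\<^sub>R b)}"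
      by (metis open_contains_ball zero_less_one)
    have "((\<lambda>_. 0) has_real_derivative F' x t) (at 0)"
    proof (rule has_field_derivative_transform_within[OF F'[OF S], of e])
      fix h :: real assume "dist h 0 < e"
      then have "h \<in> ball 0 e" by (simp add: dist_commute)
      then have "R < norm (x + h *\<^sub>R b) \<or> T1 < t" using e(2) out by blast
      then show "F (x + h *\<^sub>R b) t = 0" using F S by (auto simp: vanishes_def strip_iff)
    qed (use e in auto)
    moreover have "((\<lambda>_. 0) has_real_derivative 0) (at 0)" for x :: 'a by simp
    ultimately show "F' x t = 0" using DERIV_unique by blast
  qed
  show D: "vanishes R T1 T (D b)" if "b \<in> Basis" for b using gen[OF v d(6)] that by blast
  show "vanishes R T1 T (D2 b c)" if "b \<in> Basis" "c \<in> Basis" for b c using gen[OF D d(7)] that by blast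
qed

section \<open>Calculus of parabolic derivatives\<close>

lemma par_add:
  assumes p: "par T \<phi> \<phi>t D D2" and q: "par T \<psi> \<psi>t E E2"
  shows "par T (\<lambda>x t. \<phi> x t + \<psi> x t) (\<lambda>x t. \<phi>t x t + \<psi>t x t) (\<lambda>b x t. D b x t + E b x t)
    (\<lambda>b c x t. D2 b c x t + E2 b c x t)"
  unfolding par_def
  using continuous_on_add[OF parD(1)[OF p] parD(1)[OF q]] continuous_on_add[OF parD(2)[OF p] parD(2)[OF q]]
    continuous_on_add[OF parD(3)[OF p] parD(3)[OF q]] continuous_on_add[OF parD(4)[OF p] parD(4)[OF q]]
    DERIV_add[OF parD(5)[OF p] parD(5)[OF q]] DERIV_add[OF parD(6)[OF p] parD(6)[OF q]]
    DERIV_add[OF parD(7)[OF p] parD(7)[OF q]]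
  by (simp add: case_prod_unfold)

lemma par_mult:
  assumes p: "par T \<phi> \<phi>t D D2" and q: "par T \<psi> \<psi>t E E2"
  shows "par T (\<lambda>x t. \<phi> x t * \<psi> x t) (\<lambda>x t. \<phi>t x t * \<psi> x t + \<phi> x t * \<psi>t x t)
    (\<lambda>b x t. D b x t * \<psi> x t + \<phi> x t * E b x t)
    (\<lambda>b c x t. D2 b c x t * \<psi> x t + D b x t * E c x t + D c x t * E b x t + \<phi> x t * E2 b c x t)"
proof -
  note d = parD[OF p] and e = parD[OF q]
  note d' = d(1-4)[unfolded case_prod_unfold] and e' = e(1-4)[unfolded case_prod_unfold]
  show ?thesis
    unfolding par_def case_prod_unfold
  proof (intro conjI ballI allI impI)
    fix x :: 'a and t assume S: "(x, t) \<in> strip T"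
    show "((\<lambda>t. \<phi> x t * \<psi> x t) has_real_derivative \<phi>t x t * \<psi> x t + \<phi> x t * \<psi>t x t) (at t within {0..})"
      using DERIV_mult[OF d(5)[OF S] e(5)[OF S]] by (simp add: algebra_simps)
    fix b :: 'a assume b: "b \<in> Basis"
    show "((\<lambda>h. \<phi> (x + h *\<^sub>R b) t * \<psi> (x + h *\<^sub>R b) t) has_real_derivative D b x t * \<psi> x t + \<phi> x t * E b x t) (at 0)"
      using DERIV_mult[OF d(6)[OF S b] e(6)[OF S b]] by (simp add: algebra_simps)
    fix c :: 'a assume c: "c \<in> Basis"
    show "((\<lambda>h. D b (x + h *\<^sub>R c) t * \<psi> (x + h *\<^sub>R c) t + \<phi> (x + h *\<^sub>R c) t * E b (x + h *\<^sub>R c) t) has_real_derivative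
       D2 b c x t * \<psi> x t + D b x t * E c x t + D c x t * E b x t + \<phi> x t * E2 b c x t) (at 0)"
      using DERIV_add[OF DERIV_mult[OF d(7)[OF S b c] e(6)[OF S c]] DERIV_mult[OF d(6)[OF S c] e(7)[OF S b c]]]
      by (simp add: algebra_simps)
  qed (rule d' e' | assumption | rule continuous_on_add continuous_on_mult)+
qed

text \<open>The set U confines the hypotheses on G to values taken by \<rho>; for the logarithm it
  is the positive half-line.\<close>

lemma par_comp:
  assumes p: "par T \<rho> \<rho>t D D2" and U: "\<And>x t. (x, t) \<in> strip T \<Longrightarrow> \<rho> x t \<in> U"
    and G: "\<And>r. r \<in> U \<Longrightarrow> (G has_real_derivative G1 r) (at r)"
      "\<And>r. r \<in> U \<Longrightarrow> (G1 has_real_derivative G2 r) (at r)" "continuous_on U G2"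
  shows "par T (\<lambda>x t. G (\<rho> x t)) (\<lambda>x t. G1 (\<rho> x t) * \<rho>t x t)
    (\<lambda>b x t. G1 (\<rho> x t) * D b x t)
    (\<lambda>b c x t. G2 (\<rho> x t) * D c x t * D b x t + G1 (\<rho> x t) * D2 b c x t)"
proof -
  note d = parD[OF p]
  note d' = d(1-4)[unfolded case_prod_unfold]
  have cG: "continuous_on U G" "continuous_on U G1"
    by (rule DERIV_continuous_on, rule has_field_derivative_at_within, rule G, assumption)+
  have c: "continuous_on (strip T) (\<lambda>z. g (\<rho> (fst z) (snd z)))" if "continuous_on U g" for g :: "real \<Rightarrow> real"
    by (rule continuous_on_compose2[OF that d'(1)]) (use U in auto)
  show ?thesis
    unfolding par_def case_prod_unfold
  proof (intro conjI ballI allI impI)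
    fix x :: 'a and t assume S: "(x, t) \<in> strip T"
    show "((\<lambda>t. G (\<rho> x t)) has_real_derivative G1 (\<rho> x t) * \<rho>t x t) (at t within {0..})"
      by (rule DERIV_chain2[OF G(1)[OF U[OF S]] d(5)[OF S]])
    fix b :: 'a assume b: "b \<in> Basis"
    show "((\<lambda>h. G (\<rho> (x + h *\<^sub>R b) t)) has_real_derivative G1 (\<rho> x t) * D b x t) (at 0)"
      by (rule DERIV_chain2[OF _ d(6)[OF S b]]) (use G(1)[OF U[OF S]] in simp)
    fix c :: 'a assume c: "c \<in> Basis"
    have "((\<lambda>h. G1 (\<rho> (x + h *\<^sub>R c) t)) has_real_derivative G2 (\<rho> x t) * D c x t) (at 0)"
      by (rule DERIV_chain2[OF _ d(6)[OF S c]]) (use G(2)[OF U[OF S]] in simp)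
    from DERIV_mult[OF this d(7)[OF S b c]]
    show "((\<lambda>h. G1 (\<rho> (x + h *\<^sub>R c) t) * D b (x + h *\<^sub>R c) t) has_real_derivative
        G2 (\<rho> x t) * D c x t * D b x t + G1 (\<rho> x t) * D2 b c x t) (at 0)"
      by (simp add: algebra_simps)
  qed (rule d' c[OF G(3)] c[OF cG(1)] c[OF cG(2)] | assumption | rule continuous_on_add continuous_on_mult)+
qed

lemma strip_mono: "T' \<le> T \<Longrightarrow> strip T' \<subseteq> strip T"
  by (auto simp: strip_def intro: order_less_le_trans)

lemma par_subset: "par T \<phi> \<phi>t D D2 \<Longrightarrow> T' \<le> T \<Longrightarrow> par T' \<phi> \<phi>t D D2"
  unfolding par_def using strip_mono[of T' T] continuous_on_subset[of "strip T" _ "strip T'"]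
  by (elim conjE, intro conjI ballI allI impI) blast+

text \<open>Derivatives within \<open>{0..}\<close> suffice. This admits real powers of t and
  primitives taken from 0, whose values at negative times are immaterial.\<close>

lemma par_time:
  assumes "\<And>t. 0 \<le> t \<Longrightarrow> (\<zeta> has_real_derivative \<zeta>' t) (at t within {0..})" "continuous_on {0..} \<zeta>'"
  shows "par T (\<lambda>x t. \<zeta> t) (\<lambda>x t. \<zeta>' t) (\<lambda>b x t. 0) (\<lambda>b c x t. 0)"
proof -
  have "continuous_on {0..} \<zeta>" using assms(1) DERIV_continuous_on[of "{0..}" \<zeta> \<zeta>'] by auto
  then have "continuous_on (strip T) (\<lambda>z. \<zeta> (snd z))" "continuous_on (strip T) (\<lambda>z. \<zeta>' (snd z))"
    using assms(2) by (auto intro!: continuous_on_compose2[of "{0..}" _ "strip T" snd] continuous_intros simp: strip_iff)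
  then show ?thesis using assms(1) by (simp add: par_def case_prod_unfold strip_iff)
qed

lemma par_const: "par T (\<lambda>x t. k) (\<lambda>x t. 0) (\<lambda>b x t. 0) (\<lambda>b c x t. 0)"
  by (rule par_time) auto

lemma par_inner: "par T (\<lambda>x t. inner x a) (\<lambda>x t. 0) (\<lambda>b x t. inner b a) (\<lambda>b c x t. 0)"
  unfolding par_def case_prod_unfold
  by (auto intro!: continuous_intros derivative_eq_intros simp: inner_add_left)

lemma par_sqdist:
  "par T (\<lambda>x t. inner (x - z) (x - z)) (\<lambda>x t. 0) (\<lambda>b x t. 2 * inner (x - z) b) (\<lambda>b c x t. 2 * inner c b)"
proof -
  have 1: "((\<lambda>h. inner (x + h *\<^sub>R b - z) (x + h *\<^sub>R b - z)) has_real_derivative 2 * inner (x - z) b) (at 0)" for x b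
  proof -
    have "(\<lambda>h. inner (x + h *\<^sub>R b - z) (x + h *\<^sub>R b - z)) =
      (\<lambda>h. inner (x - z) (x - z) + h * (2 * inner (x - z) b) + h^2 * inner b b)"
      by (auto simp: fun_eq_iff inner_simps algebra_simps power2_eq_square inner_commute)
    then show ?thesis by (auto intro!: derivative_eq_intros)
  qed
  have 2: "((\<lambda>h. 2 * inner (x + h *\<^sub>R c - z) b) has_real_derivative 2 * inner c b) (at 0)" for x b c
    by (auto intro!: derivative_eq_intros simp: inner_simps)
  show ?thesis
    unfolding par_def case_prod_unfold using 1 2 by (auto intro!: continuous_intros)
qed

section \<open>Time-independent C^2 functions and approximation of C_c\<close>

text \<open>Encoded as a time-independent case of \<open>par\<close> on the infinite strip, so that
  sums and products inherit the parabolic calculus.\<close>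

definition C2 :: "('a::euclidean_space \<Rightarrow> real) \<Rightarrow> bool"
  where "C2 f \<longleftrightarrow> (\<exists>D D2. par \<infinity> (\<lambda>x t. f x) (\<lambda>x t. 0) D D2)"

lemma C2_continuous: "C2 f \<Longrightarrow> continuous_on S f"
proof -
  assume "C2 f"
  then obtain D D2 where "par \<infinity> (\<lambda>x t. f x) (\<lambda>x t. 0) D D2" unfolding C2_def by (elim exE)
  from parD(1)[OF this] have "continuous_on (strip \<infinity>) (\<lambda>z::'a \<times> real. f (fst z))"
    unfolding case_prod_unfold .
  moreover have "continuous_on S (\<lambda>x. (x, 0::real))"
    by (intro continuous_on_Pair continuous_on_id continuous_on_const)
  moreover have "(\<lambda>x. (x, 0::real)) ` S \<subseteq> strip \<infinity>"
    by (auto simp: strip_iff)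
  ultimately have "continuous_on S (\<lambda>x. f (fst (x, 0::real)))"
    by (rule continuous_on_compose2[where g="\<lambda>z. f (fst z)"])
  then show ?thesis by simp
qed

lemma C2_add: "C2 f \<Longrightarrow> C2 g \<Longrightarrow> C2 (\<lambda>x. f x + g x)"
  unfolding C2_def
proof (elim exE)
  fix D D2 E E2
  assume "par \<infinity> (\<lambda>x t. f x) (\<lambda>x t. 0) D D2" "par \<infinity> (\<lambda>x t. g x) (\<lambda>x t. 0) E E2"
  from par_add[OF this] have "\<exists>D D2. par \<infinity> (\<lambda>x t. f x + g x) (\<lambda>x t. 0 + 0) D D2"
    by (intro exI)
  then show "\<exists>D D2. par \<infinity> (\<lambda>x t. f x + g x) (\<lambda>x t. 0) D D2" by simp
qed

lemma C2_mult: "C2 f \<Longrightarrow> C2 g \<Longrightarrow> C2 (\<lambda>x. f x * g x)"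
  unfolding C2_def
proof (elim exE)
  fix D D2 E E2
  assume "par \<infinity> (\<lambda>x t. f x) (\<lambda>x t. 0) D D2" "par \<infinity> (\<lambda>x t. g x) (\<lambda>x t. 0) E E2"
  from par_mult[OF this] have "\<exists>D D2. par \<infinity> (\<lambda>x t. f x * g x) (\<lambda>x t. 0 * g x + f x * 0) D D2"
    by (intro exI)
  then show "\<exists>D D2. par \<infinity> (\<lambda>x t. f x * g x) (\<lambda>x t. 0) D D2" by simp
qed

lemma C2_const: "C2 (\<lambda>x. k)"
  unfolding C2_def by (intro exI) (rule par_const)

lemma C2_inner: "C2 (\<lambda>x. inner x a)"
  unfolding C2_def by (intro exI) (rule par_inner)

lemma C2_approx:
  fixes f :: "'a::euclidean_space \<Rightarrow> real"
  assumes "compact S" "continuous_on S f" "0 < e"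
  obtains g where "C2 g" "\<And>x. x \<in> S \<Longrightarrow> \<bar>f x - g x\<bar> < e"
proof -
  interpret function_ring_on "{g::'a \<Rightarrow> real. C2 g}" S
  proof
    show "\<exists>f\<in>{g. C2 g}. f x \<noteq> f y" if "x \<noteq> y" for x y :: 'a
    proof -
      obtain b where "b \<in> Basis" "inner x b \<noteq> inner y b" using \<open>x \<noteq> y\<close> by (metis euclidean_eqI)
      then show ?thesis by (intro bexI[of _ "\<lambda>x. inner x b"]) (auto simp: C2_inner)
    qed
    show "compact S" by fact
    show "(\<lambda>_. k) \<in> {g::'a \<Rightarrow> real. C2 g}" for k using C2_const by simp
    fix f :: "'a \<Rightarrow> real" assume f: "f \<in> {g. C2 g}"
    then show "continuous_on S f" using C2_continuous by simp
    fix g :: "'a \<Rightarrow> real" assume g: "g \<in> {g. C2 g}"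
    show "(\<lambda>x. f x + g x) \<in> {g. C2 g}" using C2_add f g by simp
    show "(\<lambda>x. f x * g x) \<in> {g. C2 g}" using C2_mult f g by simp
  qed
  obtain g where "g \<in> {g. C2 g}" "\<forall>x\<in>S. \<bar>f x - g x\<bar> < e"
    using Stone_Weierstrass_basic[OF assms(2,3)] by (elim bexE)
  then show thesis by (intro that[of g]) auto
qed


text \<open>The exponent is at least 2, so the difference quotient at 0 is dominated by a positive
  power of the positive part. Hence squares of positive parts are C^1 and cubes are C^2.\<close>

lemma DERIV_pos_part_power:
  "((\<lambda>w. max 0 w ^ Suc (Suc n)) has_real_derivative (real n + 2) * max 0 w ^ Suc n) (at w)"
proof -
  consider "w > 0" | "w < 0" | "w = 0" by linarith
  then show ?thesis
  proof cases
    case 1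
    have "((\<lambda>w. w ^ Suc (Suc n)) has_real_derivative (real n + 2) * w ^ Suc n) (at w)"
      using DERIV_pow[of "Suc (Suc n)" w] by (simp add: add.commute)
    then show ?thesis
      by (rule DERIV_cong_ev[THEN iffD1, rotated -1])
        (use 1 eventually_nhds_in_open[of "{0<..}" w] in \<open>auto elim: eventually_mono\<close>)
  next
    case 2
    have "((\<lambda>w. 0) has_real_derivative 0) (at w)" by simp
    then show ?thesis
      by (rule DERIV_cong_ev[THEN iffD1, rotated -1])
        (use 2 eventually_nhds_in_open[of "{..<0}" w] in \<open>auto elim: eventually_mono\<close>)
  next
    case 3
    have "(\<lambda>h::real. max 0 h ^ Suc (Suc n) / h) \<midarrow>0\<rightarrow> 0"
    proof (rule Lim_null_comparison)
      show "\<forall>\<^sub>F h in at 0. norm (max 0 h ^ Suc (Suc n) / h) \<le> max 0 h ^ Suc n"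
        by (intro always_eventually allI) (auto simp: max_def)
      show "((\<lambda>h::real. max 0 h ^ Suc n) \<longlongrightarrow> 0) (at 0)"
        by (auto intro!: tendsto_eq_intros)
    qed
    then show ?thesis using 3 by (simp add: DERIV_def)
  qed
qed

text \<open>The square makes the cut-off C^1 across T1, and its value 1 at t = 0 leaves initial
  slices unchanged under multiplication.\<close>

definition time_cut :: "real \<Rightarrow> real \<Rightarrow> real"
  where "time_cut T1 t = max 0 (1 - t / T1) ^ 2"

lemma par_time_cut:
  "par T (\<lambda>x t. time_cut T1 t) (\<lambda>x t. 2 * max 0 (1 - t / T1) * (- (1 / T1))) (\<lambda>b x t. 0) (\<lambda>b c x t. 0)"
proof (rule par_time)
  fix t :: real
  have "((\<lambda>t. 1 - t * k) has_real_derivative - k) (at t within {0..})" for k :: real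
    by (auto intro!: derivative_eq_intros)
  from this[of "1 / T1"] have "((\<lambda>t. 1 - t / T1) has_real_derivative - (1 / T1)) (at t within {0..})"
    by simp
  from DERIV_chain2[OF DERIV_pos_part_power[of 0 "1 - t / T1"] this]
  show "(time_cut T1 has_real_derivative 2 * max 0 (1 - t / T1) * (- (1 / T1))) (at t within {0..})"
    by (simp add: time_cut_def[abs_def] power2_eq_square)
next
  have "continuous_on {0..} (\<lambda>t. 2 * max 0 (1 - t * k) * l)" for k l :: real
    by (intro continuous_intros)
  from this[of "inverse T1" "- (1 / T1)"]
  show "continuous_on {0..} (\<lambda>t. 2 * max 0 (1 - t / T1) * (- (1 / T1)))"
    by (simp only: divide_inverse)
qed

lemma time_cut_0: "time_cut T1 0 = 1" and time_cut_vanish: "0 < T1 \<Longrightarrow> T1 < t \<Longrightarrow> time_cut T1 t = 0"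
  by (auto simp: time_cut_def max_def)

lemma tendsto_time_cut: "0 < T1 \<Longrightarrow> (time_cut T1 \<longlongrightarrow> 1) (at_right 0)"
  unfolding time_cut_def[abs_def] by (auto intro!: tendsto_eq_intros)

lemma test_fun_product:
  assumes g: "C2 g" "Cc g" and T1: "0 < T1" "ereal T1 < T"
  shows "test_fun T (\<lambda>x t. g x * time_cut T1 t)"
proof -
  obtain D D2 where p: "par \<infinity> (\<lambda>x t. g x) (\<lambda>x t. 0) D D2" using g unfolding C2_def by (elim exE)
  obtain R where R: "\<And>x. R < norm x \<Longrightarrow> g x = 0" using g by (auto simp: Cc_iff)
  have "vanishes R T1 T (\<lambda>x t. g x * time_cut T1 t)"
    using R time_cut_vanish[OF T1(1)] by (auto simp: vanishes_def)
  from test_funI[OF par_mult[OF par_subset[OF p] par_time_cut] this T1(2)] show ?thesis by simp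
qed

text \<open>The error is measured against one function \<eta> of the same class, fixed before e, so
  pairing the error with a solution or a measure costs at most e times the pairing with \<eta>. The
  approximant is \<eta> times a C^2 approximation of the quotient of \<psi> by \<eta>.\<close>

lemma Cc_C2_approx:
  fixes \<psi> :: "'a::euclidean_space \<Rightarrow> real"
  assumes \<psi>: "Cc \<psi>"
  obtains \<eta> :: "'a \<Rightarrow> real" where "C2 \<eta>" "Cc \<eta>" "\<And>x. 0 \<le> \<eta> x"
    "\<And>e. 0 < e \<Longrightarrow> \<exists>g. C2 g \<and> Cc g \<and> (\<forall>x. \<bar>\<psi> x - g x\<bar> \<le> e * \<eta> x)"
proof -
  obtain R0 where R0: "\<And>x. R0 < norm x \<Longrightarrow> \<psi> x = 0" using \<psi> by (auto simp: Cc_iff)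
  define R where "R = max R0 0"
  have R: "0 \<le> R" "\<And>x. R < norm x \<Longrightarrow> \<psi> x = 0" using R0 by (auto simp: R_def)
  \<comment> \<open>The margin 1 keeps \<eta> above the positive constant c on the ball that carries
    \<psi>.\<close>
  define S where "S = R + 1"
  have S: "R < S" "0 < S" using R by (auto simp: S_def)
  \<comment> \<open>The cube is C^2 across the sphere of radius S; a square would be only C^1
    there.\<close>
  define \<eta> :: "'a \<Rightarrow> real" where "\<eta> x = max 0 (1 - inner (x - 0) (x - 0) / S\<^sup>2) ^ 3" for x
  define c where "c = (1 - R\<^sup>2 / S\<^sup>2) ^ 3"
  have "R\<^sup>2 < S\<^sup>2" using R S by (intro power_strict_mono) auto
  then have c: "0 < c" using S by (simp add: c_def)
  have \<eta>0: "0 \<le> \<eta> x" for x by (simp add: \<eta>_def)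
  have \<eta>out: "\<eta> x = 0" if "S < norm x" for x
  proof -
    have "S\<^sup>2 \<le> (norm x)\<^sup>2" using that S by (intro power_mono) auto
    then show ?thesis using S by (simp add: \<eta>_def dot_square_norm max_def field_simps)
  qed
  have \<eta>in: "c \<le> \<eta> x" if "norm x \<le> R" for x
  proof -
    have "(norm x)\<^sup>2 \<le> R\<^sup>2" using that by (intro power_mono) auto
    then have "1 - R\<^sup>2 / S\<^sup>2 \<le> 1 - (norm x)\<^sup>2 / S\<^sup>2"
      using S by (simp add: divide_right_mono)
    moreover have "0 \<le> 1 - R\<^sup>2 / S\<^sup>2" using \<open>R\<^sup>2 < S\<^sup>2\<close> S by simp
    ultimately show ?thesis
      unfolding c_def \<eta>_def dot_square_norm diff_zero by (intro power_mono) auto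
  qed
  have C2\<eta>: "C2 \<eta>"
  proof -
    define k where "k = inverse (S\<^sup>2)"
    define G where "G n w = max 0 (1 - w * k) ^ n" for n :: nat and w :: real
    have G: "(G (Suc (Suc n)) has_real_derivative (real n + 2) * G (Suc n) w * - k) (at w)" for n w
    proof -
      have "((\<lambda>w. 1 - w * k) has_real_derivative - k) (at w)"
        by (auto intro!: derivative_eq_intros)
      from DERIV_chain2[OF DERIV_pos_part_power[of n "1 - w * k"] this]
      show ?thesis unfolding G_def[abs_def] .
    qed
    have c: "continuous_on UNIV (\<lambda>w. 2 * G 1 w * - k * (- (3 * k)))"
      unfolding G_def by (intro continuous_intros)
    have 1: "(G 3 has_real_derivative G 2 w * (- (3 * k))) (at w)"
      "((\<lambda>w. G 2 w * (- (3 * k))) has_real_derivative 2 * G 1 w * - k * (- (3 * k))) (at w)" for w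
      using G[of 1 w] DERIV_cmult_right[OF G[of 0 w], of "- (3 * k)"]
      by (simp_all add: numeral_2_eq_2 numeral_3_eq_3 mult.commute mult.left_commute)
    have "\<exists>D D2. par \<infinity> (\<lambda>x t. G 3 (inner (x - 0) (x - 0))) (\<lambda>x t. G 2 (inner (x - 0) (x - 0)) * (- (3 * k)) * 0) D D2"
      by (intro exI) (rule par_comp[OF par_sqdist UNIV_I 1 c])
    then show ?thesis unfolding C2_def \<eta>_def G_def k_def by (simp add: divide_inverse)
  qed
  then have "continuous_on UNIV \<eta>" by (rule C2_continuous)
  then have Cc\<eta>: "Cc \<eta>" using \<eta>out by (auto simp: Cc_iff)
  show thesis
  proof (rule that[OF C2\<eta> Cc\<eta> \<eta>0])
    fix e :: real assume e: "0 < e"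
    \<comment> \<open>\<open>max (\<eta> x) c\<close> avoids division by 0 near the sphere of radius
      S and equals \<open>\<eta> x\<close> wherever \<psi> is nonzero.\<close>
    have "continuous_on (cball 0 S) (\<lambda>x. \<psi> x / max (\<eta> x) c)"
      using c by (intro continuous_intros Cc_continuous \<psi> Cc\<eta>) auto
    then obtain P where P: "C2 P" "\<And>x. x \<in> cball 0 S \<Longrightarrow> \<bar>\<psi> x / max (\<eta> x) c - P x\<bar> < e"
      by (rule C2_approx[OF compact_cball _ e]) (erule that, blast)
    have "\<bar>\<psi> x - \<eta> x * P x\<bar> \<le> e * \<eta> x" for x
    proof (cases "norm x \<le> S")
      case True
      have "\<psi> x = \<eta> x * (\<psi> x / max (\<eta> x) c)"
      proof (cases "norm x \<le> R")
        case True
        then show ?thesis using \<eta>in[OF True] c by (simp add: max_def)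
      qed (use R in auto)
      then have "\<bar>\<psi> x - \<eta> x * P x\<bar> = \<eta> x * \<bar>\<psi> x / max (\<eta> x) c - P x\<bar>"
        using \<eta>0[of x] by (metis abs_mult abs_of_nonneg right_diff_distrib)
      also have "\<dots> \<le> \<eta> x * e"
        using P(2)[of x] True \<eta>0[of x] by (intro mult_left_mono) auto
      finally show ?thesis by (simp add: mult.commute)
    next
      case False
      then show ?thesis using \<eta>out[of x] R(2)[of x] S by simp
    qed
    then show "\<exists>g. C2 g \<and> Cc g \<and> (\<forall>x. \<bar>\<psi> x - g x\<bar> \<le> e * \<eta> x)"
      using C2_mult[OF C2\<eta> P(1)] Cc_mult[OF Cc\<eta> C2_continuous[OF P(1)]]
      by (intro exI[of _ "\<lambda>x. \<eta> x * P x"]) simp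
  qed
qed

section \<open>Borel representatives and the weak formulation\<close>

lemma integral_lebesgue_eq_lborel:
  fixes f g :: "'a::euclidean_space \<Rightarrow> real"
  assumes g: "g \<in> borel_measurable borel" and ae: "AE x in lborel. f x = g x"
  shows "(LINT x|lebesgue. f x) = (LINT x|lborel. g x)"
proof -
  have g': "g \<in> borel_measurable lebesgue" using g by (auto intro: measurable_completion)
  have ae': "AE x in lebesgue. g x = f x" using ae by (auto simp: AE_completion_iff eq_commute)
  have "(LINT x|lebesgue. f x) = (LINT x|lebesgue. g x)"
    by (intro integral_cong_AE borel_measurable_AE[OF g' ae'] g') (use ae' in \<open>auto simp: eq_commute\<close>)
  also have "\<dots> = (LINT x|lborel. g x)" using g by (intro integral_completion) auto
  finally show ?thesis .
qed

lemma open_Collect_time_less: "open {z :: 'a::topological_space \<times> real. ereal (snd z) < T}"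
proof (cases T)
  case (real r)
  then show ?thesis by (auto intro!: open_Collect_less continuous_intros)
qed auto

lemma strip_borel: "strip T \<in> sets (borel :: ('a::euclidean_space \<times> real) measure)"
proof -
  have "strip T = {z :: 'a \<times> real. 0 \<le> snd z} \<inter> {z. ereal (snd z) < T}" by (auto simp: strip_def)
  also have "\<dots> \<in> sets borel"
  proof (rule sets.Int[OF borel_closed borel_open])
    show "closed {z :: 'a \<times> real. 0 \<le> snd z}" by (intro closed_Collect_le continuous_intros)
    show "open {z :: 'a \<times> real. ereal (snd z) < T}" by (rule open_Collect_time_less)
  qed
  finally show ?thesis .
qed

text \<open>\<open>v\<close> stands for a Borel representative of a solution.  It vanishes off \<open>0 < t < T\<close>, so that
  the arbitrary values of a test function off the strip never matter.\<close>

locale weak_rep =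
  fixes m p :: real and T :: ereal and v :: "'a::euclidean_space \<Rightarrow> real \<Rightarrow> real"
  assumes m: "0 < m" "m < 1" and p: "1 < p" and T: "0 < T"
    and meas: "(\<lambda>z. v (fst z) (snd z)) \<in> borel_measurable borel"
    and v_nonneg: "0 \<le> v x t"
    and v_outside: "\<not> (0 < t \<and> ereal t < T) \<Longrightarrow> v x t = 0"
    and v_loc: "\<And>R T1. ereal T1 < T \<Longrightarrow>
      integrable lborel (\<lambda>z. indicator (cball 0 R \<times> {0..T1}) z * v (fst z) (snd z) powr p)"

text \<open>Agreement in almost every time slice is what iterated integrals and essential limits in
  time see.\<close>

definition slice_eq :: "ereal \<Rightarrow> ('a::euclidean_space \<Rightarrow> real \<Rightarrow> real) \<Rightarrow> ('a \<Rightarrow> real \<Rightarrow> real) \<Rightarrow> bool"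
  where "slice_eq T u v \<longleftrightarrow> (AE t in lborel. 0 < t \<and> ereal t < T \<longrightarrow> (AE x in lborel. u x t = v x t))"

text \<open>Fubini delivers the space variable outside, while time slices need the opposite order.
  The exchange is made for a measurable null set N containing the exceptions, as P itself may fail
  to be measurable.\<close>

lemma AE_lborel_pair_swap:
  fixes P :: "'a::euclidean_space \<times> real \<Rightarrow> bool"
  assumes "AE z in lborel. P z"
  shows "AE t in lborel. AE x in lborel. P (x, t)"
proof -
  have "AE z in lborel \<Otimes>\<^sub>M lborel. P z" using assms unfolding lborel_prod .
  then obtain N where N: "{z \<in> space (lborel \<Otimes>\<^sub>M lborel). \<not> P z} \<subseteq> N" "N \<in> null_sets (lborel \<Otimes>\<^sub>M lborel)"
    by (auto simp: eventually_ae_filter)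
  then have "AE z in lborel \<Otimes>\<^sub>M lborel. z \<notin> N" by (intro AE_not_in)
  from lborel_pair.AE_pair[OF this] have "AE x in lborel. AE t in lborel. (x, t) \<notin> N" .
  moreover have "{z \<in> space (lborel \<Otimes>\<^sub>M lborel). (fst z, snd z) \<notin> N} \<in> sets (lborel \<Otimes>\<^sub>M lborel)"
  proof -
    have "{z \<in> space (lborel \<Otimes>\<^sub>M lborel). (fst z, snd z) \<notin> N} = space (lborel \<Otimes>\<^sub>M lborel) - N" by auto
    then show ?thesis using N(2) by (simp only: sets.compl_sets null_setsD2)
  qed
  ultimately have "AE t in lborel. AE x in lborel. (x, t) \<notin> N"
    using lborel_pair.AE_commute[of "\<lambda>x t. (x, t) \<notin> N"] by blast
  then show ?thesis
  proof eventually_elim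
    case (elim t)
    then show ?case
    proof eventually_elim
      case (elim x)
      then show ?case using N(1) by (auto simp: space_pair_measure)
    qed
  qed
qed

lemma admissible_weak_rep:
  fixes u :: "'a::euclidean_space \<Rightarrow> real \<Rightarrow> real"
  assumes mp: "0 < m" "m < 1" "1 < p" "0 < T" and u: "admissible p T u"
  obtains v where "weak_rep m p T v" "slice_eq T u v"
proof -
  have loc: "set_borel_measurable lebesgue (strip T) (\<lambda>(x, t). u x t)"
    "\<And>K. compact K \<Longrightarrow> K \<subseteq> strip T \<Longrightarrow> set_integrable lebesgue K (\<lambda>(x, t). \<bar>u x t\<bar> powr p)"
    and nn: "AE z in lborel. 0 < snd z \<and> ereal (snd z) < T \<longrightarrow> 0 \<le> u (fst z) (snd z)"
    using u by (auto simp: admissible_def Lp_loc_def AE_completion_iff case_prod_unfold)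
  obtain g where g: "g \<in> borel_measurable lborel"
    "AE z in lborel. indicator (strip T) z *\<^sub>R (case z of (x, t) \<Rightarrow> u x t) = g z"
    using completion_ex_borel_measurable_real[OF loc(1)[unfolded set_borel_measurable_def]] by blast
  have g' [measurable]: "g \<in> borel_measurable borel" using g(1) by simp
  \<comment> \<open>The sign and the vanishing outside 0 < t < T hold everywhere by construction;
    for 0 < t < T this differs from u on a null set only.\<close>
  define v where "v x t = (if 0 < t \<and> ereal t < T then max 0 (g (x, t)) else 0)" for x t
  have eq: "AE z in lborel. 0 < snd z \<and> ereal (snd z) < T \<longrightarrow> u (fst z) (snd z) = v (fst z) (snd z)"
    using nn g(2) by eventually_elim (auto simp: v_def strip_def case_prod_unfold split: if_splits)
  have vm: "(\<lambda>z. v (fst z) (snd z)) \<in> borel_measurable borel"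
  proof -
    let ?A = "{z :: 'a \<times> real. 0 < snd z} \<inter> {z. ereal (snd z) < T}"
    have A: "?A \<in> sets borel"
      by (intro borel_open open_Int open_Collect_time_less open_Collect_less continuous_intros)
    have "(\<lambda>z. indicator ?A z * max 0 (g z)) \<in> borel_measurable borel"
      using A by (intro borel_measurable_times borel_measurable_indicator borel_measurable_max g' borel_measurable_const)
    moreover have "(\<lambda>z. indicator ?A z * max 0 (g z)) = (\<lambda>z. v (fst z) (snd z))"
      by (auto simp: v_def indicator_def fun_eq_iff)
    ultimately show ?thesis by simp
  qed
  have v_nn: "0 \<le> v x t" for x t by (simp add: v_def)
  have "weak_rep m p T v"
  proof
    fix R T1 assume T1: "ereal T1 < T"
    let ?K = "cball (0::'a) R \<times> {0..T1}"
    have "compact ?K" by (intro compact_Times) auto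
    moreover have "?K \<subseteq> strip T"
      by (rule box_subset_strip[OF T1])
    ultimately have i: "integrable lebesgue (\<lambda>z. indicator ?K z *\<^sub>R (case z of (x, t) \<Rightarrow> \<bar>u x t\<bar> powr p))"
      using loc(2) by (auto simp: set_integrable_def)
    have K [measurable]: "?K \<in> sets borel" by (intro borel_closed closed_Times) auto
    have mm: "(\<lambda>z. indicator ?K z * v (fst z) (snd z) powr p) \<in> borel_measurable borel"
      using vm K by simp
    \<comment> \<open>The boxes include t = 0, where \<open>v\<close> is 0 and u is arbitrary, so
      this slice is discarded as a null set.\<close>
    have sl: "AE z in lborel. snd (z :: 'a \<times> real) \<noteq> 0"
    proof -
      have "{z \<in> space (lborel \<Otimes>\<^sub>M lborel). snd (z :: 'a \<times> real) \<noteq> 0} \<in> sets (lborel \<Otimes>\<^sub>M lborel)"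
        by measurable
      moreover have "AE x in lborel. AE t in lborel. snd (x :: 'a, t :: real) \<noteq> 0"
        using AE_lborel_singleton[of "0::real"] by simp
      ultimately have "AE z in lborel \<Otimes>\<^sub>M lborel. snd (z :: 'a \<times> real) \<noteq> 0"
        by (rule lborel_pair.AE_pair_measure)
      then show ?thesis unfolding lborel_prod .
    qed
    have "AE z in lborel. indicator ?K z *\<^sub>R (case z of (x, t) \<Rightarrow> \<bar>u x t\<bar> powr p) = indicator ?K z * v (fst z) (snd z) powr p"
      using eq sl
    proof eventually_elim
      case (elim z)
      have "ereal (snd z) < T" if "snd z \<le> T1" using that T1 by (meson ereal_less_eq(3) order_le_less_trans)
      then show ?case using elim v_nn
        by (cases z) (auto simp: indicator_def)
    qed
    then have "AE z in lebesgue. indicator ?K z *\<^sub>R (case z of (x, t) \<Rightarrow> \<bar>u x t\<bar> powr p) = indicator ?K z * v (fst z) (snd z) powr p"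
      by (simp add: AE_completion_iff)
    moreover have "(\<lambda>z. indicator ?K z * v (fst z) (snd z) powr p) \<in> borel_measurable lebesgue"
      using mm by (intro measurable_completion) simp
    ultimately have "integrable lebesgue (\<lambda>z. indicator ?K z * v (fst z) (snd z) powr p)"
      by (intro integrable_cong_AE_imp[OF i])
    then show "integrable lborel (\<lambda>z. indicator ?K z * v (fst z) (snd z) powr p)"
      using mm by (subst integrable_completion[symmetric]) auto
  qed (use mp vm in \<open>auto simp: v_def\<close>)
  moreover have "slice_eq T u v"
    unfolding slice_eq_def using AE_lborel_pair_swap[OF eq] by eventually_elim auto
  ultimately show ?thesis by (rule that)
qed


lemma powr_le_one_plus: assumes "0 \<le> a" "0 < e" "e \<le> q" shows "a powr e \<le> 1 + a powr (q::real)"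
proof (cases "a \<le> 1")
  case True
  then have "a powr e \<le> 1" using assms by (cases "a = 0") (auto intro: powr_le1)
  then show ?thesis by (smt (verit) powr_ge_zero)
next
  case False
  then have "a powr e \<le> a powr q" using assms by (intro powr_mono) auto
  then show ?thesis by simp
qed

text \<open>The indicator hides the arbitrary values off the strip, so that measurability and a
  bound hold on all of space-time.\<close>

lemma strip_mult_bounded:
  fixes f :: "'a::euclidean_space \<Rightarrow> real \<Rightarrow> real"
  assumes c: "continuous_on (strip T) (\<lambda>(x, t). f x t)" and v: "vanishes R T1 T f" and T1: "ereal T1 < T"
  shows "(\<lambda>z. indicator (strip T) z * f (fst z) (snd z)) \<in> borel_measurable borel"
    "\<exists>B. \<forall>z. \<bar>indicator (strip T) z * f (fst z) (snd z)\<bar> \<le> B"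
proof -
  show "(\<lambda>z. indicator (strip T) z * f (fst z) (snd z)) \<in> borel_measurable borel"
    using borel_measurable_continuous_on_indicator[OF strip_borel c] by (simp add: case_prod_unfold)
  let ?K = "cball (0::'a) R \<times> {0..T1}"
  have sub: "?K \<subseteq> strip T"
    by (rule box_subset_strip[OF T1])
  have "compact ?K" by (intro compact_Times) auto
  then have "compact ((\<lambda>(x, t). f x t) ` ?K)"
    by (rule compact_continuous_image[rotated]) (rule continuous_on_subset[OF c sub])
  then have "bounded ((\<lambda>(x, t). f x t) ` ?K)" by (rule compact_imp_bounded)
  then obtain B where "\<forall>y\<in>(\<lambda>(x, t). f x t) ` ?K. norm y \<le> B" unfolding bounded_iff by (elim exE)
  then have B: "\<bar>f x t\<bar> \<le> B" if "norm x \<le> R" "0 \<le> t" "t \<le> T1" for x t using that by auto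
  show "\<exists>B. \<forall>z. \<bar>indicator (strip T) z * f (fst z) (snd z)\<bar> \<le> B"
  proof (intro exI[of _ "max B 0"] allI)
    fix z :: "'a \<times> real"
    obtain x t where z: "z = (x, t)" by (cases z)
    show "\<bar>indicator (strip T) z * f (fst z) (snd z)\<bar> \<le> max B 0"
    proof (cases "z \<in> strip T")
      case True
      then have "0 \<le> t" by (simp add: z strip_iff)
      show ?thesis
      proof (cases "norm x \<le> R \<and> t \<le> T1")
        case True
        then show ?thesis using B[of x t] \<open>0 \<le> t\<close> \<open>z \<in> strip T\<close> by (simp add: z)
      next
        case False
        then have "f x t = 0" using v \<open>z \<in> strip T\<close> unfolding vanishes_def z by (meson not_le)
        then show ?thesis by (simp add: z)
      qed
    qed simp
  qed
qed

section \<open>Integrability of the weak formulation\<close>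

context weak_rep
begin

lemma integrable_pow:
  assumes e: "0 < e" "e \<le> p" and T1: "ereal T1 < T" and w: "w \<in> borel_measurable borel"
    and B: "\<And>z. \<bar>w z\<bar> \<le> B" and supp: "\<And>x t. (x, t) \<in> strip T \<Longrightarrow> R < norm x \<or> T1 < t \<Longrightarrow> w (x, t) = 0"
  shows "integrable lborel (\<lambda>z. v (fst z) (snd z) powr e * w z)"
proof -
  let ?K = "cball (0::'a) R \<times> {0..T1}"
  have K: "?K \<in> sets borel" by (intro borel_closed closed_Times) auto
  have "compact ?K" by (intro compact_Times) auto
  then have "emeasure lborel ?K < \<infinity>" by (intro emeasure_bounded_finite compact_imp_bounded)
  then have iK: "integrable lborel (indicator ?K :: _ \<Rightarrow> real)"
    using K by (intro integrable_real_indicator) auto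
  have "integrable lborel (\<lambda>z. B * (indicator ?K z + indicator ?K z * v (fst z) (snd z) powr p))"
    by (intro integrable_mult_right Bochner_Integration.integrable_add iK v_loc[OF T1])
  moreover have "(\<lambda>z. v (fst z) (snd z) powr e * w z) \<in> borel_measurable lborel"
    using meas w by simp
  ultimately show ?thesis
  proof (rule Bochner_Integration.integrable_bound, intro always_eventually allI)
    fix z :: "'a \<times> real"
    obtain x t where z: "z = (x, t)" by (cases z)
    have B0: "0 \<le> B" using B[of z] by linarith
    show "norm (v (fst z) (snd z) powr e * w z) \<le> norm (B * (indicator ?K z + indicator ?K z * v (fst z) (snd z) powr p))"
    proof (cases "z \<in> ?K")
      case True
      have "v x t powr e * \<bar>w z\<bar> \<le> (1 + v x t powr p) * B"
        using powr_le_one_plus[OF v_nonneg e, of x t] B[of z] by (intro mult_mono) auto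
      then show ?thesis using True B0 by (simp add: z abs_mult mult.commute)
    next
      case False
      have "v x t powr e * w z = 0"
      proof (cases "0 < t \<and> ereal t < T")
        case True
        then have "(x, t) \<in> strip T" by (simp add: strip_iff)
        moreover have "R < norm x \<or> T1 < t" using False True by (auto simp: z not_le)
        ultimately show ?thesis using supp by (simp add: z)
      qed (simp add: v_outside)
      then have "norm (v (fst z) (snd z) powr e * w z) = 0"
        by (simp only: z fst_conv snd_conv norm_zero)
      then show ?thesis by (simp only: norm_ge_zero)
    qed
  qed
qed

lemma integrable_pow_strip:
  assumes e: "0 < e" "e \<le> p" and T1: "ereal T1 < T"
    and c: "continuous_on (strip T) (\<lambda>(x, t). f x t)" and van: "vanishes R T1 T f"
  shows "integrable lborel (\<lambda>z. v (fst z) (snd z) powr e * f (fst z) (snd z))"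
proof -
  note s = strip_mult_bounded[OF c van T1]
  obtain B where "\<forall>z. \<bar>indicator (strip T) z * f (fst z) (snd z)\<bar> \<le> B" using s(2) by (elim exE)
  then have "integrable lborel (\<lambda>z. v (fst z) (snd z) powr e * (indicator (strip T) z * f (fst z) (snd z)))"
    using van by (intro integrable_pow[OF e T1 s(1), of B R]) (auto simp: vanishes_def)
  moreover have "v (fst z) (snd z) powr e * (indicator (strip T) z * f (fst z) (snd z)) =
    v (fst z) (snd z) powr e * f (fst z) (snd z)" for z
    using v_outside[of "snd z" "fst z"]
    by (cases "0 < snd z \<and> ereal (snd z) < T") (auto simp: indicator_def strip_def case_prod_unfold)
  ultimately show ?thesis by simp
qed

definition \<Phi> :: "('a \<Rightarrow> real \<Rightarrow> real) \<Rightarrow> 'a \<Rightarrow> real \<Rightarrow> real"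
  where "\<Phi> \<phi> x t = - v x t * time_deriv \<phi> x t - v x t powr m * laplacian (\<lambda>y. \<phi> y t) x - v x t powr p * \<phi> x t"

definition F :: "('a \<Rightarrow> real \<Rightarrow> real) \<Rightarrow> real \<Rightarrow> real"
  where "F \<phi> t = (LINT x|lborel. \<Phi> \<phi> x t)"

definition g :: "('a \<Rightarrow> real \<Rightarrow> real) \<Rightarrow> real \<Rightarrow> real"
  where "g \<phi> t = (LINT x|lborel. v x t * \<phi> x t)"

text \<open>No upper limit T appears because \<open>v\<close> vanishes from T on, and with it
  \<open>F\<close>.\<close>

definition W :: "('a \<Rightarrow> real \<Rightarrow> real) \<Rightarrow> real \<Rightarrow> real"
  where "W \<phi> \<tau> = (LINT t|lborel. indicator {\<tau><..} t * F \<phi> t)"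

lemma v_powr_1: "v x t powr 1 = v x t"
  using v_nonneg[of x t] by simp

lemma test_continuous:
  assumes "test_fun T \<phi>"
  shows "continuous_on (strip T) (\<lambda>(x, t). \<phi> x t)" "continuous_on (strip T) (\<lambda>(x, t). time_deriv \<phi> x t)"
    "continuous_on (strip T) (\<lambda>(x, t). laplacian (\<lambda>y. \<phi> y t) x)"
proof -
  note p = test_fun_par[OF assms]
  show "continuous_on (strip T) (\<lambda>(x, t). \<phi> x t)" "continuous_on (strip T) (\<lambda>(x, t). time_deriv \<phi> x t)"
    using parD(1,2)[OF p] by auto
  show "continuous_on (strip T) (\<lambda>(x, t). laplacian (\<lambda>y. \<phi> y t) x)"
    unfolding laplacian_def case_prod_unfold
    by (intro continuous_on_sum parD(4)[OF p, unfolded case_prod_unfold])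
qed

lemma test_vanishes:
  assumes "test_fun T \<phi>" "vanishes R T1 T \<phi>"
  shows "vanishes R T1 T (time_deriv \<phi>)" "vanishes R T1 T (\<lambda>x t. laplacian (\<lambda>y. \<phi> y t) x)"
proof -
  note p = vanishes_derivs[OF test_fun_par[OF assms(1)] assms(2)]
  show "vanishes R T1 T (time_deriv \<phi>)" by (rule p(1))
  show "vanishes R T1 T (\<lambda>x t. laplacian (\<lambda>y. \<phi> y t) x)"
    using p(3) unfolding laplacian_def vanishes_def by (auto intro!: sum.neutral)
qed

lemma test_integrable:
  assumes \<phi>: "test_fun T \<phi>"
  shows "integrable lborel (\<lambda>z. v (fst z) (snd z) * \<phi> (fst z) (snd z))"
    "integrable lborel (\<lambda>z. v (fst z) (snd z) powr p * \<phi> (fst z) (snd z))"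
    "integrable lborel (\<lambda>z. v (fst z) (snd z) * time_deriv \<phi> (fst z) (snd z))"
    "integrable lborel (\<lambda>z. v (fst z) (snd z) powr m * laplacian (\<lambda>y. \<phi> y (snd z)) (fst z))"
    "integrable lborel (\<lambda>z. \<Phi> \<phi> (fst z) (snd z))"
proof -
  obtain R T1 where R: "0 < R" "0 < T1" "ereal T1 < T" "vanishes R T1 T \<phi>"
    using test_fun_vanishes[OF \<phi> T] .
  note c = test_continuous[OF \<phi>] and w = R(4) test_vanishes[OF \<phi> R(4)]
  show 1: "integrable lborel (\<lambda>z. v (fst z) (snd z) * \<phi> (fst z) (snd z))"
    using integrable_pow_strip[OF _ _ R(3) c(1) w(1), of 1, unfolded v_powr_1] p by simp
  show 2: "integrable lborel (\<lambda>z. v (fst z) (snd z) powr p * \<phi> (fst z) (snd z))"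
    using integrable_pow_strip[OF _ _ R(3) c(1) w(1), of p] p by simp
  show 3: "integrable lborel (\<lambda>z. v (fst z) (snd z) * time_deriv \<phi> (fst z) (snd z))"
    using integrable_pow_strip[OF _ _ R(3) c(2) w(2), of 1, unfolded v_powr_1] p by simp
  show 4: "integrable lborel (\<lambda>z. v (fst z) (snd z) powr m * laplacian (\<lambda>y. \<phi> y (snd z)) (fst z))"
    using integrable_pow_strip[OF _ _ R(3) c(3) w(3), of m] p m by simp
  show "integrable lborel (\<lambda>z. \<Phi> \<phi> (fst z) (snd z))"
    using Bochner_Integration.integrable_diff[OF Bochner_Integration.integrable_diff[OF Bochner_Integration.integrable_minus[OF 3] 4] 2] by (simp add: \<Phi>_def)
qed

lemma integrable_slice:
  fixes f :: "'a \<Rightarrow> real \<Rightarrow> real"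
  assumes "integrable lborel (\<lambda>z. f (fst z) (snd z))"
  shows "AE t in lborel. integrable lborel (\<lambda>x. f x t)" "integrable lborel (\<lambda>t. LINT x|lborel. f x t)"
    "(LINT t|lborel. LINT x|lborel. f x t) = (LINT z|lborel. f (fst z) (snd z))"
proof -
  have i: "integrable (lborel \<Otimes>\<^sub>M lborel) (case_prod f)"
    using assms unfolding lborel_prod case_prod_unfold .
  show "AE t in lborel. integrable lborel (\<lambda>x. f x t)" by (rule lborel_pair.AE_integrable_snd[OF i])
  show "integrable lborel (\<lambda>t. LINT x|lborel. f x t)" by (rule lborel_pair.integrable_snd[OF i])
  show "(LINT t|lborel. LINT x|lborel. f x t) = (LINT z|lborel. f (fst z) (snd z))"
    using lborel_pair.integral_snd[OF i] unfolding lborel_prod case_prod_unfold .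
qed

lemma F_integrable: "test_fun T \<phi> \<Longrightarrow> integrable lborel (F \<phi>)"
  unfolding F_def by (intro integrable_slice(2) test_integrable)

lemma F_measurable: "test_fun T \<phi> \<Longrightarrow> F \<phi> \<in> borel_measurable borel"
  using borel_measurable_integrable[OF F_integrable] by simp

lemma g_integrable: "test_fun T \<phi> \<Longrightarrow> integrable lborel (g \<phi>)"
  unfolding g_def by (intro integrable_slice(2) test_integrable)

lemma slice_measurable:
  fixes f :: "'a \<Rightarrow> real \<Rightarrow> real"
  assumes "(\<lambda>z. f (fst z) (snd z)) \<in> borel_measurable borel"
  shows "(\<lambda>x. f x t) \<in> borel_measurable borel"
proof -
  have "(\<lambda>x. (x, t)) \<in> borel \<rightarrow>\<^sub>M (borel :: ('a \<times> real) measure)"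
    by (intro borel_measurable_continuous_onI continuous_intros)
  from measurable_compose[OF this assms] show ?thesis by simp
qed

lemma integrable_slice_measurable:
  fixes f :: "'a \<Rightarrow> real \<Rightarrow> real"
  assumes "integrable lborel (\<lambda>z. f (fst z) (snd z))"
  shows "(\<lambda>x. f x t) \<in> borel_measurable borel"
  using borel_measurable_integrable[OF assms] by (intro slice_measurable) simp

text \<open>The outer integral in time tolerates an exceptional null set of slices, and each other
  slice integral of u may be computed with the Borel representative.\<close>

lemma weak_integral_eq:
  assumes u: "slice_eq T u v" and \<phi>: "test_fun T \<phi>" and \<tau>: "0 \<le> \<tau>"
  shows "weak_integral m p \<tau> T u \<phi> = W \<phi> \<tau>"
proof -
  let ?A = "{t. \<tau> < t \<and> ereal t < T}"
  let ?U = "\<lambda>t. LINT x|lebesgue. - u x t * time_deriv \<phi> x t - u x t powr m * laplacian (\<lambda>y. \<phi> y t) x - u x t powr p * \<phi> x t"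
  have "AE t in lborel. indicator ?A t *\<^sub>R ?U t = indicator {\<tau><..} t * F \<phi> t"
    using u unfolding slice_eq_def
  proof eventually_elim
    case (elim t)
    show ?case
    proof (cases "\<tau> < t \<and> ereal t < T")
      case True
      then have ae: "AE x in lborel. u x t = v x t" using elim \<tau> by auto
      have "?U t = F \<phi> t"
        unfolding F_def
        by (rule integral_lebesgue_eq_lborel[OF integrable_slice_measurable[OF test_integrable(5)[OF \<phi>]]])
          (use ae in \<open>eventually_elim, simp add: \<Phi>_def\<close>)
      then show ?thesis using True by simp
    next
      case False
      have "indicator {\<tau><..} t * F \<phi> t = 0"
      proof (cases "\<tau> < t")
        case True
        then have "v x t = 0" for x using False by (intro v_outside) auto
        then show ?thesis by (simp add: F_def \<Phi>_def)
      qed simp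
      then show ?thesis using False by auto
    qed
  qed
  moreover have "(\<lambda>t. indicator {\<tau><..} t * F \<phi> t) \<in> borel_measurable borel"
    using borel_measurable_integrable[OF F_integrable[OF \<phi>]] by simp
  ultimately show ?thesis
    unfolding weak_integral_def W_def set_lebesgue_integral_def
    by (intro integral_lebesgue_eq_lborel)
qed

text \<open>\<open>F \<phi>\<close> is integrable up to t = 0, so its tail integrals converge by
  dominated convergence. Where the equation equates \<open>W\<close> and \<open>g\<close>, this
  becomes existence of the essential limit.\<close>

lemma W_tendsto:
  assumes \<phi>: "test_fun T \<phi>"
  shows "(W \<phi> \<longlongrightarrow> W \<phi> 0) (at_right 0)"
proof (rule tendsto_at_right_sequentially[of 0 1])
  fix S :: "nat \<Rightarrow> real" assume S: "\<And>n. 0 < S n" "S \<longlonglongrightarrow> 0"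
  show "(\<lambda>n. W \<phi> (S n)) \<longlonglongrightarrow> W \<phi> 0"
    unfolding W_def
  proof (rule integral_dominated_convergence[where w="\<lambda>t. \<bar>F \<phi> t\<bar>"])
    show "integrable lborel (\<lambda>t. \<bar>F \<phi> t\<bar>)" using F_integrable[OF \<phi>] by simp
    note F_measurable[OF \<phi>, measurable]
    show "(\<lambda>t. indicator {0<..} t * F \<phi> t) \<in> borel_measurable lborel"
      "\<And>n. (\<lambda>t. indicator {S n<..} t * F \<phi> t) \<in> borel_measurable lborel" by simp_all
    show "AE t in lborel. (\<lambda>n. indicator {S n<..} t * F \<phi> t) \<longlonglongrightarrow> indicator {0<..} t * F \<phi> t"
    proof (intro always_eventually allI tendsto_mult tendsto_const)
      fix t :: real
      have "\<forall>\<^sub>F n in sequentially. indicator {S n<..} t = (indicator {0<..} t :: real)"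
      proof (cases "0 < t")
        case True
        then have "\<forall>\<^sub>F n in sequentially. S n < t" by (rule order_tendstoD(2)[OF S(2)])
        then show ?thesis by eventually_elim (use True in simp)
      next
        case False
        then have "\<not> S n < t" for n using S(1)[of n] by linarith
        then show ?thesis using False by simp
      qed
      then show "(\<lambda>n. indicator {S n<..} t) \<longlonglongrightarrow> (indicator {0<..} t :: real)"
        by (rule tendsto_eventually)
    qed
  qed (auto simp: indicator_def)
qed simp

end

section \<open>Initial traces\<close>

text \<open>As a filter, the essential limit obeys the usual calculus of limits, and each eventual
  statement may carry its own null set of times.\<close>

definition ess_right_0 :: "real filter"
  where "ess_right_0 = inf (ae_filter lborel) (at_right 0)"

lemma eventually_ess_right_0:
  "eventually P ess_right_0 \<longleftrightarrow> (\<exists>\<delta>>0. AE t in lborel. 0 < t \<and> t < \<delta> \<longrightarrow> P t)"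
proof
  assume "eventually P ess_right_0"
  then obtain Q R where QR: "eventually Q (ae_filter lborel)" "eventually R (at_right 0)" "\<And>x. Q x \<Longrightarrow> R x \<Longrightarrow> P x"
    unfolding ess_right_0_def eventually_inf by auto
  then obtain \<delta> where "\<delta> > 0" "\<And>t. 0 < t \<Longrightarrow> t < \<delta> \<Longrightarrow> R t" unfolding eventually_at_right_field by auto
  then show "\<exists>\<delta>>0. AE t in lborel. 0 < t \<and> t < \<delta> \<longrightarrow> P t"
    using QR by (intro exI[of _ \<delta>] conjI) (auto elim!: eventually_mono)
next
  assume "\<exists>\<delta>>0. AE t in lborel. 0 < t \<and> t < \<delta> \<longrightarrow> P t"
  then obtain \<delta> where \<delta>: "\<delta> > 0" "AE t in lborel. 0 < t \<and> t < \<delta> \<longrightarrow> P t" by auto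
  have "eventually (\<lambda>t. 0 < t \<and> t < \<delta>) (at_right 0)"
    unfolding eventually_at_right_field using \<delta>(1) by auto
  then show "eventually P ess_right_0"
    unfolding ess_right_0_def eventually_inf using \<delta>(2) by blast
qed

lemma ess_right_0_neq_bot: "ess_right_0 \<noteq> bot"
proof
  assume "ess_right_0 = bot"
  then have "eventually (\<lambda>_. False) ess_right_0" by simp
  then obtain \<delta> where \<delta>: "\<delta> > 0" "AE t in lborel. \<not> (0 < t \<and> t < (\<delta>::real))" unfolding eventually_ess_right_0 by auto
  have "emeasure lborel {t \<in> space lborel. \<not> \<not> (0 < t \<and> t < (\<delta>::real))} = 0"
    using AE_E2[OF \<delta>(2)] by simp
  moreover have "{t \<in> space lborel. \<not> \<not> (0 < t \<and> t < (\<delta>::real))} = {0<..<\<delta>}" by auto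
  ultimately show False using \<delta>(1) by simp
qed

lemma ess_right_0_le: "ess_right_0 \<le> at_right 0" by (simp add: ess_right_0_def)

lemma ess_right_0_AE: "(AE t in lborel. P t) \<Longrightarrow> eventually P ess_right_0"
  by (rule filter_leD[of ess_right_0 "ae_filter lborel"]) (simp_all add: ess_right_0_def)

lemma ess_right_0_less: "0 < \<delta> \<Longrightarrow> \<forall>\<^sub>F t in ess_right_0. 0 < t \<and> t < \<delta>"
  unfolding eventually_ess_right_0 by auto

lemma ess_lim_0_iff: "ess_lim_0 f l \<longleftrightarrow> (f \<longlongrightarrow> l) ess_right_0"
  unfolding ess_lim_0_def tendsto_iff eventually_ess_right_0 AE_completion_iff dist_real_def ..

context weak_rep
begin

definition h :: "('a \<Rightarrow> real) \<Rightarrow> real \<Rightarrow> real"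
  where "h \<psi> t = (LINT x|lborel. v x t * \<psi> x)"

text \<open>One null set of times serves every \<psi> at once: integrability over countably many
  balls suffices, since each \<psi> is dominated by a multiple of the indicator of one of
  them.\<close>

lemma eventually_h_integrable:
  "\<forall>\<^sub>F t in ess_right_0. \<forall>\<psi>. Cc \<psi> \<longrightarrow> integrable lborel (\<lambda>x. v x t * \<psi> x)"
proof -
  obtain T1 where T1: "0 < T1" "ereal T1 < T" by (rule horizon[OF T])
  have "AE t in lborel. integrable lborel (\<lambda>x. v x t * indicator (cball 0 (real n) \<times> {0..T1}) (x, t))" for n
  proof -
    have K: "cball (0::'a) (real n) \<times> {0..T1} \<in> sets borel" by (intro borel_closed closed_Times) auto
    have "integrable lborel (\<lambda>z. v (fst z) (snd z) powr 1 * indicator (cball 0 (real n) \<times> {0..T1}) z)"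
      by (rule integrable_pow[OF _ _ T1(2), where B=1 and R="real n"])
        (use K p in \<open>auto simp: indicator_def\<close>)
    from integrable_slice(1)[of "\<lambda>x t. v x t * indicator (cball 0 (real n) \<times> {0..T1}) (x, t)"] this[unfolded v_powr_1]
    show ?thesis by simp
  qed
  then have "AE t in lborel. \<forall>n. integrable lborel (\<lambda>x. v x t * indicator (cball 0 (real n) \<times> {0..T1}) (x, t))"
    by (simp add: AE_all_countable)
  from ess_right_0_AE[OF this] ess_right_0_less[OF T1(1)] show ?thesis
  proof eventually_elim
    case (elim t)
    show ?case
    proof (intro allI impI)
      fix \<psi> :: "'a \<Rightarrow> real" assume \<psi>: "Cc \<psi>"
      obtain R where R: "\<And>x. R < norm x \<Longrightarrow> \<psi> x = 0" using \<psi> by (auto simp: Cc_iff)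
      obtain B where B: "B > 0" "\<And>x. \<bar>\<psi> x\<bar> \<le> B" by (rule Cc_bounded[OF \<psi>]) (erule that, blast)
      obtain n where n: "R \<le> real n" using real_arch_simple by blast
      have m1: "(\<lambda>x. v x t) \<in> borel_measurable borel" by (rule slice_measurable[OF meas])
      have m2: "\<psi> \<in> borel_measurable borel" by (rule Cc_measurable[OF \<psi>])
      show "integrable lborel (\<lambda>x. v x t * \<psi> x)"
      proof (rule Bochner_Integration.integrable_bound)
        show "integrable lborel (\<lambda>x. B * (v x t * indicator (cball 0 (real n) \<times> {0..T1}) (x, t)))"
          using elim by (intro integrable_mult_right) auto
        show "AE x in lborel. norm (v x t * \<psi> x) \<le> norm (B * (v x t * indicator (cball 0 (real n) \<times> {0..T1}) (x, t)))"
        proof (intro always_eventually allI)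
          fix x
          show "norm (v x t * \<psi> x) \<le> norm (B * (v x t * indicator (cball 0 (real n) \<times> {0..T1}) (x, t)))"
          proof (cases "norm x \<le> real n")
            case True
            have "v x t * \<bar>\<psi> x\<bar> \<le> v x t * B" using B v_nonneg by (intro mult_left_mono) auto
            then show ?thesis using True elim B v_nonneg[of x t] by (simp add: abs_mult mult.commute)
          next
            case False
            then show ?thesis using R[of x] n by simp
          qed
        qed
      qed (use m1 m2 in simp)
    qed
  qed
qed

end


section \<open>Convergence of the pairings and the trace measure\<close>

context weak_rep
begin

lemma g_product: "g (\<lambda>x t. \<psi> x * \<zeta> t) t = \<zeta> t * h \<psi> t"
proof -
  have "g (\<lambda>x t. \<psi> x * \<zeta> t) t = (LINT x|lborel. \<zeta> t * (v x t * \<psi> x))"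
    unfolding g_def by (intro Bochner_Integration.integral_cong) (auto simp: algebra_simps)
  then show ?thesis by (simp add: h_def)
qed

lemma eventually_h_bound:
  assumes "Cc f" "Cc k" "Cc \<eta>" "\<And>x. \<bar>f x - k x\<bar> \<le> c * \<eta> x"
  shows "\<forall>\<^sub>F t in ess_right_0. \<bar>h f t - h k t\<bar> \<le> c * h \<eta> t"
  using eventually_h_integrable
proof eventually_elim
  case (elim t)
  have i: "integrable lborel (\<lambda>x. v x t * f x)" "integrable lborel (\<lambda>x. v x t * k x)"
    "integrable lborel (\<lambda>x. v x t * (c * \<eta> x))"
    using elim assms Cc_cmult by auto
  have "\<bar>h f t - h k t\<bar> = \<bar>LINT x|lborel. v x t * f x - v x t * k x\<bar>"
    unfolding h_def by (simp add: Bochner_Integration.integral_diff[OF i(1,2)])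
  also have "\<dots> \<le> (LINT x|lborel. \<bar>v x t * f x - v x t * k x\<bar>)"
    by (rule integral_abs_bound)
  also have "\<dots> \<le> (LINT x|lborel. v x t * (c * \<eta> x))"
  proof (rule integral_mono)
    show "integrable lborel (\<lambda>x. \<bar>v x t * f x - v x t * k x\<bar>)"
      by (intro integrable_abs Bochner_Integration.integrable_diff i)
    fix x
    have "v x t * \<bar>f x - k x\<bar> \<le> v x t * (c * \<eta> x)"
      using assms(4) v_nonneg by (rule mult_left_mono)
    then show "\<bar>v x t * f x - v x t * k x\<bar> \<le> v x t * (c * \<eta> x)"
      using v_nonneg[of x t] by (simp add: abs_mult flip: right_diff_distrib)
  qed (rule i)
  also have "\<dots> = (LINT x|lborel. c * (v x t * \<eta> x))"
    by (intro Bochner_Integration.integral_cong) (auto simp: algebra_simps)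
  also have "\<dots> = c * h \<eta> t" by (simp add: h_def)
  finally show ?case .
qed

lemma test_slice_Cc:
  assumes "test_fun T \<phi>" "0 \<le> t" "ereal t < T"
  shows "Cc (\<lambda>x. \<phi> x t)"
proof -
  have "continuous_on UNIV (\<lambda>x. (x, t))" by (intro continuous_intros)
  then have "continuous_on UNIV (\<lambda>x. (\<lambda>(x, t). \<phi> x t) (x, t))"
    by (rule continuous_on_compose2[OF test_continuous(1)[OF assms(1)]]) (use assms in \<open>auto simp: strip_iff\<close>)
  moreover obtain R T1 where "vanishes R T1 T \<phi>" by (rule test_fun_vanishes[OF assms(1) T])
  ultimately show ?thesis using assms by (auto simp: Cc_iff vanishes_def strip_iff)
qed

end

text \<open>The assumption \<open>conv\<close> is all that the trace and the mass estimate take from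
  equation (E).\<close>

locale weak_limit = weak_rep +
  assumes conv: "test_fun T \<phi> \<Longrightarrow> (g \<phi> \<longlongrightarrow> W \<phi> 0) ess_right_0"
begin

lemma h_C2_convergent:
  assumes "C2 \<psi>" "Cc \<psi>"
  shows "\<exists>l. (h \<psi> \<longlongrightarrow> l) ess_right_0"
proof -
  obtain T1 where T1: "0 < T1" "ereal T1 < T" by (rule horizon[OF T])
  let ?\<phi> = "\<lambda>x t. \<psi> x * time_cut T1 t"
  have "(g ?\<phi> \<longlongrightarrow> W ?\<phi> 0) ess_right_0" by (intro conv test_fun_product assms T1)
  moreover have z: "(time_cut T1 \<longlongrightarrow> 1) ess_right_0" by (rule tendsto_mono[OF ess_right_0_le tendsto_time_cut[OF T1(1)]])
  ultimately have lim: "((\<lambda>t. g ?\<phi> t / time_cut T1 t) \<longlongrightarrow> W ?\<phi> 0 / 1) ess_right_0"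
    by (intro tendsto_divide) auto
  have "\<forall>\<^sub>F t in ess_right_0. time_cut T1 t > 0" using order_tendstoD(1)[OF z, of 0] by simp
  then have "\<forall>\<^sub>F t in ess_right_0. g ?\<phi> t / time_cut T1 t = h \<psi> t"
    by eventually_elim (simp add: g_product)
  from Lim_transform_eventually[OF lim this] show ?thesis by (rule exI)
qed

text \<open>\<open>h \<eta>\<close> converges by the C^2 case and is thus bounded near 0. It
  controls the distance from \<open>h \<psi>\<close> to the pairings with C^2 approximants, so the
  limits of the latter form a Cauchy sequence, and its limit is attained by
  \<open>h \<psi>\<close>.\<close>

lemma h_convergent:
  assumes \<psi>: "Cc \<psi>"
  shows "\<exists>l. (h \<psi> \<longlongrightarrow> l) ess_right_0"
proof -
  obtain \<eta> :: "'a \<Rightarrow> real" where \<eta>: "C2 \<eta>" "Cc \<eta>" "\<And>x. 0 \<le> \<eta> x"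
    and ap: "\<And>e. 0 < e \<Longrightarrow> \<exists>g. C2 g \<and> Cc g \<and> (\<forall>x. \<bar>\<psi> x - g x\<bar> \<le> e * \<eta> x)"
    by (rule Cc_C2_approx[OF \<psi>]) (erule that, assumption, blast, blast)
  obtain a where a: "(h \<eta> \<longlongrightarrow> a) ess_right_0" using h_C2_convergent[OF \<eta>(1,2)] by (elim exE)
  define e where "e n = 1 / real (Suc n)" for n
  have e: "0 < e n" for n by (simp add: e_def)
  have e0: "e \<longlonglongrightarrow> 0" unfolding e_def by (rule LIMSEQ_Suc[OF lim_const_over_n])
  have "\<forall>n. \<exists>g. C2 g \<and> Cc g \<and> (\<forall>x. \<bar>\<psi> x - g x\<bar> \<le> e n * \<eta> x)" using ap[OF e] by (rule allI)
  then obtain k where "\<forall>n. C2 (k n) \<and> Cc (k n) \<and> (\<forall>x. \<bar>\<psi> x - k n x\<bar> \<le> e n * \<eta> x)"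
    by (rule choice[THEN exE])
  then have k: "\<And>n. C2 (k n)" "\<And>n. Cc (k n)" "\<And>n x. \<bar>\<psi> x - k n x\<bar> \<le> e n * \<eta> x" by auto
  have "\<forall>n. \<exists>l. (h (k n) \<longlongrightarrow> l) ess_right_0" using h_C2_convergent[OF k(1,2)] by (rule allI)
  then obtain l where "\<forall>n. (h (k n) \<longlongrightarrow> l n) ess_right_0" by (rule choice[THEN exE])
  then have l: "\<And>n. (h (k n) \<longlongrightarrow> l n) ess_right_0" by (rule spec)
  have dl: "\<bar>l i - l j\<bar> \<le> (e i + e j) * a" for i j
  proof (rule tendsto_le[OF ess_right_0_neq_bot])
    show "((\<lambda>t. \<bar>h (k i) t - h (k j) t\<bar>) \<longlongrightarrow> \<bar>l i - l j\<bar>) ess_right_0" by (intro tendsto_intros l)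
    show "((\<lambda>t. (e i + e j) * h \<eta> t) \<longlongrightarrow> (e i + e j) * a) ess_right_0" by (intro tendsto_intros a)
    have "\<bar>k i x - k j x\<bar> \<le> (e i + e j) * \<eta> x" for x
      using k(3)[of x i] k(3)[of x j] by (simp add: algebra_simps abs_le_iff)
    then show "\<forall>\<^sub>F t in ess_right_0. \<bar>h (k i) t - h (k j) t\<bar> \<le> (e i + e j) * h \<eta> t"
      by (intro eventually_h_bound k(2) \<eta>(2))
  qed
  have "Cauchy l"
  proof (rule metric_CauchyI)
    fix \<epsilon> :: real assume \<epsilon>: "0 < \<epsilon>"
    have "(\<lambda>n. e n * a) \<longlonglongrightarrow> 0 * a" by (intro tendsto_intros e0)
    then have "\<forall>\<^sub>F n in sequentially. e n * a < \<epsilon> / 2" using \<epsilon> by (intro order_tendstoD(2)) auto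
    then obtain M where M: "\<And>n. n \<ge> M \<Longrightarrow> e n * a < \<epsilon> / 2" by (auto simp: eventually_sequentially)
    show "\<exists>M. \<forall>i\<ge>M. \<forall>j\<ge>M. dist (l i) (l j) < \<epsilon>"
    proof (intro exI allI impI)
      fix i j assume "i \<ge> M" "j \<ge> M"
      then show "dist (l i) (l j) < \<epsilon>"
        using dl[of i j] M[of i] M[of j] by (simp add: dist_real_def algebra_simps)
    qed
  qed
  then have "convergent l" by (rule Cauchy_convergent)
  then obtain L where L: "l \<longlonglongrightarrow> L" unfolding convergent_def by (elim exE)
  have lL: "\<bar>l i - L\<bar> \<le> e i * a" for i
  proof (rule tendsto_le[OF sequentially_bot])
    show "(\<lambda>j. \<bar>l i - l j\<bar>) \<longlonglongrightarrow> \<bar>l i - L\<bar>" by (intro tendsto_intros L)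
    have "(\<lambda>j. (e i + e j) * a) \<longlonglongrightarrow> (e i + 0) * a" by (intro tendsto_intros e0)
    then show "(\<lambda>j. (e i + e j) * a) \<longlonglongrightarrow> e i * a" by simp
  qed (use dl in auto)
  have "(h \<psi> \<longlongrightarrow> L) ess_right_0"
  proof (rule tendstoI)
    fix \<epsilon> :: real assume \<epsilon>: "0 < \<epsilon>"
    have "(\<lambda>n. e n * (a + 1)) \<longlonglongrightarrow> 0 * (a + 1)" by (intro tendsto_intros e0)
    then have "\<forall>\<^sub>F n in sequentially. e n * (a + 1) < \<epsilon> / 3" using \<epsilon> by (intro order_tendstoD(2)) auto
    then obtain n where n: "e n * (a + 1) < \<epsilon> / 3" by (auto simp: eventually_sequentially)
    \<comment> \<open>A local mass bound near t = 0, obtained from the convergence of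
      \<open>h \<eta>\<close>.\<close>
    have 1: "\<forall>\<^sub>F t in ess_right_0. h \<eta> t < a + 1" by (rule order_tendstoD(2)[OF a]) simp
    have 2: "\<forall>\<^sub>F t in ess_right_0. dist (h (k n) t) (l n) < \<epsilon> / 3" by (rule tendstoD[OF l]) (use \<epsilon> in simp)
    have 3: "\<forall>\<^sub>F t in ess_right_0. \<bar>h \<psi> t - h (k n) t\<bar> \<le> e n * h \<eta> t"
      by (rule eventually_h_bound[OF \<psi> k(2) \<eta>(2) k(3)])
    show "\<forall>\<^sub>F t in ess_right_0. dist (h \<psi> t) L < \<epsilon>"
      using 1 2 3
    proof eventually_elim
      case (elim t)
      have "e n * h \<eta> t \<le> e n * (a + 1)" using elim(1) e[of n] by (intro mult_left_mono) auto
      moreover have "e n * a \<le> e n * (a + 1)" using e[of n] by simp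
      ultimately show ?case using elim lL[of n] n unfolding dist_real_def by linarith
    qed
  qed
  then show ?thesis by (rule exI)
qed

definition \<Lambda> :: "('a \<Rightarrow> real) \<Rightarrow> real"
  where "\<Lambda> \<psi> = Lim ess_right_0 (h \<psi>)"

lemma tendsto_\<Lambda>: "Cc \<psi> \<Longrightarrow> (h \<psi> \<longlongrightarrow> \<Lambda> \<psi>) ess_right_0"
  using h_convergent[of \<psi>] tendsto_Lim[OF ess_right_0_neq_bot] unfolding \<Lambda>_def by blast

lemma \<Lambda>_eqI: "(h \<psi> \<longlongrightarrow> l) ess_right_0 \<Longrightarrow> \<Lambda> \<psi> = l"
  unfolding \<Lambda>_def by (rule tendsto_Lim[OF ess_right_0_neq_bot])

sublocale positive_functional \<Lambda>
proof
  fix f k :: "'a \<Rightarrow> real" and c :: real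
  assume f: "Cc f"
  show "\<Lambda> (\<lambda>x. c * f x) = c * \<Lambda> f"
  proof (rule \<Lambda>_eqI)
    have "((\<lambda>t. c * h f t) \<longlongrightarrow> c * \<Lambda> f) ess_right_0" by (intro tendsto_intros tendsto_\<Lambda> f)
    moreover have "h (\<lambda>x. c * f x) = (\<lambda>t. c * h f t)"
      unfolding h_def by (simp add: fun_eq_iff mult.left_commute)
    ultimately show "(h (\<lambda>x. c * f x) \<longlongrightarrow> c * \<Lambda> f) ess_right_0" by simp
  qed
  show "\<Lambda> (\<lambda>x. f x + k x) = \<Lambda> f + \<Lambda> k" if k: "Cc k"
  proof (rule \<Lambda>_eqI)
    have lim: "((\<lambda>t. h f t + h k t) \<longlongrightarrow> \<Lambda> f + \<Lambda> k) ess_right_0" by (intro tendsto_intros tendsto_\<Lambda> f k)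
    have "\<forall>\<^sub>F t in ess_right_0. h f t + h k t = h (\<lambda>x. f x + k x) t"
      using eventually_h_integrable
    proof eventually_elim
      case (elim t)
      then have "integrable lborel (\<lambda>x. v x t * f x)" "integrable lborel (\<lambda>x. v x t * k x)" using f k by auto
      then show ?case unfolding h_def by (simp add: distrib_left)
    qed
    from Lim_transform_eventually[OF lim this] show "(h (\<lambda>x. f x + k x) \<longlongrightarrow> \<Lambda> f + \<Lambda> k) ess_right_0" .
  qed
  show "0 \<le> \<Lambda> f" if nn: "\<And>x. 0 \<le> f x"
  proof (rule tendsto_lowerbound[OF tendsto_\<Lambda>[OF f] _ ess_right_0_neq_bot])
    show "\<forall>\<^sub>F t in ess_right_0. 0 \<le> h f t"
      unfolding h_def using nn v_nonneg by (intro always_eventually allI integral_nonneg_AE) auto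
  qed
qed

abbreviation \<nu> :: "'a measure" where "\<nu> \<equiv> riesz_measure"

lemma radon_\<nu>: "radon \<nu>"
  by (rule radonI) (use riesz_measure_compact in auto)

lemma tendsto_\<nu>: "Cc \<psi> \<Longrightarrow> (h \<psi> \<longlongrightarrow> (LINT x|\<nu>. \<psi> x)) ess_right_0"
  using tendsto_\<Lambda> riesz_representation by simp

lemma W_eq_\<nu>:
  assumes \<phi>: "test_fun T \<phi>"
  shows "W \<phi> 0 = (LINT x|\<nu>. \<phi> x 0)"
proof (rule tendsto_unique[OF ess_right_0_neq_bot conv[OF \<phi>]])
  let ?\<psi> = "\<lambda>x. \<phi> x 0"
  have C0: "Cc ?\<psi>" using test_slice_Cc[OF \<phi>, of 0] T by (simp add: zero_ereal_def)
  obtain R T1 where R: "0 < R" "0 < T1" "ereal T1 < T" "vanishes R T1 T \<phi>" by (rule test_fun_vanishes[OF \<phi> T])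
  have inS: "(x, t) \<in> strip T" if "0 \<le> t" "t \<le> T1" for x :: 'a and t
    using that R(3) by (auto simp: strip_iff intro: order_le_less_trans[of "ereal t" "ereal T1"])
  obtain \<eta> where \<eta>: "Cc \<eta>" "\<And>x. 0 \<le> \<eta> x" "\<And>x::'a. norm x \<le> R \<Longrightarrow> \<eta> x = 1"
    using Cc_plateau[of R] by metis
  let ?K = "cball (0::'a) R \<times> {0..T1}"
  have "compact ?K" by (intro compact_Times) auto
  moreover have "continuous_on ?K (\<lambda>(x, t). \<phi> x t)"
    by (rule continuous_on_subset[OF test_continuous(1)[OF \<phi>]]) (use inS in auto)
  ultimately have uc: "uniformly_continuous_on ?K (\<lambda>(x, t). \<phi> x t)"
    by (rule compact_uniformly_continuous[rotated])
  have diff0: "((\<lambda>t. g \<phi> t - h ?\<psi> t) \<longlongrightarrow> 0) ess_right_0"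
  proof (rule tendstoI)
    fix \<epsilon> :: real assume \<epsilon>: "0 < \<epsilon>"
    \<comment> \<open>Positive, and eventually above \<open>h \<eta> t\<close>, so the total error
      is at most \<epsilon> / 2.\<close>
    define a where "a = \<Lambda> \<eta> + 1"
    have a: "0 < a" using nonneg[OF \<eta>(1,2)] by (simp add: a_def)
    obtain d where d: "0 < d" "\<And>z z'. z \<in> ?K \<Longrightarrow> z' \<in> ?K \<Longrightarrow> dist z' z < d \<Longrightarrow>
        dist ((\<lambda>(x, t). \<phi> x t) z') ((\<lambda>(x, t). \<phi> x t) z) < \<epsilon> / (2 * a)"
      using uc[unfolded uniformly_continuous_on_def, rule_format, of "\<epsilon> / (2 * a)"] \<epsilon> a by auto
    have 1: "\<forall>\<^sub>F t in ess_right_0. h \<eta> t < a" 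
      by (rule order_tendstoD(2)[OF tendsto_\<Lambda>[OF \<eta>(1)]]) (simp add: a_def)
    have 2: "\<forall>\<^sub>F t in ess_right_0. 0 < t \<and> t < min d T1" using d R by (intro ess_right_0_less) auto
    show "\<forall>\<^sub>F t in ess_right_0. dist (g \<phi> t - h ?\<psi> t) 0 < \<epsilon>"
      using 1 2 eventually_h_integrable
    proof eventually_elim
      case (elim t)
      have t: "0 < t" "t < d" "t \<le> T1" using elim by auto
      have bd: "\<bar>\<phi> x t - \<phi> x 0\<bar> \<le> \<epsilon> / (2 * a) * \<eta> x" for x
      proof (cases "norm x \<le> R")
        case True
        then have "dist (\<phi> x t) (\<phi> x 0) < \<epsilon> / (2 * a)"
          using d(2)[of "(x, 0)" "(x, t)"] t by (simp add: dist_Pair_Pair dist_real_def)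
        then show ?thesis using \<eta>(3)[OF True] by (simp add: dist_real_def)
      next
        case False
        then have "\<phi> x t = 0" "\<phi> x 0 = 0"
          using R(4) inS[of t x] inS[of 0 x] t R(2) by (auto simp: vanishes_def)
        then show ?thesis using \<eta>(2)[of x] \<epsilon> a by simp
      qed
      have i1: "integrable lborel (\<lambda>x. v x t * \<phi> x t)"
        using elim test_slice_Cc[OF \<phi>, of t] inS[of t] t by (simp add: strip_iff)
      have i2: "integrable lborel (\<lambda>x. v x t * \<phi> x 0)" using elim C0 by simp
      have i3: "integrable lborel (\<lambda>x. v x t * \<eta> x)" using elim \<eta> by simp
      have "\<bar>g \<phi> t - h ?\<psi> t\<bar> = \<bar>LINT x|lborel. v x t * \<phi> x t - v x t * \<phi> x 0\<bar>"
        unfolding g_def h_def by (simp add: Bochner_Integration.integral_diff[OF i1 i2])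
      also have "\<dots> \<le> (LINT x|lborel. \<bar>v x t * \<phi> x t - v x t * \<phi> x 0\<bar>)"
        by (rule integral_abs_bound)
      also have "\<dots> \<le> (LINT x|lborel. \<epsilon> / (2 * a) * (v x t * \<eta> x))"
      proof (rule integral_mono)
        show "integrable lborel (\<lambda>x. \<bar>v x t * \<phi> x t - v x t * \<phi> x 0\<bar>)"
          by (intro integrable_abs Bochner_Integration.integrable_diff i1 i2)
        show "integrable lborel (\<lambda>x. \<epsilon> / (2 * a) * (v x t * \<eta> x))" by (intro integrable_mult_right i3)
        fix x
        have "v x t * \<bar>\<phi> x t - \<phi> x 0\<bar> \<le> v x t * (\<epsilon> / (2 * a) * \<eta> x)"
          using bd v_nonneg by (rule mult_left_mono)
        then show "\<bar>v x t * \<phi> x t - v x t * \<phi> x 0\<bar> \<le> \<epsilon> / (2 * a) * (v x t * \<eta> x)"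
          using v_nonneg[of x t] by (simp add: abs_mult mult.left_commute flip: right_diff_distrib)
      qed
      also have "\<dots> = \<epsilon> / (2 * a) * h \<eta> t" by (simp add: h_def)
      also have "\<dots> \<le> \<epsilon> / (2 * a) * a" using elim(1) \<epsilon> a by (intro mult_left_mono) auto
      also have "\<dots> < \<epsilon>" using \<epsilon> a by simp
      finally show ?case by (simp add: dist_real_def)
    qed
  qed
  from tendsto_add[OF tendsto_\<nu>[OF C0] diff0]
  show "(g \<phi> \<longlongrightarrow> (LINT x|\<nu>. \<phi> x 0)) ess_right_0" by simp
qed

end

context weak_rep
begin

lemma slice_lebesgue_eq:
  assumes "AE x in lborel. u x t = v x t" "f \<in> borel_measurable borel"
  shows "(LINT x|lebesgue. u x t * f x) = (LINT x|lborel. v x t * f x)"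
  by (rule integral_lebesgue_eq_lborel)
    (use assms slice_measurable[OF meas] in \<open>auto elim: eventually_mono\<close>)

lemma initial_trace_iff:
  assumes u: "slice_eq T u v"
  shows "initial_trace u \<mu> \<longleftrightarrow> radon \<mu> \<and> (\<forall>\<psi>. Cc \<psi> \<longrightarrow> (h \<psi> \<longlongrightarrow> (LINT x|\<mu>. \<psi> x)) ess_right_0)"
proof -
  obtain T1 where T1: "0 < T1" "ereal T1 < T" by (rule horizon[OF T])
  have "((\<lambda>t. LINT x|lebesgue. u x t * \<psi> x) \<longlongrightarrow> l) ess_right_0 \<longleftrightarrow> (h \<psi> \<longlongrightarrow> l) ess_right_0" if \<psi>: "Cc \<psi>" for \<psi> l
  proof (rule tendsto_cong)
    have m: "\<psi> \<in> borel_measurable borel" by (rule Cc_measurable[OF \<psi>])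
    show "\<forall>\<^sub>F t in ess_right_0. (LINT x|lebesgue. u x t * \<psi> x) = h \<psi> t"
      using ess_right_0_AE[OF u[unfolded slice_eq_def]] ess_right_0_less[OF T1(1)]
    proof eventually_elim
      case (elim t)
      then have "ereal t < T" using T1(2) by (auto intro: order_less_trans[of "ereal t" "ereal T1"])
      then show ?case unfolding h_def using elim by (intro slice_lebesgue_eq m) auto
    qed
  qed
  then show ?thesis unfolding initial_trace_def ess_lim_0_iff by blast
qed

lemma solution_E_iff:
  assumes u: "slice_eq T u v" "admissible p T u"
  shows "solution_E m p T u \<longleftrightarrow> (\<forall>\<phi>. test_fun T \<phi> \<longrightarrow> (AE \<tau> in lborel. 0 < \<tau> \<and> ereal \<tau> < T \<longrightarrow> W \<phi> \<tau> = g \<phi> \<tau>))"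
proof -
  have eq: "(AE \<tau> in lebesgue. 0 < \<tau> \<and> ereal \<tau> < T \<longrightarrow> weak_integral m p \<tau> T u \<phi> = (LINT x|lebesgue. u x \<tau> * \<phi> x \<tau>))
    \<longleftrightarrow> (AE \<tau> in lborel. 0 < \<tau> \<and> ereal \<tau> < T \<longrightarrow> W \<phi> \<tau> = g \<phi> \<tau>)" if \<phi>: "test_fun T \<phi>" for \<phi>
    unfolding AE_completion_iff
  proof (rule eventually_subst)
    show "AE \<tau> in lborel. (0 < \<tau> \<and> ereal \<tau> < T \<longrightarrow> weak_integral m p \<tau> T u \<phi> = (LINT x|lebesgue. u x \<tau> * \<phi> x \<tau>))
      \<longleftrightarrow> (0 < \<tau> \<and> ereal \<tau> < T \<longrightarrow> W \<phi> \<tau> = g \<phi> \<tau>)"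
      using u(1)[unfolded slice_eq_def]
    proof eventually_elim
      case (elim \<tau>)
      show ?case
      proof (cases "0 < \<tau> \<and> ereal \<tau> < T")
        case True
        then have "Cc (\<lambda>x. \<phi> x \<tau>)" by (intro test_slice_Cc \<phi>) auto
        then have "(\<lambda>x. \<phi> x \<tau>) \<in> borel_measurable borel"
          by (intro borel_measurable_continuous_onI Cc_continuous)
        then have "(LINT x|lebesgue. u x \<tau> * \<phi> x \<tau>) = g \<phi> \<tau>"
          unfolding g_def using elim True by (intro slice_lebesgue_eq) auto
        then show ?thesis using weak_integral_eq[OF u(1) \<phi>, of \<tau>] True by simp
      qed auto
    qed
  qed
  show ?thesis unfolding solution_E_def using u(2) eq by blast
qed

lemma solution_E_conv:
  assumes "slice_eq T u v" "solution_E m p T u" "test_fun T \<phi>"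
  shows "(g \<phi> \<longlongrightarrow> W \<phi> 0) ess_right_0"
proof -
  obtain T1 where T1: "0 < T1" "ereal T1 < T" by (rule horizon[OF T])
  have "admissible p T u" using assms(2) by (simp add: solution_E_def)
  from solution_E_iff[OF assms(1) this] assms(2,3)
  have ae: "AE \<tau> in lborel. 0 < \<tau> \<and> ereal \<tau> < T \<longrightarrow> W \<phi> \<tau> = g \<phi> \<tau>" by simp
  have "\<forall>\<^sub>F t in ess_right_0. W \<phi> t = g \<phi> t"
    using ess_right_0_AE[OF ae] ess_right_0_less[OF T1(1)]
  proof eventually_elim
    case (elim t)
    then have "ereal t < T" using T1(2) by (auto intro: order_less_trans[of "ereal t" "ereal T1"])
    then show ?case using elim by simp
  qed
  from Lim_transform_eventually[OF tendsto_mono[OF ess_right_0_le W_tendsto[OF assms(3)]] this] show ?thesis .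
qed

end

lemma initial_trace_unique:
  assumes "initial_trace u \<mu>" "initial_trace u \<nu>"
  shows "\<mu> = \<nu>"
proof (rule radon_eqI)
  show "radon \<mu>" "radon \<nu>" using assms by (auto simp: initial_trace_def)
  fix f :: "'a \<Rightarrow> real" assume "Cc f"
  then show "(LINT x|\<mu>. f x) = (LINT x|\<nu>. f x)"
    using assms tendsto_unique[OF ess_right_0_neq_bot] unfolding initial_trace_def ess_lim_0_iff by blast
qed


section \<open>From problem (P) to equation (E)\<close>

text \<open>Products with \<open>time_cut\<close> test a measure only against C^2 functions. These
  determine it, because each function of C_c is approximated with an error below e \<eta>, and
  \<eta> is C^2 as well.\<close>

lemma radon_eqI_C2:
  fixes \<mu> \<nu> :: "'a::euclidean_space measure"
  assumes \<mu>: "radon \<mu>" and \<nu>: "radon \<nu>"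
    and eq: "\<And>f. C2 f \<Longrightarrow> Cc f \<Longrightarrow> (LINT x|\<mu>. f x) = (LINT x|\<nu>. f x)"
  shows "\<mu> = \<nu>"
proof (rule radon_eqI[OF \<mu> \<nu>])
  fix f :: "'a \<Rightarrow> real" assume f: "Cc f"
  obtain \<eta> :: "'a \<Rightarrow> real" where \<eta>: "C2 \<eta>" "Cc \<eta>" "\<And>x. 0 \<le> \<eta> x"
    and ap: "\<And>e. 0 < e \<Longrightarrow> \<exists>g. C2 g \<and> Cc g \<and> (\<forall>x. \<bar>f x - g x\<bar> \<le> e * \<eta> x)"
    by (rule Cc_C2_approx[OF f]) (erule that, assumption, blast, blast)
  let ?a = "LINT x|\<mu>. \<eta> x"
  have main: "\<bar>(LINT x|\<mu>. f x) - (LINT x|\<nu>. f x)\<bar> \<le> 2 * e * ?a" if e: "0 < e" for e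
  proof -
    obtain k where "C2 k \<and> Cc k \<and> (\<forall>x. \<bar>f x - k x\<bar> \<le> e * \<eta> x)" using ap[OF e] by (rule exE)
    then have k: "C2 k" "Cc k" "\<And>x. \<bar>f x - k x\<bar> \<le> e * \<eta> x" by auto
    have near: "\<bar>(LINT x|M. f x) - (LINT x|M. k x)\<bar> \<le> e * (LINT x|M. \<eta> x)" if M: "radon M" for M
    proof -
      note i = radon_integrable[OF M f] radon_integrable[OF M k(2)] radon_integrable[OF M \<eta>(2)]
      have "\<bar>(LINT x|M. f x) - (LINT x|M. k x)\<bar> = \<bar>LINT x|M. f x - k x\<bar>"
        by (simp add: Bochner_Integration.integral_diff[OF i(1,2)])
      also have "\<dots> \<le> (LINT x|M. \<bar>f x - k x\<bar>)" by (rule integral_abs_bound)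
      also have "\<dots> \<le> (LINT x|M. e * \<eta> x)"
        by (rule integral_mono) (use i k(3) in \<open>auto intro!: integrable_abs Bochner_Integration.integrable_diff integrable_mult_right\<close>)
      finally show ?thesis by simp
    qed
    \<comment> \<open>Since \<eta> is C^2, its integrals against both measures agree, and one
      constant bounds both errors.\<close>
    have "\<bar>(LINT x|\<nu>. f x) - (LINT x|\<nu>. k x)\<bar> \<le> e * ?a" using near[OF \<nu>] eq[OF \<eta>(1,2)] by simp
    moreover have "2 * e * ?a = e * ?a + e * ?a" by simp
    ultimately show ?thesis using near[OF \<mu>] eq[OF k(1,2)] by linarith
  qed
  have "0 \<le> ?a" using \<eta>(3) by (intro integral_nonneg_AE) auto
  have "\<bar>(LINT x|\<mu>. f x) - (LINT x|\<nu>. f x)\<bar> \<le> 0"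
  proof (rule field_le_epsilon)
    fix e :: real assume e: "0 < e"
    have "2 * (e / (2 * (?a + 1))) * ?a \<le> e" using e \<open>0 \<le> ?a\<close> by (simp add: field_simps)
    then show "\<bar>(LINT x|\<mu>. f x) - (LINT x|\<nu>. f x)\<bar> \<le> 0 + e"
      using main[of "e / (2 * (?a + 1))"] e \<open>0 \<le> ?a\<close> by simp
  qed
  then show "(LINT x|\<mu>. f x) = (LINT x|\<nu>. f x)" by simp
qed

text \<open>The positive and negative parts of k are densities of two Radon measures with equal
  integrals over C_c. Equal measures have densities equal almost everywhere, and the two parts are
  never both nonzero at a point.\<close>

lemma AE_zero_if_Cc_integral_zero:
  fixes k :: "real \<Rightarrow> real"
  assumes k: "k \<in> borel_measurable borel"
    and loc: "\<And>K. compact K \<Longrightarrow> integrable lborel (\<lambda>s. indicator K s * k s)"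
    and zero: "\<And>\<eta>. Cc \<eta> \<Longrightarrow> (LINT s|lborel. \<eta> s * k s) = 0"
  shows "AE s in lborel. k s = 0"
proof -
  define kp where "kp s = max 0 (k s)" for s
  define km where "km s = max 0 (- k s)" for s
  have m: "kp \<in> borel_measurable borel" "km \<in> borel_measurable borel"
    unfolding kp_def km_def using k by simp_all
  have nn: "0 \<le> kp s" "0 \<le> km s" for s by (auto simp: kp_def km_def)
  have ip: "integrable lborel (\<lambda>s. indicator K s * kp s)" "integrable lborel (\<lambda>s. indicator K s * km s)" if K: "compact K" for K
  proof -
    have Kb: "K \<in> sets borel" using K by (rule borel_compact)
    have mm: "(\<lambda>s. indicator K s * kp s) \<in> borel_measurable lborel" "(\<lambda>s. indicator K s * km s) \<in> borel_measurable lborel"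
      using Kb m by simp_all
    show "integrable lborel (\<lambda>s. indicator K s * kp s)"
      by (rule Bochner_Integration.integrable_bound[OF loc[OF K] mm(1)]) (auto simp: kp_def indicator_def)
    show "integrable lborel (\<lambda>s. indicator K s * km s)"
      by (rule Bochner_Integration.integrable_bound[OF loc[OF K] mm(2)]) (auto simp: km_def indicator_def)
  qed
  have radon_density: "radon (density lborel (\<lambda>s. ennreal (f s)))"
    if f: "f \<in> borel_measurable borel" "\<And>s. 0 \<le> f s" "\<And>K. compact K \<Longrightarrow> integrable lborel (\<lambda>s. indicator K s * f s)" for f :: "real \<Rightarrow> real"
  proof (rule radonI)
    fix K :: "real set" assume K: "compact K"
    then have Kb: "K \<in> sets borel" by (rule borel_compact)
    have "emeasure (density lborel (\<lambda>s. ennreal (f s))) K = (\<integral>\<^sup>+ s. ennreal (f s) * indicator K s \<partial>lborel)"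
      using f Kb by (intro emeasure_density) auto
    also have "\<dots> = (\<integral>\<^sup>+ s. ennreal (indicator K s * f s) \<partial>lborel)"
      by (intro nn_integral_cong) (auto simp: indicator_def)
    also have "\<dots> = ennreal (LINT s|lborel. indicator K s * f s)"
      by (intro nn_integral_eq_integral f(3) K) (use f(2) in auto)
    finally show "emeasure (density lborel (\<lambda>s. ennreal (f s))) K < \<infinity>" by simp
  qed simp
  have int_Cc: "integrable lborel (\<lambda>s. \<eta> s * f s)"
    if f: "f \<in> borel_measurable borel" "\<And>K. compact K \<Longrightarrow> integrable lborel (\<lambda>s. indicator K s * f s)" and \<eta>: "Cc \<eta>" for f \<eta> :: "real \<Rightarrow> real"
  proof -
    obtain R where R: "\<And>x. R < norm x \<Longrightarrow> \<eta> x = 0" using \<eta> by (auto simp: Cc_iff)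
    obtain B where B: "B > 0" "\<And>x. \<bar>\<eta> x\<bar> \<le> B" by (rule Cc_bounded[OF \<eta>]) (erule that, blast)
    have m: "\<eta> \<in> borel_measurable borel" by (rule Cc_measurable[OF \<eta>])
    show ?thesis
    proof (rule Bochner_Integration.integrable_bound)
      show "integrable lborel (\<lambda>s. B * (indicator (cball 0 R) s * f s))"
        by (intro integrable_mult_right f(2)) simp
      show "AE s in lborel. norm (\<eta> s * f s) \<le> norm (B * (indicator (cball 0 R) s * f s))"
      proof (intro always_eventually allI)
        fix s
        show "norm (\<eta> s * f s) \<le> norm (B * (indicator (cball 0 R) s * f s))"
        proof (cases "norm s \<le> R")
          case True
          have "\<bar>\<eta> s\<bar> * \<bar>f s\<bar> \<le> B * \<bar>f s\<bar>" using B by (intro mult_right_mono) auto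
          then show ?thesis using True B by (simp add: abs_mult)
        qed (use R in simp)
      qed
    qed (use m f in simp)
  qed
  let ?P = "density lborel (\<lambda>s. ennreal (kp s))" and ?M = "density lborel (\<lambda>s. ennreal (km s))"
  have "?P = ?M"
  proof (rule radon_eqI)
    show "radon ?P" by (rule radon_density[OF m(1) nn(1) ip(1)])
    show "radon ?M" by (rule radon_density[OF m(2) nn(2) ip(2)])
    fix \<eta> :: "real \<Rightarrow> real" assume \<eta>: "Cc \<eta>"
    have me: "\<eta> \<in> borel_measurable borel" by (rule Cc_measurable[OF \<eta>])
    have "(LINT s|lborel. \<eta> s * k s) = (LINT s|lborel. \<eta> s * kp s - \<eta> s * km s)"
    proof (intro Bochner_Integration.integral_cong refl)
      fix s
      have "k s = kp s - km s" by (simp add: kp_def km_def)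
      then show "\<eta> s * k s = \<eta> s * kp s - \<eta> s * km s" by (simp only: right_diff_distrib)
    qed
    also have "\<dots> = (LINT s|lborel. \<eta> s * kp s) - (LINT s|lborel. \<eta> s * km s)"
      by (rule Bochner_Integration.integral_diff[OF int_Cc[OF m(1) ip(1) \<eta>] int_Cc[OF m(2) ip(2) \<eta>]])
    finally have "(LINT s|lborel. \<eta> s * kp s) = (LINT s|lborel. \<eta> s * km s)" using zero[OF \<eta>] by simp
    moreover have "(LINT s|density lborel (\<lambda>s. ennreal (f s)). \<eta> s) = (LINT s|lborel. \<eta> s * f s)"
      if "f \<in> borel_measurable borel" "\<And>s. 0 \<le> f s" for f
      using that me by (subst integral_density) (auto simp: mult.commute)
    ultimately show "(LINT s|?P. \<eta> s) = (LINT s|?M. \<eta> s)" using m nn by simp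
  qed
  then have "AE s in lborel. ennreal (kp s) = ennreal (km s)"
    by (intro sigma_finite_measure.density_unique[OF sigma_finite_lborel]) (use m in auto)
  then show ?thesis
  proof eventually_elim
    case (elim s)
    then have "kp s = km s" using nn by simp
    then show ?case by (auto simp: kp_def km_def max_def split: if_splits)
  qed
qed

section \<open>Recovery of the identity of (E) by multipliers in time\<close>

context weak_rep
begin

lemma W_measurable: assumes "test_fun T \<phi>" shows "W \<phi> \<in> borel_measurable borel"
proof -
  note F_measurable[OF assms, measurable]
  have "W \<phi> = (\<lambda>\<tau>. LINT t|lborel. (if \<tau> < t then F \<phi> t else 0))"
    unfolding W_def by (intro ext Bochner_Integration.integral_cong) (auto simp: indicator_def)
  also have "\<dots> \<in> borel_measurable borel" by measurable
  finally show ?thesis .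
qed

lemma W_bounded: assumes "test_fun T \<phi>" shows "\<bar>W \<phi> \<tau>\<bar> \<le> (LINT t|lborel. \<bar>F \<phi> t\<bar>)"
proof -
  have i: "integrable lborel (\<lambda>t. \<bar>F \<phi> t\<bar>)" using F_integrable[OF assms] by simp
  have "\<bar>W \<phi> \<tau>\<bar> \<le> (LINT t|lborel. \<bar>indicator {\<tau><..} t * F \<phi> t\<bar>)"
    unfolding W_def by (rule integral_abs_bound)
  also have "\<dots> \<le> (LINT t|lborel. \<bar>F \<phi> t\<bar>)"
    by (rule integral_mono_AE'[OF i]) (auto simp: indicator_def)
  finally show ?thesis .
qed

lemma v_past: "t \<le> 0 \<Longrightarrow> v x t = 0"
  by (rule v_outside) auto

text \<open>A factor depending on time alone passes through the Laplacian, so only the product rule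
  in time adds a term, and that term is the pairing \<open>g\<close>. The identity is restricted to
  almost every t because splitting the integral requires integrable slices.\<close>

lemma time_multiplier:
  fixes \<zeta> \<eta> :: "real \<Rightarrow> real"
  assumes \<phi>: "test_fun T \<phi>" and \<zeta>: "\<And>t. 0 \<le> t \<Longrightarrow> (\<zeta> has_real_derivative \<eta> t) (at t within {0..})"
    and \<eta>: "continuous_on {0..} \<eta>"
  shows "test_fun T (\<lambda>x t. \<phi> x t * \<zeta> t)"
    "AE t in lborel. F (\<lambda>x t. \<phi> x t * \<zeta> t) t = \<zeta> t * F \<phi> t - \<eta> t * g \<phi> t"
proof -
  obtain R T1 where R: "0 < R" "0 < T1" "ereal T1 < T" "vanishes R T1 T \<phi>" by (rule test_fun_vanishes[OF \<phi> T])
  let ?\<psi> = "\<lambda>x t. \<phi> x t * \<zeta> t"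
  note p0 = test_fun_par[OF \<phi>]
  note p1 = par_mult[OF p0 par_time[OF \<zeta> \<eta>]]
  have van: "vanishes R T1 T ?\<psi>" using R(4) by (auto simp: vanishes_def)
  show "test_fun T ?\<psi>" by (rule test_funI[OF p1 van R(3)])
  show "AE t in lborel. F ?\<psi> t = \<zeta> t * F \<phi> t - \<eta> t * g \<phi> t"
    using integrable_slice(1)[OF test_integrable(1)[OF \<phi>]] integrable_slice(1)[OF test_integrable(5)[OF \<phi>]]
  proof eventually_elim
    case (elim t)
    have "\<Phi> ?\<psi> x t = \<zeta> t * \<Phi> \<phi> x t - \<eta> t * (v x t * \<phi> x t)" for x
    proof (cases "0 < t \<and> ereal t < T")
      case True
      then have S: "(x, t) \<in> strip T" by (simp add: strip_iff)
      have 1: "time_deriv ?\<psi> x t = time_deriv \<phi> x t * \<zeta> t + \<phi> x t * \<eta> t"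
        by (rule par_derivs(1)[OF p1 S])
      have 2: "laplacian (\<lambda>y. ?\<psi> y t) x = laplacian (\<lambda>y. \<phi> y t) x * \<zeta> t"
        using par_derivs(4)[OF p1 S] par_derivs(4)[OF p0 S] by (simp add: sum_distrib_right)
      show ?thesis unfolding \<Phi>_def 1 2 by (simp add: algebra_simps)
    qed (simp add: \<Phi>_def v_outside)
    then have "F ?\<psi> t = (LINT x|lborel. \<zeta> t * \<Phi> \<phi> x t - \<eta> t * (v x t * \<phi> x t))"
      unfolding F_def by (intro Bochner_Integration.integral_cong) auto
    also have "\<dots> = (LINT x|lborel. \<zeta> t * \<Phi> \<phi> x t) - (LINT x|lborel. \<eta> t * (v x t * \<phi> x t))"
      by (intro Bochner_Integration.integral_diff integrable_mult_right elim)
    also have "\<dots> = \<zeta> t * F \<phi> t - \<eta> t * g \<phi> t" by (simp add: F_def g_def)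
    finally show ?case .
  qed
qed

text \<open>Integration by parts that never differentiates \<open>W\<close>: the primitive is
  written as an integral of \<eta> over 0 < s < t, and exchanging the order leaves the tail integral
  of \<open>F\<close> beyond s, which is \<open>W\<close>.\<close>

lemma integral_primitive_F:
  fixes \<eta> :: "real \<Rightarrow> real"
  assumes \<phi>: "test_fun T \<phi>" and \<eta>: "Cc \<eta>"
  shows "integrable lborel (\<lambda>t. indicator {0<..} t * (integral {0..t} \<eta> * F \<phi> t))"
    "(LINT t|lborel. indicator {0<..} t * (integral {0..t} \<eta> * F \<phi> t)) =
      (LINT s|lborel. indicator {0<..} s * \<eta> s * W \<phi> s)"
proof -
  note F_measurable[OF \<phi>, measurable]
  have [measurable]: "\<eta> \<in> borel_measurable borel" by (rule Cc_measurable[OF \<eta>])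
  have i\<eta>: "integrable lborel \<eta>" by (rule Cc_integrable[OF \<eta> sets_lborel emeasure_compact_finite])
  define K where "K s t = indicator {0<..} s * \<eta> s * ((if s < t then 1 else 0) * F \<phi> t)" for s t
  have Km: "case_prod K \<in> borel_measurable (lborel \<Otimes>\<^sub>M lborel)"
    unfolding K_def by measurable
  have iF: "integrable lborel (\<lambda>t. \<bar>F \<phi> t\<bar>)" using F_integrable[OF \<phi>] by simp
  have iK1: "integrable lborel (\<lambda>t. K s t)" for s
    by (rule Bochner_Integration.integrable_bound[OF integrable_mult_right[OF iF, of "\<eta> s"]])
      (auto simp: K_def indicator_def)
  have int_t: "(LINT t|lborel. K s t) = indicator {0<..} s * \<eta> s * W \<phi> s" for s
  proof -
    have "W \<phi> s = (LINT t|lborel. (if s < t then 1 else 0) * F \<phi> t)"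
      unfolding W_def by (intro Bochner_Integration.integral_cong) (auto simp: indicator_def)
    then show ?thesis by (simp add: K_def)
  qed
  have iK: "integrable (lborel \<Otimes>\<^sub>M lborel) (case_prod K)"
  proof (rule lborel_pair.Fubini_integrable[OF Km])
    show "AE s in lborel. integrable lborel (\<lambda>t. case_prod K (s, t))" using iK1 by simp
    have "(\<lambda>s. LINT t|lborel. norm (case_prod K (s, t))) \<in> borel_measurable lborel"
      using Km by measurable
    moreover have "norm (LINT t|lborel. norm (case_prod K (s, t))) \<le> norm ((LINT t|lborel. \<bar>F \<phi> t\<bar>) * \<eta> s)" for s
    proof -
      have "(LINT t|lborel. \<bar>K s t\<bar>) \<le> (LINT t|lborel. \<bar>\<eta> s\<bar> * \<bar>F \<phi> t\<bar>)"
        by (rule integral_mono_AE'[OF integrable_mult_right[OF iF]])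
          (auto simp: K_def indicator_def abs_mult)
      then show ?thesis by (simp add: abs_mult mult.commute)
    qed
    ultimately show "integrable lborel (\<lambda>s. LINT t|lborel. norm (case_prod K (s, t)))"
      by (intro Bochner_Integration.integrable_bound[OF integrable_mult_right[OF i\<eta>, of "LINT t|lborel. \<bar>F \<phi> t\<bar>"]]) auto
  qed
  have int_s: "(LINT s|lborel. K s t) = indicator {0<..} t * (integral {0..t} \<eta> * F \<phi> t)" for t
  proof (cases "0 < t")
    case False
    then have "K s t = 0" for s by (simp add: K_def indicator_def)
    then show ?thesis using False by simp
  next
    case True
    have "(LINT s|lborel. K s t) = (LINT s|lborel. indicator {0<..<t} s * \<eta> s * F \<phi> t)"
      unfolding K_def by (intro Bochner_Integration.integral_cong) (auto simp: indicator_def)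
    also have "\<dots> = (LINT s|lborel. indicator {0<..<t} s * \<eta> s) * F \<phi> t" by simp
    also have "(LINT s|lborel. indicator {0<..<t} s * \<eta> s) = integral {0<..<t} \<eta>"
    proof -
      have "set_integrable lborel {0<..<t} \<eta>"
        using i\<eta> unfolding set_integrable_def by (intro integrable_mult_indicator) auto
      from set_borel_integral_eq_integral(2)[OF this] show ?thesis by (simp add: set_lebesgue_integral_def)
    qed
    also have "integral {0<..<t} \<eta> = integral {0..t} \<eta>" using integral_open_interval_real[of 0 t \<eta>] by simp
    finally show ?thesis using True by simp
  qed
  show "integrable lborel (\<lambda>t. indicator {0<..} t * (integral {0..t} \<eta> * F \<phi> t))"
    using lborel_pair.integrable_snd[OF iK] unfolding int_s .
  show "(LINT t|lborel. indicator {0<..} t * (integral {0..t} \<eta> * F \<phi> t)) =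
      (LINT s|lborel. indicator {0<..} s * \<eta> s * W \<phi> s)"
    using lborel_pair.Fubini_integral[OF iK] unfolding int_s int_t .
qed

text \<open>Testing with \<open>\<phi> x t * \<zeta> t\<close>, where \<open>\<zeta>\<close> is the primitive of \<open>\<eta>\<close> vanishing at \<open>0\<close>, gives
  \<open>\<integral> \<eta> (W \<phi> - g \<phi>) = 0\<close> over \<open>t > 0\<close>.\<close>

lemma solution_P_imp_W_eq_g:
  assumes u: "slice_eq T u v" and sol: "solution_P m p T \<mu> u" and \<phi>: "test_fun T \<phi>"
  shows "AE \<tau> in lborel. 0 < \<tau> \<and> ereal \<tau> < T \<longrightarrow> W \<phi> \<tau> = g \<phi> \<tau>"
proof -
  have P: "W \<psi> 0 = (LINT x|\<mu>. \<psi> x 0)" if "test_fun T \<psi>" for \<psi>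
    using sol weak_integral_eq[OF u that, of 0] that by (simp add: solution_P_def)
  define k where "k s = indicator {0<..} s * (W \<phi> s - g \<phi> s)" for s
  have gm [measurable]: "g \<phi> \<in> borel_measurable borel"
    using borel_measurable_integrable[OF g_integrable[OF \<phi>]] by simp
  note Wm [measurable] = W_measurable[OF \<phi>]
  have "AE s in lborel. k s = 0"
  proof (rule AE_zero_if_Cc_integral_zero)
    show "k \<in> borel_measurable borel" unfolding k_def by measurable
    fix K :: "real set" assume K: "compact K"
    then have Kb [measurable]: "K \<in> sets borel" by (rule borel_compact)
    have "integrable lborel (indicator K :: real \<Rightarrow> real)"
      using emeasure_compact_finite[OF K] Kb by (intro integrable_real_indicator) simp_all
    then have b: "integrable lborel (\<lambda>s. (LINT t|lborel. \<bar>F \<phi> t\<bar>) * indicator K s + \<bar>g \<phi> s\<bar>)"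
      using g_integrable[OF \<phi>] by (intro Bochner_Integration.integrable_add integrable_mult_right integrable_abs)
    show "integrable lborel (\<lambda>s. indicator K s * k s)"
    proof (rule Bochner_Integration.integrable_bound[OF b])
      show "(\<lambda>s. indicator K s * k s) \<in> borel_measurable lborel" unfolding k_def by measurable
      show "AE s in lborel. norm (indicator K s * k s) \<le> norm ((LINT t|lborel. \<bar>F \<phi> t\<bar>) * indicator K s + \<bar>g \<phi> s\<bar>)"
      proof (intro always_eventually allI)
        fix s
        show "norm (indicator K s * k s) \<le> norm ((LINT t|lborel. \<bar>F \<phi> t\<bar>) * indicator K s + \<bar>g \<phi> s\<bar>)"
          using W_bounded[OF \<phi>, of s] by (auto simp: k_def indicator_def)
      qed
    qed
  next
    fix \<eta> :: "real \<Rightarrow> real" assume \<eta>: "Cc \<eta>"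
    define \<zeta> where "\<zeta> t = integral {0..t} \<eta>" for t
    have d: "(\<zeta> has_real_derivative \<eta> t) (at t within {0..})" if t: "0 \<le> t" for t
    proof -
      \<comment> \<open>The compact interval ends beyond t, so near t it looks like
        \<open>{0..}\<close>.\<close>
      have "(\<zeta> has_real_derivative \<eta> t) (at t within {0..t+1})"
        unfolding \<zeta>_def by (rule integral_has_real_derivative) (use t Cc_continuous[OF \<eta>] in auto)
      moreover have "at t within {0..t+1} = at t within {0..}"
        by (rule at_within_nhd[of _ "{..<t+1}"]) auto
      ultimately show ?thesis by simp
    qed
    obtain B where B: "B > 0" "\<And>x. \<bar>\<eta> x\<bar> \<le> B" by (rule Cc_bounded[OF \<eta>]) (erule that, blast)
    have \<eta>m: "\<eta> \<in> borel_measurable borel" by (rule Cc_measurable[OF \<eta>])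
    have i\<eta>: "integrable lborel \<eta>" by (rule Cc_integrable[OF \<eta> sets_lborel emeasure_compact_finite])
    have i1: "integrable lborel (\<lambda>t. \<eta> t * (indicator {0<..} t * g \<phi> t))"
    proof (rule Bochner_Integration.integrable_bound[OF integrable_mult_right[OF g_integrable[OF \<phi>], of B]])
      show "(\<lambda>t. \<eta> t * (indicator {0<..} t * g \<phi> t)) \<in> borel_measurable lborel" using \<eta>m gm by simp
      show "AE t in lborel. norm (\<eta> t * (indicator {0<..} t * g \<phi> t)) \<le> norm (B * g \<phi> t)"
        using B by (intro always_eventually allI) (auto simp: indicator_def abs_mult intro!: mult_right_mono)
    qed
    have i2: "integrable lborel (\<lambda>t. \<eta> t * (indicator {0<..} t * W \<phi> t))"
    proof (rule Bochner_Integration.integrable_bound[OF integrable_mult_right[OF i\<eta>, of "LINT t|lborel. \<bar>F \<phi> t\<bar>"]])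
      show "(\<lambda>t. \<eta> t * (indicator {0<..} t * W \<phi> t)) \<in> borel_measurable lborel" using \<eta>m Wm by simp
      show "AE t in lborel. norm (\<eta> t * (indicator {0<..} t * W \<phi> t)) \<le> norm ((LINT t|lborel. \<bar>F \<phi> t\<bar>) * \<eta> t)"
      proof (intro always_eventually allI)
        fix t
        have "\<bar>\<eta> t\<bar> * \<bar>W \<phi> t\<bar> \<le> \<bar>\<eta> t\<bar> * (LINT t|lborel. \<bar>F \<phi> t\<bar>)"
          by (intro mult_left_mono W_bounded[OF \<phi>]) simp
        then show "norm (\<eta> t * (indicator {0<..} t * W \<phi> t)) \<le> norm ((LINT t|lborel. \<bar>F \<phi> t\<bar>) * \<eta> t)"
          by (simp add: indicator_def abs_mult mult.commute)
      qed
    qed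
    have tm: "test_fun T (\<lambda>x t. \<phi> x t * \<zeta> t)"
      "AE t in lborel. F (\<lambda>x t. \<phi> x t * \<zeta> t) t = \<zeta> t * F \<phi> t - \<eta> t * g \<phi> t"
      by (rule time_multiplier[OF \<phi> d Cc_continuous[OF \<eta>]], assumption)+
    \<comment> \<open>The initial datum enters (P) through the slice t = 0 alone, where the
      multiplier vanishes; thus \<mu> drops out.\<close>
    have "\<zeta> 0 = 0" by (simp add: \<zeta>_def)
    then have "W (\<lambda>x t. \<phi> x t * \<zeta> t) 0 = 0" using P[OF tm(1)] by simp
    then have "0 = (LINT t|lborel. indicator {0<..} t * F (\<lambda>x t. \<phi> x t * \<zeta> t) t)" by (simp add: W_def)
    also have "\<dots> = (LINT t|lborel. indicator {0<..} t * (\<zeta> t * F \<phi> t) - \<eta> t * (indicator {0<..} t * g \<phi> t))"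
    proof (rule integral_cong_AE)
      show "(\<lambda>t. indicator {0<..} t * F (\<lambda>x t. \<phi> x t * \<zeta> t) t) \<in> borel_measurable lborel"
        using borel_measurable_integrable[OF F_integrable[OF tm(1)]] by simp
      have "\<eta> \<in> borel_measurable borel" by (rule Cc_measurable[OF \<eta>])
      then show "(\<lambda>t. indicator {0<..} t * (\<zeta> t * F \<phi> t) - \<eta> t * (indicator {0<..} t * g \<phi> t)) \<in> borel_measurable lborel"
        using borel_measurable_integrable[OF integral_primitive_F(1)[OF \<phi> \<eta>]] unfolding \<zeta>_def by simp
      show "AE t in lborel. indicator {0<..} t * F (\<lambda>x t. \<phi> x t * \<zeta> t) t = indicator {0<..} t * (\<zeta> t * F \<phi> t) - \<eta> t * (indicator {0<..} t * g \<phi> t)"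
        using tm(2) by eventually_elim (simp add: indicator_def)
    qed
    also have "\<dots> = (LINT t|lborel. indicator {0<..} t * (\<zeta> t * F \<phi> t)) - (LINT t|lborel. \<eta> t * (indicator {0<..} t * g \<phi> t))"
      using integral_primitive_F(1)[OF \<phi> \<eta>] unfolding \<zeta>_def[symmetric]
      by (rule Bochner_Integration.integral_diff[OF _ i1])
    also have "(LINT t|lborel. indicator {0<..} t * (\<zeta> t * F \<phi> t)) = (LINT s|lborel. \<eta> s * (indicator {0<..} s * W \<phi> s))"
      unfolding \<zeta>_def integral_primitive_F(2)[OF \<phi> \<eta>] by (simp add: ac_simps)
    finally have e: "0 = (LINT s|lborel. \<eta> s * (indicator {0<..} s * W \<phi> s)) - (LINT t|lborel. \<eta> t * (indicator {0<..} t * g \<phi> t))" .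
    have "(LINT s|lborel. \<eta> s * k s) = (LINT s|lborel. \<eta> s * (indicator {0<..} s * W \<phi> s) - \<eta> s * (indicator {0<..} s * g \<phi> s))"
      unfolding k_def by (intro Bochner_Integration.integral_cong) (auto simp: algebra_simps)
    also have "\<dots> = 0" unfolding Bochner_Integration.integral_diff[OF i2 i1] using e by simp
    finally show "(LINT s|lborel. \<eta> s * k s) = 0" .
  qed
  then show ?thesis by eventually_elim (auto simp: k_def)
qed

lemma solution_P_imp_solution_E:
  assumes "slice_eq T u v" "solution_P m p T \<mu> u"
  shows "solution_E m p T u"
proof -
  have adm: "admissible p T u" using assms(2) by (simp add: solution_P_def)
  show ?thesis unfolding solution_E_iff[OF assms(1) adm]
    by (intro allI impI) (rule solution_P_imp_W_eq_g[OF assms])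
qed

lemma solution_E_weak_limit:
  assumes "slice_eq T u v" "solution_E m p T u"
  shows "weak_limit m p T v"
  by (unfold_locales) (rule solution_E_conv[OF assms])

end

context weak_limit
begin

lemma initial_trace_\<nu>: assumes "slice_eq T u v" shows "initial_trace u \<nu>"
  unfolding initial_trace_iff[OF assms] by (intro conjI allI impI radon_\<nu>) (rule tendsto_\<nu>)

lemma \<nu>_eqI:
  assumes \<mu>: "radon \<mu>" and W: "\<And>\<phi>. test_fun T \<phi> \<Longrightarrow> W \<phi> 0 = (LINT x|\<mu>. \<phi> x 0)"
  shows "\<nu> = \<mu>"
proof (rule radon_eqI_C2[OF radon_\<nu> \<mu>])
  fix f :: "'a \<Rightarrow> real" assume f: "C2 f" "Cc f"
  obtain T1 where T1: "0 < T1" "ereal T1 < T" by (rule horizon[OF T])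
  note t = test_fun_product[OF f T1]
  show "(LINT x|\<nu>. f x) = (LINT x|\<mu>. f x)"
    using W[OF t] W_eq_\<nu>[OF t] by (simp add: time_cut_0)
qed

end

lemma solution_P_initial_trace:
  fixes u :: "'a::euclidean_space \<Rightarrow> real \<Rightarrow> real"
  assumes mp: "0 < m" "m < 1" "1 < p" "0 < T" and \<mu>: "radon \<mu>" and sol: "solution_P m p T \<mu> u"
  shows "solution_E m p T u" "initial_trace u \<nu> \<longleftrightarrow> \<nu> = \<mu>"
proof -
  have adm: "admissible p T u" using sol by (simp add: solution_P_def)
  obtain v where v: "weak_rep m p T v" "slice_eq T u v"
    by (rule admissible_weak_rep[OF mp adm])
  interpret weak_rep m p T v by (rule v(1))
  show E: "solution_E m p T u" by (rule solution_P_imp_solution_E[OF v(2) sol])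
  interpret L: weak_limit m p T v by (rule solution_E_weak_limit[OF v(2) E])
  have "L.\<nu> = \<mu>"
  proof (rule L.\<nu>_eqI[OF \<mu>])
    fix \<phi> :: "'a \<Rightarrow> real \<Rightarrow> real" assume \<phi>: "test_fun T \<phi>"
    then show "W \<phi> 0 = (LINT x|\<mu>. \<phi> x 0)"
      using sol weak_integral_eq[OF v(2) \<phi>, of 0] by (simp add: solution_P_def)
  qed
  then have tr: "initial_trace u \<mu>" using L.initial_trace_\<nu>[OF v(2)] by simp
  show "initial_trace u \<nu> \<longleftrightarrow> \<nu> = \<mu>"
  proof
    assume "initial_trace u \<nu>"
    then show "\<nu> = \<mu>" by (rule initial_trace_unique[OF _ tr])
  qed (simp add: tr)
qed


section \<open>The logarithmic test function\<close>

lemma DERIV_time_power: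
  fixes \<tau> \<beta> :: real
  assumes \<tau>: "0 < \<tau>" and \<beta>: "1 < \<beta>" and t: "0 \<le> t"
  shows "((\<lambda>t. (t / \<tau>) powr \<beta>) has_real_derivative (\<beta> / \<tau>) * (t / \<tau>) powr (\<beta> - 1)) (at t within {0..})"
proof (cases "t = 0")
  case False
  then have "0 < t" using t by simp
  then have "((\<lambda>t. (t / \<tau>) powr \<beta>) has_real_derivative (\<beta> / \<tau>) * (t / \<tau>) powr (\<beta> - 1)) (at t)"
    using \<tau> by (auto intro!: derivative_eq_intros simp: field_simps powr_diff powr_divide)
  then show ?thesis by (rule has_field_derivative_at_within)
next
  case True
  \<comment> \<open>At t = 0 the difference quotient is (y/\<tau>)^(\<beta> - 1) / \<tau>, which
    tends to 0 by \<beta> > 1; the claimed derivative is 0 as well, because \<open>powr\<close> with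
    base 0 gives 0.\<close>
  have "((\<lambda>y. (y / \<tau>) powr (\<beta> - 1)) \<longlongrightarrow> 0) (at 0 within {0..})"
  proof (rule tendsto_zero_powrI[OF _ tendsto_const])
    show "((\<lambda>y. y / \<tau>) \<longlongrightarrow> 0) (at 0 within {0..})"
      using \<tau> by (auto intro!: tendsto_eq_intros)
    show "\<forall>\<^sub>F y in at 0 within {0..}. 0 \<le> y / \<tau>"
      using \<tau> by (auto simp: eventually_at_filter)
  qed (use \<beta> in simp)
  then have "((\<lambda>y. (y / \<tau>) powr (\<beta> - 1) / \<tau>) \<longlongrightarrow> 0 / \<tau>) (at 0 within {0..})"
    using \<tau> by (intro tendsto_divide tendsto_const) simp_all
  moreover have "\<forall>\<^sub>F y in at 0 within {0..}. (y / \<tau>) powr (\<beta> - 1) / \<tau> = ((y / \<tau>) powr \<beta> - (0 / \<tau>) powr \<beta>) / (y - 0)"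
    unfolding eventually_at_filter
  proof (intro always_eventually allI impI)
    fix y :: real assume "y \<noteq> 0" "y \<in> {0..}"
    then show "(y / \<tau>) powr (\<beta> - 1) / \<tau> = ((y / \<tau>) powr \<beta> - (0 / \<tau>) powr \<beta>) / (y - 0)"
      using \<tau> by (simp add: powr_diff field_simps)
  qed
  ultimately have "((\<lambda>y. ((y / \<tau>) powr \<beta> - (0 / \<tau>) powr \<beta>) / (y - 0)) \<longlongrightarrow> 0) (at 0 within {0..})"
    by (simp add: tendsto_cong)
  then show ?thesis using True \<beta> by (simp add: has_field_derivative_iff)
qed

text \<open>The time variable enters with the exponent \<open>\<beta> = 2\<theta> > 1\<close>: this matches the scaling of the
  equation and keeps \<open>rho\<close> of class \<open>C\<^sup>1\<close> down to \<open>t = 0\<close>.\<close>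

definition rho :: "'a::euclidean_space \<Rightarrow> real \<Rightarrow> real \<Rightarrow> real \<Rightarrow> 'a \<Rightarrow> real \<Rightarrow> real"
  where "rho z \<sigma> \<tau> \<beta> x t = 1 + inner (x - z) (x - z) * inverse (\<sigma>\<^sup>2) + (t / \<tau>) powr \<beta>"

lemma par_rho:
  assumes "0 < \<tau>" "1 < \<beta>"
  shows "par T (rho z \<sigma> \<tau> \<beta>) (\<lambda>x t. (\<beta> / \<tau>) * (t / \<tau>) powr (\<beta> - 1))
    (\<lambda>b x t. 2 * inner (x - z) b * inverse (\<sigma>\<^sup>2)) (\<lambda>b c x t. 2 * inner c b * inverse (\<sigma>\<^sup>2))"
proof -
  have c: "continuous_on {0..} (\<lambda>t. (\<beta> / \<tau>) * (t / \<tau>) powr (\<beta> - 1))"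
    using assms by (intro continuous_intros continuous_on_powr') auto
  note a = par_add[OF par_add[OF par_const[of T 1] par_mult[OF par_sqdist[of T z] par_const[of T "inverse (\<sigma>\<^sup>2)"]]]
      par_time[OF DERIV_time_power[OF assms] c]]
  show ?thesis unfolding rho_def[abs_def] using a by simp
qed

lemma rho_ge: "0 < \<tau> \<Longrightarrow> 0 \<le> t \<Longrightarrow> 1 \<le> rho z \<sigma> \<tau> \<beta> x t"
  "0 < \<tau> \<Longrightarrow> 0 \<le> t \<Longrightarrow> (t / \<tau>) powr \<beta> \<le> rho z \<sigma> \<tau> \<beta> x t"
  "0 < \<tau> \<Longrightarrow> 0 \<le> t \<Longrightarrow> (norm (x - z))\<^sup>2 * inverse (\<sigma>\<^sup>2) \<le> rho z \<sigma> \<tau> \<beta> x t"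
  by (auto simp: rho_def dot_square_norm)

text \<open>The descent from 1 at r = 1 to 0 at r = e^L is spread evenly over the shells of ln r, so
  its first derivative carries 1 / (L r). This 1 / L is the origin of the logarithm in the critical
  estimate. The power k provides smoothness and room for the absorption.\<close>

definition logcut :: "nat \<Rightarrow> real \<Rightarrow> real \<Rightarrow> real"
  where "logcut k L r = max 0 (1 - ln r / L) ^ k"

lemma DERIV_logcut:
  assumes "0 < r" "0 < L"
  shows "(logcut (Suc (Suc k)) L has_real_derivative - ((real k + 2) / (L * r) * logcut (Suc k) L r)) (at r)"
proof -
  have "((\<lambda>r. 1 - ln r / L) has_real_derivative - (1 / (L * r))) (at r)"
    using assms by (auto intro!: derivative_eq_intros simp: field_simps)
  from DERIV_chain2[OF DERIV_pos_part_power[of k "1 - ln r / L"] this]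
  show ?thesis unfolding logcut_def[abs_def] by (simp add: mult.commute)
qed

lemma DERIV2_logcut:
  assumes "0 < r" "0 < L"
  shows "((\<lambda>r. - ((real k + 3) / (L * r) * logcut (Suc (Suc k)) L r)) has_real_derivative
    (real k + 3) / (L * r\<^sup>2) * logcut (Suc (Suc k)) L r + (real k + 3) * (real k + 2) / (L * r)\<^sup>2 * logcut (Suc k) L r) (at r)"
proof -
  have "((\<lambda>r. - ((real k + 3) / (L * r))) has_real_derivative (real k + 3) / (L * r\<^sup>2)) (at r)"
    using assms by (auto intro!: derivative_eq_intros simp: field_simps power2_eq_square)
  from DERIV_mult[OF this DERIV_logcut[OF assms, of k]]
  show ?thesis using assms by (simp add: field_simps power2_eq_square)
qed

lemma logcut_bounds: "1 \<le> r \<Longrightarrow> 0 < L \<Longrightarrow> 0 \<le> logcut k L r \<and> logcut k L r \<le> 1"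
  unfolding logcut_def by (auto intro!: power_le_one)

lemma logcut_zero: assumes "exp L \<le> r" "0 < L" "0 < k" shows "logcut k L r = 0"
proof -
  have "L \<le> ln r" using assms by (metis exp_gt_zero ln_exp ln_le_cancel_iff order_less_le_trans)
  then have "1 - ln r / L \<le> 0" using assms by simp
  then show ?thesis using assms by (simp add: logcut_def)
qed

text \<open>In the second case of the proof the left side exceeds the first term on the right,
  which bounds \<open>u\<close> itself; this replaces Young's inequality.\<close>

lemma young_cut:
  fixes u c w e p :: real
  assumes u: "0 \<le> u" and e: "0 < e" "e < p" and c: "0 \<le> c" and w: "0 \<le> w" "w \<le> 1"
    and jk: "0 < j" "j \<le> k" "real k * e \<le> real j * p"
  shows "u powr e * (c * w ^ j) \<le> u powr p * w ^ k / 4 + 4 powr (e / (p - e)) * c powr (p / (p - e)) * (if 0 < w then 1 else 0)"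
proof (cases "u = 0 \<or> c = 0 \<or> w = 0")
  case True
  then show ?thesis using jk u w by (auto simp: power_0_left)
next
  case False
  then have pos: "0 < u" "0 < c" "0 < w" using u c w by auto
  show ?thesis
  proof (cases "u powr e * (c * w ^ j) \<le> u powr p * w ^ k / 4")
    case True
    then show ?thesis using c by (auto intro: add_increasing2)
  next
    case False
    \<comment> \<open>In this case u^(p - e) < 4 c w^(-d), and raising to the power e / (p - e)
      bounds u^e.\<close>
    define d where "d = real k - real j"
    have d: "0 \<le> d" using jk by (simp add: d_def)
    have "u powr p * w powr real k < 4 * (u powr e * (c * w powr real j))"
      using False pos by (simp add: powr_realpow)
    then have "u powr (p - e) * w powr d < 4 * c"
      using pos by (simp add: d_def powr_diff field_simps)
    then have "u powr (p - e) < 4 * c * w powr (- d)"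
      using pos by (simp add: powr_minus field_simps)
    then have "(u powr (p - e)) powr (e / (p - e)) \<le> (4 * c * w powr (- d)) powr (e / (p - e))"
      using e by (intro powr_mono2) auto
    then have "u powr e \<le> 4 powr (e / (p - e)) * c powr (e / (p - e)) * w powr (- d * (e / (p - e)))"
      using e pos by (simp add: powr_powr powr_mult)
    then have "u powr e * (c * w ^ j) \<le> 4 powr (e / (p - e)) * c powr (e / (p - e)) * w powr (- d * (e / (p - e))) * (c * w ^ j)"
      using pos by (intro mult_right_mono) auto
    also have "\<dots> = 4 powr (e / (p - e)) * (c powr (e / (p - e)) * c powr 1) * (w powr (- d * (e / (p - e))) * w powr real j)"
      using pos by (simp add: powr_realpow)
    also have "\<dots> = 4 powr (e / (p - e)) * c powr (p / (p - e)) * w powr (real j - d * (e / (p - e)))"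
    proof -
      have "e / (p - e) + 1 = p / (p - e)" using e by (simp add: field_simps)
      then show ?thesis unfolding powr_add[symmetric] by (simp add: add.commute)
    qed
    also have "\<dots> \<le> 4 powr (e / (p - e)) * c powr (p / (p - e)) * 1"
    proof (intro mult_left_mono powr_le1)
      \<comment> \<open>The hypothesis k e \<le> j p leaves w with a nonnegative power, so the
        remainder stays bounded where w tends to 0.\<close>
      have "d * e \<le> real j * (p - e)" using jk(3) by (simp add: d_def algebra_simps)
      then show "0 \<le> real j - d * (e / (p - e))" using e by (simp add: field_simps)
    qed (use pos w in auto)
    also have "\<dots> \<le> u powr p * w ^ k / 4 + 4 powr (e / (p - e)) * c powr (p / (p - e)) * (if 0 < w then 1 else 0)"
      using pos by simp
    finally show ?thesis .
  qed
qed

lemma par_log_test: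
  fixes z :: "'a::euclidean_space" and n :: nat and \<sigma> :: real
  assumes "0 < \<tau>" "1 < \<beta>" "0 < L"
  defines "\<rho> \<equiv> rho z \<sigma> \<tau> \<beta>"
  defines "G1 \<equiv> \<lambda>r. - ((real n + 3) / (L * r) * logcut (n + 2) L r)"
    and "G2 \<equiv> \<lambda>r. (real n + 3) / (L * r\<^sup>2) * logcut (n + 2) L r + (real n + 3) * (real n + 2) / (L * r)\<^sup>2 * logcut (n + 1) L r"
  shows "par T (\<lambda>x t. logcut (n + 3) L (\<rho> x t)) (\<lambda>x t. G1 (\<rho> x t) * ((\<beta> / \<tau>) * (t / \<tau>) powr (\<beta> - 1)))
    (\<lambda>b x t. G1 (\<rho> x t) * (2 * inner (x - z) b * inverse (\<sigma>\<^sup>2)))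
    (\<lambda>b c x t. G2 (\<rho> x t) * (2 * inner (x - z) c * inverse (\<sigma>\<^sup>2)) * (2 * inner (x - z) b * inverse (\<sigma>\<^sup>2)) +
      G1 (\<rho> x t) * (2 * inner c b * inverse (\<sigma>\<^sup>2)))"
proof (rule par_comp[where U="{0<..}"])
  show "par T \<rho> (\<lambda>x t. (\<beta> / \<tau>) * (t / \<tau>) powr (\<beta> - 1)) (\<lambda>b x t. 2 * inner (x - z) b * inverse (\<sigma>\<^sup>2))
      (\<lambda>b c x t. 2 * inner c b * inverse (\<sigma>\<^sup>2))"
    unfolding \<rho>_def by (rule par_rho[OF assms(1,2)])
  show "\<rho> x t \<in> {0<..}" if "(x, t) \<in> strip T" for x t
    using rho_ge(1)[OF assms(1), of t z \<sigma> \<beta> x] that by (simp add: \<rho>_def strip_iff)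
  show "(logcut (n + 3) L has_real_derivative G1 r) (at r)" if "r \<in> {0<..}" for r
    using DERIV_logcut[of r L "Suc n"] that assms(3) by (simp add: G1_def numeral_3_eq_3 add.commute)
  show "(G1 has_real_derivative G2 r) (at r)" if "r \<in> {0<..}" for r
    using DERIV2_logcut[of r L n] that assms(3) unfolding G1_def G2_def by simp
  show "continuous_on {0<..} G2"
    unfolding G2_def logcut_def using assms(3) by (intro continuous_intros) auto
qed

text \<open>With j the integer part of ln rho, the point lies in the shell e^j \<le> rho < e^(j+1).
  There rho^(-q) is at most e^(-jq), and each of the two nonconstant terms of rho is below e^(j+1),
  which confines the point to the cylinder. The cylinders overlap, which only enlarges the
  sum.\<close>

lemma rho_level_cover:
  fixes z x :: "'a::euclidean_space"
  assumes \<sigma>: "0 < \<sigma>" and \<tau>: "0 < \<tau>" and \<beta>: "0 < \<beta>" and q: "0 < q" and t: "0 < t"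
    and less: "rho z \<sigma> \<tau> \<beta> x t < exp L"
  shows "rho z \<sigma> \<tau> \<beta> x t powr (- q) \<le> (\<Sum>j<nat \<lceil>L\<rceil>. exp (- (real j * q)) *
    indicator (ball z (\<sigma> * exp ((real j + 1) / 2)) \<times> {0<..<\<tau> * exp ((real j + 1) / \<beta>)}) (x, t))"
proof -
  let ?r = "rho z \<sigma> \<tau> \<beta> x t"
  let ?B = "\<lambda>j::nat. ball z (\<sigma> * exp ((real j + 1) / 2)) \<times> {0<..<\<tau> * exp ((real j + 1) / \<beta>)}"
  have r1: "1 \<le> ?r" using rho_ge(1)[OF \<tau> less_imp_le[OF t]] .
  have l0: "0 \<le> ln ?r" using r1 by simp
  have lL: "ln ?r < L" using less r1 by (metis exp_less_cancel_iff exp_ln less_le_trans zero_less_one)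
  define j where "j = nat \<lfloor>ln ?r\<rfloor>"
  have j: "real j \<le> ln ?r" "ln ?r < real j + 1" using l0 by (simp_all add: j_def)
  have jL: "j < nat \<lceil>L\<rceil>" using j(1) lL by linarith
  have r_less: "?r < exp (real j + 1)" using j(2) r1 by (metis exp_less_cancel_iff exp_ln less_le_trans zero_less_one)
  have inB: "(x, t) \<in> ?B j"
  proof -
    have "(norm (x - z))\<^sup>2 * inverse (\<sigma>\<^sup>2) < exp (real j + 1)"
      using rho_ge(3)[OF \<tau>, of t x z \<sigma> \<beta>] t r_less by simp
    then have "(norm (x - z))\<^sup>2 < \<sigma>\<^sup>2 * exp (real j + 1)"
      using \<sigma> by (simp add: field_simps)
    also have "\<dots> = (\<sigma> * exp ((real j + 1) / 2))\<^sup>2"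
      by (simp add: power_mult_distrib flip: exp_double)
    finally have "norm (x - z) < \<sigma> * exp ((real j + 1) / 2)"
      by (rule power_less_imp_less_base) (use \<sigma> in simp)
    moreover have "t < \<tau> * exp ((real j + 1) / \<beta>)"
    proof -
      have "(t / \<tau>) powr \<beta> < exp (real j + 1)"
        using rho_ge(2)[OF \<tau>, of t \<beta> z \<sigma> x] t r_less by simp
      then have "((t / \<tau>) powr \<beta>) powr (1 / \<beta>) < exp (real j + 1) powr (1 / \<beta>)"
        using \<beta> by (intro powr_less_mono2) auto
      then show ?thesis using t \<tau> \<beta> by (simp add: powr_powr exp_powr_real field_simps)
    qed
    ultimately show ?thesis using t by (simp add: dist_norm norm_minus_commute)
  qed
  have "?r powr (- q) = exp (- (q * ln ?r))" using r1 by (simp add: powr_def)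
  also have "\<dots> \<le> exp (- (real j * q))" using j(1) q by (simp add: mult.commute)
  also have "\<dots> = exp (- (real j * q)) * indicator (?B j) (x, t)" using inB by simp
  also have "\<dots> \<le> (\<Sum>j<nat \<lceil>L\<rceil>. exp (- (real j * q)) * indicator (?B j) (x, t))"
    by (rule member_le_sum) (use jL in auto)
  finally show ?thesis .
qed

section \<open>Pointwise absorption for the logarithmic test function\<close>

context weak_rep
begin

text \<open>Each of the two applications of \<open>young_cut\<close> uses up a quarter of v^p
  \<phi>; the half that remains is dropped by its sign. What is left lives where the cut-off is
  positive, that is, where rho < e^L.\<close>

lemma \<Phi>_log_test_le:
  fixes z :: 'a and n :: nat
  assumes \<sigma>: "0 < \<sigma>" and \<tau>: "0 < \<tau>" and L: "1 \<le> L" and S: "(x, t) \<in> strip T" and t: "0 < t"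
    and n: "real (n + 3) * (p - 1) \<ge> p" "real (n + 3) * (p - m) \<ge> 2 * p"
  defines "\<beta> \<equiv> (p - m) / (p - 1)"
  defines "\<rho> \<equiv> rho z \<sigma> \<tau> \<beta>"
  defines "A \<equiv> 4 * real (n + 3) ^ 2 + 2 * real (n + 3) * DIM('a)"
  shows "\<Phi> (\<lambda>x t. logcut (n + 3) L (\<rho> x t)) x t \<le>
    (4 powr (1 / (p - 1)) * (real (n + 3) * \<beta> / (\<tau> * L)) powr (p / (p - 1)) +
     4 powr (m / (p - m)) * (A / (\<sigma>\<^sup>2 * L)) powr (p / (p - m))) *
    (if \<rho> x t < exp L then \<rho> x t powr (- (p / (p - m))) else 0)"
proof -
  have \<beta>: "1 < \<beta>" using m p by (simp add: \<beta>_def)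
  have L0: "0 < L" using L by simp
  define r where "r = \<rho> x t"
  have r1: "1 \<le> r" unfolding r_def \<rho>_def by (rule rho_ge(1)[OF \<tau> less_imp_le[OF t]])
  define w where "w = max 0 (1 - ln r / L)"
  have w: "0 \<le> w" "w \<le> 1" using r1 L0 by (auto simp: w_def)
  have lw: "logcut i L r = w ^ i" for i by (simp add: logcut_def w_def)
  have wpos: "0 < w \<longleftrightarrow> r < exp L"
  proof -
    have "0 < w \<longleftrightarrow> ln r < L" using L0 by (auto simp: w_def max_def field_simps)
    also have "\<dots> \<longleftrightarrow> r < exp L" using r1 by (metis exp_less_cancel_iff exp_ln less_le_trans zero_less_one)
    finally show ?thesis .
  qed
  let ?\<phi> = "\<lambda>x t. logcut (n + 3) L (\<rho> x t)"
  note pa = par_log_test[OF \<tau> \<beta> L0, of T n z \<sigma>, folded \<rho>_def]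
  have tdv: "time_deriv ?\<phi> x t = - ((real n + 3) / (L * r) * w ^ (n + 2)) * ((\<beta> / \<tau>) * (t / \<tau>) powr (\<beta> - 1))"
    using par_derivs(1)[OF pa S] by (simp add: lw flip: r_def)
  define G1 where "G1 = - ((real n + 3) / (L * r) * w ^ (n + 2))"
  define G2 where "G2 = (real n + 3) / (L * r\<^sup>2) * w ^ (n + 2) + (real n + 3) * (real n + 2) / (L * r)\<^sup>2 * w ^ (n + 1)"
  define \<kappa> where "\<kappa> = inverse (\<sigma>\<^sup>2)"
  have \<kappa>: "0 < \<kappa>" using \<sigma> by (simp add: \<kappa>_def)
  have lap: "laplacian (\<lambda>y. ?\<phi> y t) x = G2 * (4 * \<kappa>\<^sup>2 * (norm (x - z))\<^sup>2) + G1 * (2 * \<kappa> * DIM('a))"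
  proof -
    have "laplacian (\<lambda>y. ?\<phi> y t) x = (\<Sum>b\<in>Basis. G2 * (2 * inner (x - z) b * \<kappa>) * (2 * inner (x - z) b * \<kappa>) + G1 * (2 * inner b b * \<kappa>))"
      using par_derivs(4)[OF pa S] by (simp add: lw G1_def G2_def \<kappa>_def flip: r_def)
    also have "\<dots> = (\<Sum>b\<in>Basis. G2 * (4 * \<kappa>\<^sup>2) * (inner (x - z) b * inner (x - z) b) + G1 * (2 * \<kappa>))"
      by (intro sum.cong) (auto simp: power2_eq_square algebra_simps)
    also have "\<dots> = G2 * (4 * \<kappa>\<^sup>2) * inner (x - z) (x - z) + G1 * (2 * \<kappa>) * DIM('a)"
      unfolding sum.distrib sum_distrib_left[symmetric] euclidean_inner[symmetric] by simp
    finally show ?thesis by (simp add: dot_square_norm algebra_simps)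
  qed
  define c1 where "c1 = real (n + 3) * \<beta> / (\<tau> * L) * r powr (- (1 / \<beta>))"
  define c2 where "c2 = A / (\<sigma>\<^sup>2 * L) * r powr (- 1)"
  have b1: "\<bar>time_deriv ?\<phi> x t\<bar> \<le> c1 * w ^ (n + 2)"
  proof -
    have "(t / \<tau>) powr (\<beta> - 1) = ((t / \<tau>) powr \<beta>) powr ((\<beta> - 1) / \<beta>)"
      using \<beta> by (simp add: powr_powr)
    also have "\<dots> \<le> r powr ((\<beta> - 1) / \<beta>)"
      using rho_ge(2)[OF \<tau>, of t \<beta> z \<sigma> x] t \<beta> by (intro powr_mono2) (auto simp: r_def \<rho>_def)
    also have "\<dots> = r * r powr (- (1 / \<beta>))"
    proof -
      have "(\<beta> - 1) / \<beta> = 1 + - (1 / \<beta>)" using \<beta> by (simp add: diff_divide_distrib)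
      then show ?thesis using r1 by (simp only: powr_add) simp
    qed
    finally have le: "(t / \<tau>) powr (\<beta> - 1) \<le> r * r powr (- (1 / \<beta>))" .
    have "\<bar>time_deriv ?\<phi> x t\<bar> = (real n + 3) / (L * r) * w ^ (n + 2) * ((\<beta> / \<tau>) * (t / \<tau>) powr (\<beta> - 1))"
      unfolding tdv using w r1 L0 \<beta> \<tau> by (simp add: abs_mult)
    also have "\<dots> \<le> (real n + 3) / (L * r) * w ^ (n + 2) * ((\<beta> / \<tau>) * (r * r powr (- (1 / \<beta>))))"
      using le w r1 L0 \<beta> \<tau> by (intro mult_left_mono) auto
    also have "\<dots> = c1 * w ^ (n + 2)" using r1 L0 \<tau> by (simp add: c1_def field_simps)
    finally show ?thesis .
  qed
  have b2: "\<bar>laplacian (\<lambda>y. ?\<phi> y t) x\<bar> \<le> c2 * w ^ (n + 1)"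
  proof -
    have w2: "w ^ (n + 2) \<le> w ^ (n + 1)" using w by (intro power_decreasing) auto
    have wn: "0 \<le> w ^ (n + 1)" using w by simp
    have x2: "(norm (x - z))\<^sup>2 * \<kappa> \<le> r"
      using rho_ge(3)[OF \<tau>, of t x z \<sigma> \<beta>] t by (simp add: \<kappa>_def r_def \<rho>_def)
    have G1b: "\<bar>G1\<bar> \<le> (real n + 3) / (L * r) * w ^ (n + 1)"
      unfolding G1_def using w2 w r1 L0 by (simp add: abs_mult divide_right_mono mult_left_mono)
    have G2b: "\<bar>G2\<bar> \<le> (real n + 3)\<^sup>2 / (L * r\<^sup>2) * w ^ (n + 1)"
    proof -
      have "G2 \<le> (real n + 3) / (L * r\<^sup>2) * w ^ (n + 1) + (real n + 3) * (real n + 2) / (L * r\<^sup>2) * w ^ (n + 1)"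
        unfolding G2_def
      proof (rule add_mono[OF mult_left_mono[OF w2] mult_right_mono[OF divide_left_mono wn]])
        \<comment> \<open>By L \<ge> 1 the second-order term gives away one factor 1 / L, so a
          single 1 / L bounds the whole Laplacian.\<close>
        show "L * r\<^sup>2 \<le> (L * r)\<^sup>2"
          using L r1 by (simp add: power_mult_distrib power2_eq_square mult_right_mono)
      qed (use r1 L0 in auto)
      also have "\<dots> = (real n + 3)\<^sup>2 / (L * r\<^sup>2) * w ^ (n + 1)"
        using r1 L0 by (simp add: field_simps power2_eq_square)
      finally show ?thesis using w r1 L0 by (simp add: G2_def)
    qed
    have "\<bar>laplacian (\<lambda>y. ?\<phi> y t) x\<bar> \<le> \<bar>G2\<bar> * (4 * \<kappa>\<^sup>2 * (norm (x - z))\<^sup>2) + \<bar>G1\<bar> * (2 * \<kappa> * DIM('a))"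
      unfolding lap using abs_triangle_ineq[of "G2 * (4 * \<kappa>\<^sup>2 * (norm (x - z))\<^sup>2)" "G1 * (2 * \<kappa> * DIM('a))"] \<kappa>
      by (simp add: abs_mult)
    also have "\<dots> \<le> (real n + 3)\<^sup>2 / (L * r\<^sup>2) * w ^ (n + 1) * (4 * \<kappa> * r) + (real n + 3) / (L * r) * w ^ (n + 1) * (2 * \<kappa> * DIM('a))"
    proof (rule add_mono[OF mult_mono[OF G2b] mult_right_mono[OF G1b]])
      show "4 * \<kappa>\<^sup>2 * (norm (x - z))\<^sup>2 \<le> 4 * \<kappa> * r"
        using mult_left_mono[OF x2, of "4 * \<kappa>"] \<kappa> by (simp add: power2_eq_square algebra_simps)
    qed (use w r1 L0 \<kappa> in auto)
    also have "\<dots> = c2 * w ^ (n + 1)"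
      using r1 L0 \<sigma> by (simp add: c2_def A_def \<kappa>_def powr_minus field_simps power2_eq_square)
    finally show ?thesis .
  qed
  have A: "0 \<le> A" by (simp add: A_def)
  have c: "0 \<le> c1" "0 \<le> c2" using A r1 L0 \<tau> \<beta> by (auto simp: c1_def c2_def)
  \<comment> \<open>The two conditions on n are the hypothesis k e \<le> j p of
    \<open>young_cut\<close> for (e, j, k) equal to (1, n + 2, n + 3) and (m, n + 1, n + 3).\<close>
  have y1: "v x t powr 1 * (c1 * w ^ (n + 2)) \<le> v x t powr p * w ^ (n + 3) / 4 + 4 powr (1 / (p - 1)) * c1 powr (p / (p - 1)) * (if 0 < w then 1 else 0)"
    by (rule young_cut) (use v_nonneg p c w n in \<open>auto simp: algebra_simps\<close>)
  have y2: "v x t powr m * (c2 * w ^ (n + 1)) \<le> v x t powr p * w ^ (n + 3) / 4 + 4 powr (m / (p - m)) * c2 powr (p / (p - m)) * (if 0 < w then 1 else 0)"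
    by (rule young_cut) (use v_nonneg m p c w n in \<open>auto simp: algebra_simps\<close>)
  have "- v x t * time_deriv ?\<phi> x t \<le> v x t powr 1 * (c1 * w ^ (n + 2))"
  proof -
    have "- v x t * time_deriv ?\<phi> x t \<le> v x t * \<bar>time_deriv ?\<phi> x t\<bar>"
      using v_nonneg[of x t] by (smt (verit) minus_mult_left minus_mult_right mult_left_mono)
    also have "\<dots> \<le> v x t * (c1 * w ^ (n + 2))" using b1 v_nonneg by (intro mult_left_mono)
    finally show ?thesis unfolding v_powr_1 .
  qed
  moreover have "- (v x t powr m * laplacian (\<lambda>y. ?\<phi> y t) x) \<le> v x t powr m * (c2 * w ^ (n + 1))"
  proof -
    have "- (v x t powr m * laplacian (\<lambda>y. ?\<phi> y t) x) \<le> v x t powr m * \<bar>laplacian (\<lambda>y. ?\<phi> y t) x\<bar>"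
      by (smt (verit) minus_mult_left minus_mult_right mult_left_mono powr_ge_zero)
    also have "\<dots> \<le> v x t powr m * (c2 * w ^ (n + 1))" using b2 by (intro mult_left_mono) auto
    finally show ?thesis .
  qed
  moreover have "0 \<le> v x t powr p * w ^ (n + 3)" using w by simp
  ultimately have "\<Phi> ?\<phi> x t \<le> (4 powr (1 / (p - 1)) * c1 powr (p / (p - 1)) + 4 powr (m / (p - m)) * c2 powr (p / (p - m))) * (if 0 < w then 1 else 0)"
    unfolding \<Phi>_def using y1 y2 by (simp add: lw distrib_right flip: r_def)
  also have "c1 powr (p / (p - 1)) = (real (n + 3) * \<beta> / (\<tau> * L)) powr (p / (p - 1)) * r powr (- (p / (p - m)))"
  proof -
    have "1 / \<beta> * (p / (p - 1)) = p / (p - m)" using p by (simp add: \<beta>_def)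
    then have "(r powr (- (1 / \<beta>))) powr (p / (p - 1)) = r powr (- (p / (p - m)))"
      unfolding powr_powr mult_minus_left by (rule arg_cong[where f="\<lambda>e. r powr (- e)"])
    then show ?thesis unfolding c1_def powr_mult by (rule arg_cong)
  qed
  also have "c2 powr (p / (p - m)) = (A / (\<sigma>\<^sup>2 * L)) powr (p / (p - m)) * r powr (- (p / (p - m)))"
    unfolding c2_def powr_mult powr_powr by simp
  finally show ?thesis
    unfolding wpos r_def by (auto simp: algebra_simps)
qed

end


section \<open>The mass estimate\<close>

lemma measure_lborel_Times:
  fixes A :: "'a::euclidean_space set" and B :: "real set"
  assumes A: "A \<in> sets borel" "emeasure lborel A < \<infinity>" and B: "B \<in> sets borel" "emeasure lborel B < \<infinity>"
  shows "integrable lborel (indicator (A \<times> B) :: _ \<Rightarrow> real)"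
    "(LINT z|lborel. indicator (A \<times> B) z) = measure lborel A * measure lborel B"
proof -
  have "emeasure (lborel \<Otimes>\<^sub>M lborel) (A \<times> B) = emeasure lborel A * emeasure lborel B"
    using A B by (intro lborel.emeasure_pair_measure_Times) auto
  then have e: "emeasure lborel (A \<times> B) = emeasure lborel A * emeasure lborel B"
    unfolding lborel_prod .
  have "A \<times> B \<in> sets (lborel \<Otimes>\<^sub>M lborel)" using A B by (intro pair_measureI) auto
  then have AB: "A \<times> B \<in> sets lborel" unfolding lborel_prod .
  have "emeasure lborel (A \<times> B) < \<infinity>" unfolding e using A B by (simp add: ennreal_mult_less_top)
  then show "integrable lborel (indicator (A \<times> B) :: _ \<Rightarrow> real)" using AB by (intro integrable_real_indicator)
  show "(LINT z|lborel. indicator (A \<times> B) z) = measure lborel A * measure lborel B"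
    using e AB by (simp add: measure_def enn2real_mult)
qed

lemma measure_cylinder:
  fixes z :: "'a::euclidean_space"
  assumes "0 \<le> r" "0 \<le> s"
  shows "integrable lborel (indicator (ball z r \<times> {0<..<s}) :: _ \<Rightarrow> real)"
    "(LINT y|lborel. indicator (ball z r \<times> {0<..<s}) y) = unit_ball_vol DIM('a) * r ^ DIM('a) * s"
proof -
  have b: "emeasure lborel (ball z r) < \<infinity>" "emeasure lborel {0<..<s} < \<infinity>"
    by (intro emeasure_bounded_finite bounded_ball) (simp add: assms)
  note m = measure_lborel_Times[OF _ b(1) _ b(2)]
  show "integrable lborel (indicator (ball z r \<times> {0<..<s}) :: _ \<Rightarrow> real)" by (rule m(1)) auto
  have "(LINT y|lborel. indicator (ball z r \<times> {0<..<s}) y) = measure lborel (ball z r) * measure lborel {0<..<s}"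
    by (rule m(2)) auto
  then show "(LINT y|lborel. indicator (ball z r \<times> {0<..<s}) y) = unit_ball_vol DIM('a) * r ^ DIM('a) * s"
    using assms by (simp add: content_ball)
qed

lemma vanishes_log_test:
  fixes z :: "'a::euclidean_space"
  assumes \<sigma>: "0 < \<sigma>" and \<tau>: "0 < \<tau>" and \<beta>: "0 < \<beta>" and L: "0 < L" and k: "0 < k"
  shows "vanishes (norm z + \<sigma> * exp (L / 2)) (\<tau> * exp (L / \<beta>)) T (\<lambda>x t. logcut k L (rho z \<sigma> \<tau> \<beta> x t))"
  unfolding vanishes_def
proof (intro allI impI logcut_zero L k)
  fix x :: 'a and t assume S: "(x, t) \<in> strip T"
    and out: "norm z + \<sigma> * exp (L / 2) < norm x \<or> \<tau> * exp (L / \<beta>) < t"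
  have t: "0 \<le> t" using S by (simp add: strip_iff)
  show "exp L \<le> rho z \<sigma> \<tau> \<beta> x t"
  proof (cases "norm z + \<sigma> * exp (L / 2) < norm x")
    case True
    then have "\<sigma> * exp (L / 2) \<le> norm (x - z)" using norm_triangle_ineq2[of x z] by simp
    then have "(\<sigma> * exp (L / 2))\<^sup>2 \<le> (norm (x - z))\<^sup>2" using \<sigma> by (intro power_mono) auto
    then have "exp L \<le> (norm (x - z))\<^sup>2 * inverse (\<sigma>\<^sup>2)"
      using \<sigma> by (simp add: power_mult_distrib field_simps flip: exp_double)
    then show ?thesis using rho_ge(3)[OF \<tau> t, of x z \<sigma> \<beta>] by simp
  next
    case False
    then have "exp (L / \<beta>) \<le> t / \<tau>" using out \<tau> by (simp add: field_simps)
    then have "exp (L / \<beta>) powr \<beta> \<le> (t / \<tau>) powr \<beta>" using \<beta> by (intro powr_mono2) auto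
    then have "exp L \<le> (t / \<tau>) powr \<beta>" using \<beta> by (simp add: exp_powr_real)
    then show ?thesis using rho_ge(2)[OF \<tau> t, of \<beta> z \<sigma> x] by simp
  qed
qed

context weak_limit
begin

lemma W_0_eq: assumes "test_fun T \<phi>" shows "W \<phi> 0 = (LINT z|lborel. \<Phi> \<phi> (fst z) (snd z))"
proof -
  have "indicator {0<..} t * F \<phi> t = F \<phi> t" for t
  proof (cases "0 < t")
    case False
    then have "F \<phi> t = 0" by (simp add: F_def \<Phi>_def v_past)
    then show ?thesis by simp
  qed simp
  then have "W \<phi> 0 = (LINT t|lborel. F \<phi> t)" by (simp only: W_def)
  also have "\<dots> = (LINT z|lborel. \<Phi> \<phi> (fst z) (snd z))"
    unfolding F_def by (rule integrable_slice(3)[OF test_integrable(5)[OF assms]])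
  finally show ?thesis .
qed

text \<open>At t = 0 the test function is at least 2^(-(n + 3)) on the ball, so its integral against
  the trace controls the mass of the ball. \<open>W_eq_\<nu>\<close> turns that integral into the
  space-time integral bounded by \<open>\<Phi>_log_test_le\<close>. The last hypothesis keeps the
  support of the test function below T.\<close>

lemma mass_bound:
  fixes z :: 'a and n :: nat
  assumes \<sigma>: "0 < \<sigma>" and \<tau>: "0 < \<tau>" and L: "2 \<le> L"
    and n: "real (n + 3) * (p - 1) \<ge> p" "real (n + 3) * (p - m) \<ge> 2 * p"
  defines "\<beta> \<equiv> (p - m) / (p - 1)" and "q \<equiv> p / (p - m)"
  defines "A \<equiv> 4 * real (n + 3) ^ 2 + 2 * real (n + 3) * DIM('a)"
  defines "E \<equiv> 4 powr (1 / (p - 1)) * (real (n + 3) * \<beta> / (\<tau> * L)) powr (p / (p - 1)) +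
     4 powr (m / (p - m)) * (A / (\<sigma>\<^sup>2 * L)) powr q"
  assumes \<tau>T: "ereal (\<tau> * exp (L / \<beta>)) < T"
  shows "measure \<nu> (ball z \<sigma>) \<le> 2 ^ (n + 3) * (E * (\<Sum>j<nat \<lceil>L\<rceil>. exp (- (real j * q)) *
    (unit_ball_vol DIM('a) * (\<sigma> * exp ((real j + 1) / 2)) ^ DIM('a) * (\<tau> * exp ((real j + 1) / \<beta>)))))"
proof -
  have \<beta>: "1 < \<beta>" and q: "0 < q" using m p by (simp_all add: \<beta>_def q_def)
  have L0: "0 < L" "1 \<le> L" using L by auto
  have E: "0 \<le> E" unfolding E_def by simp
  define \<rho> where "\<rho> = rho z \<sigma> \<tau> \<beta>"
  define \<phi> where "\<phi> x t = logcut (n + 3) L (\<rho> x t)" for x t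
  have \<phi>: "test_fun T \<phi>"
    unfolding \<phi>_def[abs_def] \<rho>_def
    by (rule test_funI[OF par_log_test[OF \<tau> \<beta> L0(1)] vanishes_log_test \<tau>T]) (use \<sigma> \<tau> \<beta> L0 in auto)
  define B where "B j = ball z (\<sigma> * exp ((real j + 1) / 2)) \<times> {0<..<\<tau> * exp ((real j + 1) / \<beta>)}" for j :: nat
  have iB: "integrable lborel (\<lambda>y. indicator (B j) y :: real)" for j
    using \<sigma> \<tau> unfolding B_def by (intro measure_cylinder) auto
  have vB: "(LINT y|lborel. indicator (B j) y) = unit_ball_vol DIM('a) * (\<sigma> * exp ((real j + 1) / 2)) ^ DIM('a) * (\<tau> * exp ((real j + 1) / \<beta>))" for j
    using \<sigma> \<tau> unfolding B_def by (intro measure_cylinder(2)) auto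
  have le: "\<Phi> \<phi> (fst y) (snd y) \<le> E * (\<Sum>j<nat \<lceil>L\<rceil>. exp (- (real j * q)) * indicator (B j) y)" for y
  proof -
    obtain x t where y: "y = (x, t)" by (cases y)
    have rhs: "0 \<le> (\<Sum>j<nat \<lceil>L\<rceil>. exp (- (real j * q)) * indicator (B j) y)"
      by (intro sum_nonneg) auto
    show ?thesis
    proof (cases "0 < t \<and> ereal t < T")
      case False
      then have "\<Phi> \<phi> x t = 0" by (simp add: \<Phi>_def v_outside)
      then show ?thesis using rhs E by (simp add: y)
    next
      case True
      then have S: "(x, t) \<in> strip T" and t: "0 < t" by (auto simp: strip_iff)
      have "\<Phi> \<phi> x t \<le> E * (if \<rho> x t < exp L then \<rho> x t powr (- q) else 0)"
        unfolding \<phi>_def[abs_def] \<rho>_def E_def A_def q_def \<beta>_def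
        by (rule \<Phi>_log_test_le[OF \<sigma> \<tau> L0(2) S t n])
      also have "\<dots> \<le> E * (\<Sum>j<nat \<lceil>L\<rceil>. exp (- (real j * q)) * indicator (B j) (x, t))"
      proof (rule mult_left_mono[OF _ E])
        show "(if \<rho> x t < exp L then \<rho> x t powr (- q) else 0) \<le> (\<Sum>j<nat \<lceil>L\<rceil>. exp (- (real j * q)) * indicator (B j) (x, t))"
          using rho_level_cover[OF \<sigma> \<tau> _ q t, of \<beta> z x L] \<beta> rhs unfolding B_def \<rho>_def y by auto
      qed
      finally show ?thesis by (simp add: y)
    qed
  qed
  have "W \<phi> 0 \<le> (LINT y|lborel. E * (\<Sum>j<nat \<lceil>L\<rceil>. exp (- (real j * q)) * indicator (B j) y))"
    unfolding W_0_eq[OF \<phi>]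
    by (rule integral_mono[OF test_integrable(5)[OF \<phi>] _ le])
      (intro integrable_mult_right Bochner_Integration.integrable_sum iB)
  also have "\<dots> = E * (\<Sum>j<nat \<lceil>L\<rceil>. exp (- (real j * q)) * (LINT y|lborel. indicator (B j) y))"
    by (simp only: Bochner_Integration.integral_mult_right_zero
        Bochner_Integration.integral_sum[OF integrable_mult_right[OF iB]])
  finally have upper: "(LINT x|\<nu>. \<phi> x 0) \<le> E * (\<Sum>j<nat \<lceil>L\<rceil>. exp (- (real j * q)) *
    (unit_ball_vol DIM('a) * (\<sigma> * exp ((real j + 1) / 2)) ^ DIM('a) * (\<tau> * exp ((real j + 1) / \<beta>))))"
    unfolding W_eq_\<nu>[OF \<phi>] vB .
  have fin: "emeasure \<nu> (ball z \<sigma>) < \<infinity>"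
    using emeasure_mono[of "ball z \<sigma>" "cball z \<sigma>" \<nu>] riesz_measure_compact[OF compact_cball, of z \<sigma>]
    by (auto simp: ball_subset_cball order_le_less_trans)
  have "(LINT x|\<nu>. (1 / 2) ^ (n + 3) * indicator (ball z \<sigma>) x) \<le> (LINT x|\<nu>. \<phi> x 0)"
  proof (rule integral_mono)
    show "integrable \<nu> (\<lambda>x. (1 / 2) ^ (n + 3) * indicator (ball z \<sigma>) x :: real)"
      using fin by (intro integrable_mult_right integrable_real_indicator) auto
    show "integrable \<nu> (\<lambda>x. \<phi> x 0)"
      using T by (intro integrable_riesz_measure test_slice_Cc[OF \<phi>]) (auto simp: zero_ereal_def)
    fix x
    show "(1 / 2) ^ (n + 3) * indicator (ball z \<sigma>) x \<le> \<phi> x 0"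
    proof (cases "x \<in> ball z \<sigma>")
      case True
      then have "(norm (x - z))\<^sup>2 \<le> \<sigma>\<^sup>2"
        using \<sigma> by (intro power_mono) (auto simp: dist_norm norm_minus_commute)
      \<comment> \<open>With L \<ge> 2 and ln 2 \<le> 1 the cut-off is at least 1/2 wherever rho
        \<le> 2.\<close>
      then have r2: "\<rho> x 0 \<le> 2" using \<sigma> by (simp add: \<rho>_def rho_def dot_square_norm field_simps)
      have r1: "1 \<le> \<rho> x 0" unfolding \<rho>_def by (rule rho_ge(1)[OF \<tau> order_refl])
      have "ln (\<rho> x 0) \<le> ln 2" using r1 r2 by simp
      also have "\<dots> \<le> 1" using ln2_le_25_over_36 by simp
      finally have "ln (\<rho> x 0) / L \<le> 1 / 2" using L by (simp add: field_simps)
      then have "1 / 2 \<le> 1 - ln (\<rho> x 0) / L" by linarith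
      then have "1 / 2 \<le> max 0 (1 - ln (\<rho> x 0) / L)" by (rule order_trans[OF _ max.cobounded2])
      then have "(1 / 2) ^ (n + 3) \<le> \<phi> x 0"
        unfolding \<phi>_def logcut_def by (rule power_mono) simp
      then show ?thesis using True by simp
    next
      case False
      have "1 \<le> \<rho> x 0" unfolding \<rho>_def by (rule rho_ge(1)[OF \<tau> order_refl])
      then show ?thesis using False logcut_bounds[of "\<rho> x 0" L "n + 3"] L0 by (simp add: \<phi>_def)
    qed
  qed
  then have "(1 / 2) ^ (n + 3) * measure \<nu> (ball z \<sigma>) \<le> (LINT x|\<nu>. \<phi> x 0)" by simp
  then have "2 ^ (n + 3) * ((1 / 2) ^ (n + 3) * measure \<nu> (ball z \<sigma>)) \<le> 2 ^ (n + 3) * (LINT x|\<nu>. \<phi> x 0)"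
    by (intro mult_left_mono) auto
  moreover have "2 ^ (n + 3) * (1 / 2) ^ (n + 3) = (1::real)" by (simp add: power_one_over)
  ultimately have "measure \<nu> (ball z \<sigma>) \<le> 2 ^ (n + 3) * (LINT x|\<nu>. \<phi> x 0)" by (simp only: mult.assoc[symmetric] mult_1)
  also have "\<dots> \<le> 2 ^ (n + 3) * (E * (\<Sum>j<nat \<lceil>L\<rceil>. exp (- (real j * q)) *
    (unit_ball_vol DIM('a) * (\<sigma> * exp ((real j + 1) / 2)) ^ DIM('a) * (\<tau> * exp ((real j + 1) / \<beta>)))))"
    by (intro mult_left_mono upper) auto
  finally show ?thesis .
qed

end


section \<open>Scaling and the choice of time scale and number of shells\<close>

text \<open>Here \<delta> will be N/2 - 1/(p - m), the net growth rate of the weighted shell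
  volumes. It is 0 exactly at p = m + 2/N, where the sum merely counts shells.\<close>

definition level_sum :: "real \<Rightarrow> real \<Rightarrow> real"
  where "level_sum \<delta> L = (\<Sum>j<nat \<lceil>L\<rceil>. exp (real j * \<delta>))"

lemma level_sum_nonneg: "0 \<le> level_sum \<delta> L"
  by (auto simp: level_sum_def intro: sum_nonneg)

lemma level_sum_0_le: "1 \<le> L \<Longrightarrow> level_sum 0 L \<le> 2 * L"
  unfolding level_sum_def by simp linarith

text \<open>The constant K is fixed before the solution, the horizon and the scales, hence depends
  on N, m and p only. An arbitrary trace is reduced to the Riesz measure by uniqueness of
  traces.\<close>

lemma ball_mass_bound:
  assumes mp: "0 < m" "m < 1" "1 < p"
  obtains K where "0 < K"
    "\<And>T (u :: 'a::euclidean_space \<Rightarrow> real \<Rightarrow> real) \<nu> z \<sigma> \<tau> L.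
      \<lbrakk>0 < T; solution_E m p T u; initial_trace u \<nu>; 0 < \<sigma>; 0 < \<tau>; 2 \<le> L;
        ereal (\<tau> * exp (L / ((p - m) / (p - 1)))) < T\<rbrakk> \<Longrightarrow>
      emeasure \<nu> (ball z \<sigma>) \<le> ennreal (K * ((\<tau> * L) powr (- (p / (p - 1))) + (\<sigma>\<^sup>2 * L) powr (- (p / (p - m)))) *
        (\<sigma> ^ DIM('a) * \<tau>) * level_sum (DIM('a) / 2 - 1 / (p - m)) L)"
proof -
  define \<beta> q e where "\<beta> = (p - m) / (p - 1)" and "q = p / (p - m)" and "e = p / (p - 1)"
  have \<beta>: "1 < \<beta>" using mp by (simp add: \<beta>_def)
  \<comment> \<open>Both lower bounds on the power of the cut-off are met at once by exceeding their
    sum.\<close>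
  obtain n0 :: nat where n0: "p / (p - 1) + 2 * p / (p - m) \<le> real n0" using real_arch_simple by blast
  have nn: "0 \<le> p / (p - 1)" "0 \<le> 2 * p / (p - m)" using mp by auto
  have n1: "real (n0 + 3) * (p - 1) \<ge> p"
  proof -
    have "p / (p - 1) \<le> real (n0 + 3)" using n0 nn by simp
    then show ?thesis using mp by (simp add: field_simps)
  qed
  have n2: "real (n0 + 3) * (p - m) \<ge> 2 * p"
  proof -
    have "2 * p / (p - m) \<le> real (n0 + 3)" using n0 nn by simp
    then show ?thesis using mp by (simp add: field_simps)
  qed
  define A where "A = 4 * real (n0 + 3) ^ 2 + 2 * real (n0 + 3) * DIM('a)"
  define a1 where "a1 = 4 powr (1 / (p - 1)) * (real (n0 + 3) * \<beta>) powr e"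
  define a2 where "a2 = 4 powr (m / (p - m)) * A powr q"
  \<comment> \<open>Growth rate of the cylinders: number j has volume \<omega> \<sigma>^N \<tau>
    e^((j + 1) \<gamma>), so the weight e^(-jq) leaves e^\<gamma> e^(j (\<gamma> - q)).\<close>
  define \<gamma> where "\<gamma> = DIM('a) / 2 + 1 / \<beta>"
  define \<omega> where "\<omega> = unit_ball_vol (real DIM('a))"
  have inv: "1 / \<beta> = q - 1 / (p - m)"
    by (simp add: q_def \<beta>_def flip: diff_divide_distrib)
  have \<gamma>q: "\<gamma> - q = DIM('a) / 2 - 1 / (p - m)"
    by (simp add: \<gamma>_def inv)
  have \<omega>: "0 < \<omega>" by (simp add: \<omega>_def)
  have a1: "0 < a1" using \<beta> by (simp add: a1_def)
  have a2: "0 \<le> a2" by (simp add: a2_def)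
  define K where "K = 2 ^ (n0 + 3) * (a1 + a2) * \<omega> * exp \<gamma>"
  have K: "0 < K" using a1 a2 \<omega> by (simp add: K_def)
  show thesis
  proof (rule that[OF K])
    fix T and u :: "'a \<Rightarrow> real \<Rightarrow> real" and \<nu> :: "'a measure" and z :: 'a and \<sigma> \<tau> L :: real
    assume T: "0 < T" and sol: "solution_E m p T u" and tr: "initial_trace u \<nu>"
      and \<sigma>: "0 < \<sigma>" and \<tau>: "0 < \<tau>" and L: "2 \<le> L" and \<tau>T: "ereal (\<tau> * exp (L / ((p - m) / (p - 1)))) < T"
    have adm: "admissible p T u" using sol by (simp add: solution_E_def)
    obtain v where v: "weak_rep m p T v" "slice_eq T u v"
      by (rule admissible_weak_rep[OF mp T adm])
    interpret weak_rep m p T v by (rule v(1))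
    interpret L: weak_limit m p T v by (rule solution_E_weak_limit[OF v(2) sol])
    have \<nu>: "L.\<nu> = \<nu>" by (rule initial_trace_unique[OF L.initial_trace_\<nu>[OF v(2)] tr])
    define X Y where "X = (\<tau> * L) powr (- e)" and "Y = (\<sigma>\<^sup>2 * L) powr (- q)"
    have XY: "0 \<le> X" "0 \<le> Y" by (auto simp: X_def Y_def)
    have E: "4 powr (1 / (p - 1)) * (real (n0 + 3) * \<beta> / (\<tau> * L)) powr e + 4 powr (m / (p - m)) * (A / (\<sigma>\<^sup>2 * L)) powr q
      \<le> (a1 + a2) * (X + Y)"
    proof -
      have dv: "(c / d) powr r = c powr r * d powr (- r)" for c d r :: real
        by (simp add: powr_divide powr_minus_divide)
      have "4 powr (1 / (p - 1)) * (real (n0 + 3) * \<beta> / (\<tau> * L)) powr e = a1 * X"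
        unfolding dv a1_def X_def by (simp only: mult.assoc)
      moreover have "4 powr (m / (p - m)) * (A / (\<sigma>\<^sup>2 * L)) powr q = a2 * Y"
        unfolding dv a2_def Y_def by (simp only: mult.assoc)
      moreover have "0 \<le> a1 * Y" "0 \<le> a2 * X" using a1 a2 XY by auto
      ultimately show ?thesis by (simp add: algebra_simps)
    qed
    have S: "(\<Sum>j<nat \<lceil>L\<rceil>. exp (- (real j * q)) * (\<omega> * (\<sigma> * exp ((real j + 1) / 2)) ^ DIM('a) * (\<tau> * exp ((real j + 1) / \<beta>))))
      = \<omega> * (\<sigma> ^ DIM('a) * \<tau>) * exp \<gamma> * level_sum (\<gamma> - q) L"
      unfolding level_sum_def sum_distrib_left
    proof (intro sum.cong refl)
      fix j :: nat
      have "exp (- (real j * q)) * exp ((real j + 1) / 2) ^ DIM('a) * exp ((real j + 1) / \<beta>)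
        = exp (- (real j * q) + DIM('a) * ((real j + 1) / 2) + (real j + 1) / \<beta>)"
        by (simp only: exp_of_nat_mult exp_add)
      also have "\<dots> = exp (\<gamma> + real j * (\<gamma> - q))"
        by (simp add: \<gamma>_def algebra_simps add_divide_distrib)
      finally have "exp (- (real j * q)) * exp ((real j + 1) / 2) ^ DIM('a) * exp ((real j + 1) / \<beta>) = exp \<gamma> * exp (real j * (\<gamma> - q))"
        by (simp only: exp_add)
      then show "exp (- (real j * q)) * (\<omega> * (\<sigma> * exp ((real j + 1) / 2)) ^ DIM('a) * (\<tau> * exp ((real j + 1) / \<beta>)))
        = \<omega> * (\<sigma> ^ DIM('a) * \<tau>) * exp \<gamma> * exp (real j * (\<gamma> - q))"
        by (simp add: power_mult_distrib mult.assoc mult.left_commute)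
    qed
    have "measure \<nu> (ball z \<sigma>) \<le> 2 ^ (n0 + 3) * ((4 powr (1 / (p - 1)) * (real (n0 + 3) * \<beta> / (\<tau> * L)) powr e + 4 powr (m / (p - m)) * (A / (\<sigma>\<^sup>2 * L)) powr q)
      * (\<omega> * (\<sigma> ^ DIM('a) * \<tau>) * exp \<gamma> * level_sum (\<gamma> - q) L))"
      using L.mass_bound[OF \<sigma> \<tau> L n1 n2 \<tau>T, of z]
      unfolding \<nu> \<beta>_def[symmetric] q_def[symmetric] e_def[symmetric] A_def[symmetric] \<omega>_def[symmetric] S .
    also have "\<dots> \<le> 2 ^ (n0 + 3) * (((a1 + a2) * (X + Y)) * (\<omega> * (\<sigma> ^ DIM('a) * \<tau>) * exp \<gamma> * level_sum (\<gamma> - q) L))"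
      using \<omega> \<sigma> \<tau> level_sum_nonneg by (intro mult_left_mono mult_right_mono E) auto
    also have "\<dots> = K * (X + Y) * (\<sigma> ^ DIM('a) * \<tau>) * level_sum (\<gamma> - q) L"
      by (simp add: K_def)
    finally have le: "measure \<nu> (ball z \<sigma>) \<le> K * (X + Y) * (\<sigma> ^ DIM('a) * \<tau>) * level_sum (\<gamma> - q) L" .
    have "radon \<nu>" using tr by (simp add: initial_trace_def)
    then have "sets \<nu> = sets borel" and "\<forall>K. compact K \<longrightarrow> emeasure \<nu> K < \<infinity>" unfolding radon_def by blast+
    then have "sets \<nu> = sets borel" "emeasure \<nu> (cball z \<sigma>) < \<infinity>" using compact_cball by blast+
    then have "emeasure \<nu> (ball z \<sigma>) < \<infinity>"
      using emeasure_mono[of "ball z \<sigma>" "cball z \<sigma>" \<nu>] by (auto simp: ball_subset_cball order_le_less_trans)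
    then have "emeasure \<nu> (ball z \<sigma>) = ennreal (measure \<nu> (ball z \<sigma>))"
      by (intro emeasure_eq_ennreal_measure) auto
    then show "emeasure \<nu> (ball z \<sigma>) \<le> ennreal (K * ((\<tau> * L) powr (- (p / (p - 1))) + (\<sigma>\<^sup>2 * L) powr (- (p / (p - m)))) *
        (\<sigma> ^ DIM('a) * \<tau>) * level_sum (DIM('a) / 2 - 1 / (p - m)) L)"
      using ennreal_leI[OF le[unfolded \<gamma>q]] unfolding X_def Y_def e_def q_def by simp
  qed
qed

text \<open>The time scale \<tau> = a \<sigma>^(1/\<theta>) follows the scaling of the equation: it
  turns (\<tau> L)^(-p/(p - 1)) and (\<sigma>^2 L)^(-p/(p - m)) into multiples of the same power
  \<sigma>^(-2p/(p - m)). Only the dimensionless a and L remain to be chosen.\<close>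

lemma scaled_mass_bound:
  assumes mp: "0 < m" "m < 1" "1 < p"
  obtains K where "0 < K"
    "\<And>T (u :: 'a::euclidean_space \<Rightarrow> real \<Rightarrow> real) \<nu> z \<sigma> a L.
      \<lbrakk>0 < T; solution_E m p (ereal T) u; initial_trace u \<nu>; 0 < \<sigma>; 0 < a; 2 \<le> L;
        a * (\<sigma> * exp (L / 2)) powr (1 / theta m p) < T\<rbrakk> \<Longrightarrow>
      emeasure \<nu> (ball z \<sigma>) \<le> ennreal (K * (a * ((a * L) powr (- (p / (p - 1))) + L powr (- (p / (p - m)))) *
        level_sum (DIM('a) / 2 - 1 / (p - m)) L) * \<sigma> powr (DIM('a) - 2 / (p - m)))"
proof -
  define \<beta> q e where "\<beta> = (p - m) / (p - 1)" and "q = p / (p - m)" and "e = p / (p - 1)"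
  have \<beta>: "1 < \<beta>" using mp by (simp add: \<beta>_def)
  have th: "1 / theta m p = 2 / \<beta>" by (simp add: theta_def \<beta>_def)
  have "- (2 / (x / y)) * (w / y) = - 2 * (w / x)" if "x \<noteq> 0" "y \<noteq> 0" for x y w :: real
    using that by (simp add: field_simps)
  from this[of "p - m" "p - 1" p] have ex1: "- (2 / \<beta>) * e = - 2 * q"
    using mp by (simp add: \<beta>_def e_def q_def)
  have ex2: "real DIM('a) + 2 / \<beta> - 2 * q = DIM('a) - 2 / (p - m)"
  proof -
    have "1 / \<beta> = q - 1 / (p - m)" by (simp add: q_def \<beta>_def flip: diff_divide_distrib)
    moreover have "2 / \<beta> = 2 * (1 / \<beta>)" "2 / (p - m) = 2 * (1 / (p - m))" by simp_all
    ultimately show ?thesis by (simp only: right_diff_distrib)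
  qed
  obtain K where K: "0 < K" and bd: "\<And>T (u :: 'a \<Rightarrow> real \<Rightarrow> real) \<nu> z \<sigma> \<tau> L.
      \<lbrakk>0 < T; solution_E m p T u; initial_trace u \<nu>; 0 < \<sigma>; 0 < \<tau>; 2 \<le> L;
        ereal (\<tau> * exp (L / ((p - m) / (p - 1)))) < T\<rbrakk> \<Longrightarrow>
      emeasure \<nu> (ball z \<sigma>) \<le> ennreal (K * ((\<tau> * L) powr (- (p / (p - 1))) + (\<sigma>\<^sup>2 * L) powr (- (p / (p - m)))) *
        (\<sigma> ^ DIM('a) * \<tau>) * level_sum (DIM('a) / 2 - 1 / (p - m)) L)"
    by (rule ball_mass_bound[OF mp]) (erule that, blast)
  show thesis
  proof (rule that[OF K])
    fix T and u :: "'a \<Rightarrow> real \<Rightarrow> real" and \<nu> :: "'a measure" and z :: 'a and \<sigma> a L :: real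
    assume T: "0 < T" and sol: "solution_E m p (ereal T) u" and tr: "initial_trace u \<nu>"
      and \<sigma>: "0 < \<sigma>" and a: "0 < a" and L: "2 \<le> L" and aT: "a * (\<sigma> * exp (L / 2)) powr (1 / theta m p) < T"
    define \<tau> where "\<tau> = a * \<sigma> powr (2 / \<beta>)"
    have \<tau>: "0 < \<tau>" using a \<sigma> by (simp add: \<tau>_def)
    have "\<tau> * exp (L / \<beta>) = a * (\<sigma> * exp (L / 2)) powr (1 / theta m p)"
      unfolding \<tau>_def th powr_mult by (simp add: exp_powr_real)
    then have "ereal (\<tau> * exp (L / ((p - m) / (p - 1)))) < ereal T" using aT by (simp add: \<beta>_def)
    from bd[OF _ sol tr \<sigma> \<tau> L this, of z] T
    have le: "emeasure \<nu> (ball z \<sigma>) \<le> ennreal (K * ((\<tau> * L) powr (- e) + (\<sigma>\<^sup>2 * L) powr (- q)) *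
        (\<sigma> ^ DIM('a) * \<tau>) * level_sum (DIM('a) / 2 - 1 / (p - m)) L)"
      by (simp add: e_def q_def)
    have s1: "(\<tau> * L) powr (- e) = (a * L) powr (- e) * \<sigma> powr (- 2 * q)"
    proof -
      have "(\<tau> * L) powr (- e) = ((a * L) * \<sigma> powr (2 / \<beta>)) powr (- e)" by (simp add: \<tau>_def ac_simps)
      also have "\<dots> = (a * L) powr (- e) * \<sigma> powr (2 / \<beta> * (- e))" by (simp only: powr_mult powr_powr)
      also have "2 / \<beta> * (- e) = - 2 * q" using ex1 by simp
      finally show ?thesis .
    qed
    have s2: "(\<sigma>\<^sup>2 * L) powr (- q) = L powr (- q) * \<sigma> powr (- 2 * q)"
    proof -
      have "\<sigma>\<^sup>2 = \<sigma> powr 2" using \<sigma> by (simp add: powr_numeral)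
      then show ?thesis by (simp only: powr_mult powr_powr) simp
    qed
    have s3: "\<sigma> powr (- 2 * q) * (\<sigma> ^ DIM('a) * \<tau>) = a * \<sigma> powr (DIM('a) - 2 / (p - m))"
    proof -
      have "\<sigma> ^ DIM('a) = \<sigma> powr DIM('a)" using \<sigma> by (simp add: powr_realpow)
      then have "\<sigma> powr (- 2 * q) * (\<sigma> ^ DIM('a) * \<tau>) = a * (\<sigma> powr (- 2 * q) * \<sigma> powr DIM('a) * \<sigma> powr (2 / \<beta>))"
        by (simp add: \<tau>_def)
      also have "\<dots> = a * \<sigma> powr (real DIM('a) + 2 / \<beta> - 2 * q)"
        unfolding powr_add[symmetric] by (simp add: algebra_simps)
      finally show ?thesis unfolding ex2 .
    qed
    have "K * ((\<tau> * L) powr (- e) + (\<sigma>\<^sup>2 * L) powr (- q)) * (\<sigma> ^ DIM('a) * \<tau>) * level_sum (DIM('a) / 2 - 1 / (p - m)) L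
      = K * ((a * L) powr (- e) + L powr (- q)) * (\<sigma> powr (- 2 * q) * (\<sigma> ^ DIM('a) * \<tau>)) * level_sum (DIM('a) / 2 - 1 / (p - m)) L"
      unfolding s1 s2 by (simp only: algebra_simps)
    also have "\<dots> = K * (a * ((a * L) powr (- e) + L powr (- q)) * level_sum (DIM('a) / 2 - 1 / (p - m)) L) * \<sigma> powr (DIM('a) - 2 / (p - m))"
      unfolding s3 by (simp only: ac_simps)
    finally show "emeasure \<nu> (ball z \<sigma>) \<le> ennreal (K * (a * ((a * L) powr (- (p / (p - 1))) + L powr (- (p / (p - m)))) *
        level_sum (DIM('a) / 2 - 1 / (p - m)) L) * \<sigma> powr (DIM('a) - 2 / (p - m)))"
      using le unfolding e_def q_def by (simp only:)
  qed
qed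

lemma solution_E_initial_trace:
  fixes u :: "'a::euclidean_space \<Rightarrow> real \<Rightarrow> real"
  assumes mp: "0 < m" "m < 1" "1 < p" and T: "0 < T" and sol: "solution_E m p T u"
  shows "\<exists>!\<nu>. initial_trace u \<nu>"
proof -
  have adm: "admissible p T u" using sol by (simp add: solution_E_def)
  obtain v where v: "weak_rep m p T v" "slice_eq T u v"
    by (rule admissible_weak_rep[OF mp T adm])
  interpret weak_rep m p T v by (rule v(1))
  interpret L: weak_limit m p T v by (rule solution_E_weak_limit[OF v(2) sol])
  have tr: "initial_trace u L.\<nu>" by (rule L.initial_trace_\<nu>[OF v(2)])
  show ?thesis
  proof (rule ex1I)
    show "initial_trace u L.\<nu>" by (rule tr)
  qed (rule initial_trace_unique[OF _ tr])
qed

text \<open>The factor \<open>L powr (- ((1 - m) * N / 2))\<close> in the time scale balances the two terms of the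
  critical estimate; a time scale independent of \<open>L\<close> would lose a power of the logarithm.\<close>

lemma critical_exponents:
  fixes a0 :: real
  assumes mp: "0 < m" "m < 1" "1 < p" and N: "0 < N" and crit: "p = m + 2 / N" and L: "1 \<le> L" and a0: "0 < a0"
  defines "a \<equiv> a0 * L powr (- ((1 - m) * N / 2))"
  shows "a * ((a * L) powr (- (p / (p - 1))) + L powr (- (p / (p - m)))) * level_sum (N / 2 - 1 / (p - m)) L
    \<le> 2 * a0 * (a0 powr (- (p / (p - 1))) + 1) * L powr (- (N / 2))"
proof -
  have pm: "p - m = 2 / N" using crit by simp
  have q: "p / (p - m) = p * N / 2" unfolding pm by simp
  \<comment> \<open>This is the exponent of L in the product a L. Raised to -p/(p - 1) it becomes
    -pN/2, the exponent of the other term; this requirement determines the power of L in a.\<close>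
  have p1: "1 - (1 - m) * N / 2 = (p - 1) * N / 2" using crit N by (simp add: field_simps)
  have aL: "(a * L) powr (- (p / (p - 1))) = a0 powr (- (p / (p - 1))) * L powr (- (p * N / 2))"
  proof -
    have "a * L = a0 * (L powr (- ((1 - m) * N / 2)) * L powr 1)" using L by (simp add: a_def)
    also have "\<dots> = a0 * L powr ((p - 1) * N / 2)"
      unfolding powr_add[symmetric] p1[symmetric] by simp
    finally have "(a * L) powr (- (p / (p - 1))) = a0 powr (- (p / (p - 1))) * L powr ((p - 1) * N / 2 * (- (p / (p - 1))))"
      by (simp only: powr_mult powr_powr)
    moreover have "y * N / 2 * (- (p / y)) = - (p * N / 2)" if "y \<noteq> 0" for y
      using that by (simp add: field_simps)
    from this[of "p - 1"] have "(p - 1) * N / 2 * (- (p / (p - 1))) = - (p * N / 2)" using mp by simp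
    ultimately show ?thesis by (simp only:)
  qed
  have "N / 2 - 1 / (p - m) = 0" unfolding pm by simp
  then have S: "level_sum (N / 2 - 1 / (p - m)) L \<le> 2 * L" using level_sum_0_le[OF L] by (simp only:)
  have "a * ((a * L) powr (- (p / (p - 1))) + L powr (- (p / (p - m)))) * level_sum (N / 2 - 1 / (p - m)) L
    \<le> a * ((a * L) powr (- (p / (p - 1))) + L powr (- (p / (p - m)))) * (2 * L)"
    using S a0 by (intro mult_left_mono) (auto simp: a_def)
  also have "\<dots> = 2 * a0 * (a0 powr (- (p / (p - 1))) + 1) * (L powr (- ((1 - m) * N / 2)) * L powr (- (p * N / 2)) * L powr 1)"
    unfolding aL q using L by (simp add: a_def algebra_simps)
  also have "L powr (- ((1 - m) * N / 2)) * L powr (- (p * N / 2)) * L powr 1 = L powr (- (N / 2))"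
  proof -
    have "- ((1 - m) * N / 2) + - (p * N / 2) + 1 = - (N / 2)" using crit N by (simp add: field_simps)
    then show ?thesis unfolding powr_add[symmetric] by (simp only:)
  qed
  finally show ?thesis .
qed

theorem theorem1p1:
  fixes m p :: real
  assumes "0 < m" "m < 1" "1 < p"
  shows
    "(\<exists>C::real. C > 0 \<and>
      (\<forall>(T::real) (u :: 'a::euclidean_space \<Rightarrow> real \<Rightarrow> real).
        0 < T \<and> solution_E m p (ereal T) u \<longrightarrow>
          (\<exists>!\<nu>. initial_trace u \<nu>) \<and>
          (\<forall>\<nu>. initial_trace u \<nu> \<longrightarrow>
            (p < m + 2 / DIM('a) \<longrightarrow>
              (SUP z. emeasure \<nu> (ball z (T powr theta m p)))
                \<le> ennreal (C * T powr (theta m p * (DIM('a) - 2 / (p - m))))) \<and>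
            (p = m + 2 / DIM('a) \<longrightarrow>
              (\<forall>\<sigma>. 0 < \<sigma> \<and> \<sigma> < T powr theta m p \<longrightarrow>
                (SUP z. emeasure \<nu> (ball z \<sigma>))
                  \<le> ennreal (C * ln (exp 1 + T powr theta m p / \<sigma>) powr (- (DIM('a) / 2))))) \<and>
            (p > m + 2 / DIM('a) \<longrightarrow>
              (\<forall>\<sigma>. 0 < \<sigma> \<and> \<sigma> < T powr theta m p \<longrightarrow>
                (SUP z. emeasure \<nu> (ball z \<sigma>))
                  \<le> ennreal (C * \<sigma> powr (DIM('a) - 2 / (p - m)))))))) \<and>
     (\<forall>(T::ereal) (\<mu> :: 'a measure) (u :: 'a \<Rightarrow> real \<Rightarrow> real).
        0 < T \<and> radon \<mu> \<and> solution_P m p T \<mu> u \<longrightarrow>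
          solution_E m p T u \<and> (\<forall>\<nu>. initial_trace u \<nu> \<longleftrightarrow> \<nu> = \<mu>))"
proof -
  note mp = assms
  define N where "N = real DIM('a)"
  define \<theta> where "\<theta> = theta m p"
  define \<delta> where "\<delta> = N / 2 - 1 / (p - m)"
  have N: "0 < N" by (simp add: N_def)
  have \<theta>: "0 < \<theta>" using mp by (simp add: \<theta>_def theta_def)
  obtain K where K: "0 < K" and bd: "\<And>T (u :: 'a \<Rightarrow> real \<Rightarrow> real) \<nu> z \<sigma> a L.
      \<lbrakk>0 < T; solution_E m p (ereal T) u; initial_trace u \<nu>; 0 < \<sigma>; 0 < a; 2 \<le> L;
        a * (\<sigma> * exp (L / 2)) powr (1 / theta m p) < T\<rbrakk> \<Longrightarrow>
      emeasure \<nu> (ball z \<sigma>) \<le> ennreal (K * (a * ((a * L) powr (- (p / (p - 1))) + L powr (- (p / (p - m)))) *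
        level_sum (DIM('a) / 2 - 1 / (p - m)) L) * \<sigma> powr (DIM('a) - 2 / (p - m)))"
    by (rule scaled_mass_bound[OF mp]) (erule that, blast)
  \<comment> \<open>Chosen for L = 2, where the horizon condition reads a1 (\<sigma> e)^(1/\<theta>)
    < T. The left side is \<sigma>^(1/\<theta>) / 2, and the factor 1/2 keeps the inequality strict
    at \<sigma> = T^\<theta>.\<close>
  define a1 where "a1 = exp 1 powr (- (1 / \<theta>)) / 2"
  define C1 where "C1 = K * (a1 * ((a1 * 2) powr (- (p / (p - 1))) + 2 powr (- (p / (p - m)))) * level_sum \<delta> 2)"
  \<comment> \<open>In the critical case the radius \<sigma> e^(L/2) equals \<sigma> e + T^\<theta>,
    which is below (e + 2) T^\<theta>; this value of a0 converts that into the horizon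
    condition.\<close>
  define a0 where "a0 = (exp 1 + 2) powr (- (1 / \<theta>))"
  define C2 where "C2 = K * (2 * a0 * (a0 powr (- (p / (p - 1))) + 1))"
  have a1: "0 < a1" by (simp add: a1_def)
  have e2: "(0::real) < exp 1 + 2" by (intro add_pos_pos) auto
  have a0: "0 < a0" unfolding a0_def using e2 by simp
  have C1: "0 \<le> C1" unfolding C1_def using K a1 level_sum_nonneg by (intro mult_nonneg_nonneg) auto
  have C2: "0 < C2" unfolding C2_def using K a0 by (intro mult_pos_pos add_nonneg_pos) auto
  have powr_theta: "\<sigma> powr (1 / \<theta>) \<le> T" if "0 < \<sigma>" "0 < T" "\<sigma> \<le> T powr \<theta>" for \<sigma> T
  proof -
    have "\<sigma> powr (1 / \<theta>) \<le> (T powr \<theta>) powr (1 / \<theta>)" using that \<theta> by (intro powr_mono2) auto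
    then show ?thesis using that \<theta> by (simp add: powr_powr)
  qed
  \<comment> \<open>The endpoint \<sigma> = T^\<theta> is included because the subcritical bound is
    stated at exactly that radius. The argument for p > p_m is the same.\<close>
  have noncritical: "emeasure \<nu> (ball z \<sigma>) \<le> ennreal ((C1 + C2) * \<sigma> powr (DIM('a) - 2 / (p - m)))"
    if T: "0 < T" and sol: "solution_E m p (ereal T) u" "initial_trace u \<nu>" and \<sigma>: "0 < \<sigma>" "\<sigma> \<le> T powr \<theta>"
    for T \<sigma> and u :: "'a \<Rightarrow> real \<Rightarrow> real" and \<nu> z
  proof -
    have "a1 * (\<sigma> * exp (2 / 2)) powr (1 / theta m p) = \<sigma> powr (1 / \<theta>) * (exp 1 powr (- (1 / \<theta>)) * exp 1 powr (1 / \<theta>)) / 2"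
      unfolding a1_def \<theta>_def powr_mult by simp
    also have "\<dots> = \<sigma> powr (1 / \<theta>) / 2" unfolding powr_add[symmetric] by simp
    also have "\<dots> < T" using powr_theta[OF \<sigma>(1) T \<sigma>(2)] T by simp
    finally have "emeasure \<nu> (ball z \<sigma>) \<le> ennreal (C1 * \<sigma> powr (DIM('a) - 2 / (p - m)))"
      using bd[OF T sol \<sigma>(1) a1, of 2 z] by (simp add: C1_def \<delta>_def N_def)
    also have "\<dots> \<le> ennreal ((C1 + C2) * \<sigma> powr (DIM('a) - 2 / (p - m)))"
      using C2 by (intro ennreal_leI mult_right_mono) auto
    finally show ?thesis .
  qed
  have critical: "emeasure \<nu> (ball z \<sigma>) \<le> ennreal ((C1 + C2) * ln (exp 1 + T powr \<theta> / \<sigma>) powr (- (N / 2)))"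
    if crit: "p = m + 2 / N" and T: "0 < T" and sol: "solution_E m p (ereal T) u" "initial_trace u \<nu>" and \<sigma>: "0 < \<sigma>" "\<sigma> < T powr \<theta>"
    for T \<sigma> and u :: "'a \<Rightarrow> real \<Rightarrow> real" and \<nu> z
  proof -
    define l where "l = ln (exp 1 + T powr \<theta> / \<sigma>)"
    \<comment> \<open>The factor 2 makes e^(L/2) equal to e + T^\<theta>/\<sigma>, and l \<ge> 1
      then gives L \<ge> 2.\<close>
    define L where "L = 2 * l"
    have q0: "0 < T powr \<theta> / \<sigma>" using T \<sigma> by simp
    have pos: "0 < exp 1 + T powr \<theta> / \<sigma>" using q0 by (simp add: add_pos_pos)
    have "ln (exp 1) \<le> l" unfolding l_def using q0 by (subst ln_le_cancel_iff) (auto simp: add_pos_pos)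
    then have l: "1 \<le> l" by simp
    then have L: "2 \<le> L" by (simp add: L_def)
    define a where "a = a0 * L powr (- ((1 - m) * N / 2))"
    have a: "0 < a" using a0 L by (simp add: a_def)
    \<comment> \<open>By m < 1 the extra power of L only shortens the time scale, so the horizon
      condition for a0 carries over to a, whatever L is.\<close>
    have "L powr (- ((1 - m) * N / 2)) \<le> L powr 0" using mp N L by (intro powr_mono) auto
    then have a_le: "a \<le> a0" using a0 L by (simp add: a_def mult_left_le)
    have "\<sigma> * exp (L / 2) = \<sigma> * exp 1 + T powr \<theta>"
      using \<sigma> pos by (simp add: L_def l_def field_simps)
    also have "\<dots> \<le> (exp 1 + 1) * T powr \<theta>" using \<sigma> by (simp add: algebra_simps)
    also have "\<dots> < (exp 1 + 2) * T powr \<theta>" using T by simp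
    finally have less: "\<sigma> * exp (L / 2) < (exp 1 + 2) * T powr \<theta>" .
    have "(\<sigma> * exp (L / 2)) powr (1 / \<theta>) < ((exp 1 + 2) * T powr \<theta>) powr (1 / \<theta>)"
      using less \<sigma> \<theta> by (intro powr_less_mono2) auto
    also have "\<dots> = (exp 1 + 2) powr (1 / \<theta>) * T"
      using T \<theta> by (simp add: powr_mult powr_powr)
    finally have "a0 * (\<sigma> * exp (L / 2)) powr (1 / \<theta>) < a0 * ((exp 1 + 2) powr (1 / \<theta>) * T)"
      using a0 by (rule mult_strict_left_mono)
    also have "\<dots> = ((exp 1 + 2) powr (- (1 / \<theta>)) * (exp 1 + 2) powr (1 / \<theta>)) * T" by (simp add: a0_def)
    also have "\<dots> = T"
      unfolding powr_add[symmetric] using e2 by simp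
    finally have "a0 * (\<sigma> * exp (L / 2)) powr (1 / \<theta>) < T" .
    moreover have "a * (\<sigma> * exp (L / 2)) powr (1 / \<theta>) \<le> a0 * (\<sigma> * exp (L / 2)) powr (1 / \<theta>)"
      using a_le by (intro mult_right_mono) auto
    ultimately have aT: "a * (\<sigma> * exp (L / 2)) powr (1 / theta m p) < T" by (simp add: \<theta>_def)
    have ex0: "real DIM('a) - 2 / (p - m) = 0" using crit N by (simp add: N_def)
    have "emeasure \<nu> (ball z \<sigma>) \<le> ennreal (K * (a * ((a * L) powr (- (p / (p - 1))) + L powr (- (p / (p - m)))) * level_sum (N / 2 - 1 / (p - m)) L))"
      using bd[OF T sol \<sigma>(1) a L aT, of z] \<sigma>(1) unfolding ex0 by (simp add: N_def)
    also have "\<dots> \<le> ennreal (K * (2 * a0 * (a0 powr (- (p / (p - 1))) + 1) * L powr (- (N / 2))))"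
    proof (intro ennreal_leI mult_left_mono)
      show "a * ((a * L) powr (- (p / (p - 1))) + L powr (- (p / (p - m)))) * level_sum (N / 2 - 1 / (p - m)) L
        \<le> 2 * a0 * (a0 powr (- (p / (p - 1))) + 1) * L powr (- (N / 2))"
        unfolding a_def by (rule critical_exponents[OF mp N crit _ a0]) (use L in simp)
    qed (use K in simp)
    also have "\<dots> = ennreal (C2 * L powr (- (N / 2)))" by (simp add: C2_def mult.assoc)
    also have "\<dots> \<le> ennreal ((C1 + C2) * l powr (- (N / 2)))"
    proof (intro ennreal_leI mult_mono)
      show "L powr (- (N / 2)) \<le> l powr (- (N / 2))"
        using l N by (intro powr_mono2') (auto simp: L_def)
    qed (use C1 C2 in auto)
    finally show ?thesis unfolding l_def .
  qed
  show ?thesis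
    unfolding \<theta>_def[symmetric]
  \<comment> \<open>One constant serves all three regimes, and it is positive because C2 is.\<close>
  proof (rule conjI, rule exI[of _ "C1 + C2"], intro conjI allI impI)
    show "0 < C1 + C2" using C1 C2 by simp
  next
    fix T and u :: "'a \<Rightarrow> real \<Rightarrow> real"
    assume "0 < T \<and> solution_E m p (ereal T) u"
    then show "\<exists>!\<nu>. initial_trace u \<nu>" by (intro solution_E_initial_trace[OF mp, of "ereal T"]) auto
  next
    fix T and u :: "'a \<Rightarrow> real \<Rightarrow> real" and \<nu>
    assume "0 < T \<and> solution_E m p (ereal T) u" and tr: "initial_trace u \<nu>"
    then have T: "0 < T" and sol: "solution_E m p (ereal T) u" by auto
    have Tp: "0 < T powr \<theta>" using T by simp
    show "(SUP z. emeasure \<nu> (ball z (T powr \<theta>))) \<le> ennreal ((C1 + C2) * T powr (\<theta> * (DIM('a) - 2 / (p - m))))"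
      using noncritical[OF T sol tr Tp order_refl] by (intro SUP_least) (simp add: powr_powr)
  next
    fix T \<sigma> and u :: "'a \<Rightarrow> real \<Rightarrow> real" and \<nu>
    assume "0 < T \<and> solution_E m p (ereal T) u" and tr: "initial_trace u \<nu>"
      and crit: "p = m + 2 / DIM('a)" and \<sigma>: "0 < \<sigma> \<and> \<sigma> < T powr \<theta>"
    then have T: "0 < T" and sol: "solution_E m p (ereal T) u" by auto
    show "(SUP z. emeasure \<nu> (ball z \<sigma>)) \<le> ennreal ((C1 + C2) * ln (exp 1 + T powr \<theta> / \<sigma>) powr (- (DIM('a) / 2)))"
      using critical[OF crit[folded N_def] T sol tr] \<sigma> by (intro SUP_least) (simp add: N_def)
  next
    fix T \<sigma> and u :: "'a \<Rightarrow> real \<Rightarrow> real" and \<nu>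
    assume "0 < T \<and> solution_E m p (ereal T) u" and tr: "initial_trace u \<nu>" and \<sigma>: "0 < \<sigma> \<and> \<sigma> < T powr \<theta>"
    then have T: "0 < T" and sol: "solution_E m p (ereal T) u" by auto
    show "(SUP z. emeasure \<nu> (ball z \<sigma>)) \<le> ennreal ((C1 + C2) * \<sigma> powr (DIM('a) - 2 / (p - m)))"
      using noncritical[OF T sol tr] \<sigma> by (intro SUP_least) simp
  next
    show "\<forall>(T::ereal) (\<mu> :: 'a measure) (u :: 'a \<Rightarrow> real \<Rightarrow> real).
        0 < T \<and> radon \<mu> \<and> solution_P m p T \<mu> u \<longrightarrow>
          solution_E m p T u \<and> (\<forall>\<nu>. initial_trace u \<nu> \<longleftrightarrow> \<nu> = \<mu>)"
    proof (intro allI impI conjI)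
      fix T :: ereal and \<mu> :: "'a measure" and u :: "'a \<Rightarrow> real \<Rightarrow> real" and \<nu>
      assume "0 < T \<and> radon \<mu> \<and> solution_P m p T \<mu> u"
      then have a: "0 < T" "radon \<mu>" "solution_P m p T \<mu> u" by auto
      show "solution_E m p T u" by (rule solution_P_initial_trace(1)[OF mp a])
      show "initial_trace u \<nu> \<longleftrightarrow> \<nu> = \<mu>" by (rule solution_P_initial_trace(2)[OF mp a])
    qed
  qed
qed

end
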